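(* (Reconstruction equations.) Let $(M,\omega)$ be a (finite dimensional) symplectic manifold and let $G$ be a (finite dimensional) Lie group acting properly and canonically on $M$; let $m\in M$, $H:=G_m$, and let $(Y_r=G\times_H(\mathfrak m_r^*\times(V_m)_r),\omega_{Y_r})$ be the symplectic tubular model at $m$ with projection $\pi:G\times\mathfrak m_r^*\times(V_m)_r\to Y_r$ (see context). Let $h\in C^\infty(Y_r)^G$ be a $G$-invariant function, so that $h\circ\pi$ may be regarded as an $H$-invariant function on $\mathfrak m_r^*\times(V_m)_r$. Let $\tau$ be the locally defined map and put $$\psi(\rho,v):=\tau\big(D_{\mathfrak m^*}(h\circ\pi)(\rho,v),\,\rho+\mathbf J_{V_m}(v)\big)\in\mathfrak q,$$ wherever this is defined. Then, wherever $\psi$ is defined, the Hamiltonian vector field $X_h$ of $h$ on $(Y_r,\omega_{Y_r})$ is given by $X_h([g,\rho,v])=T_{(g,\rho,v)}\pi(X_G,X_{\mathfrak m^*},X_{V_m})$ with $$X_G=T_eL_g\big(\psi(\rho,v)+D_{\mathfrak m^*}(h\circ\pi)(\rho,v)\big),$$ $$X_{\mathfrak m^*}=\mathbb P_{\mathfrak m^*}\big(\mathrm{ad}^*_{D_{\mathfrak m^*}(h\circ\pi)}\rho\big)+\mathbb P_{\mathfrak m^*}\big(\mathrm{ad}^*_{D_{\mathfrak m^*}(h\circ\pi)}\mathbf J_{V_m}(v)\big)+\mathbb P_{\mathfrak m^*}\big(\mathrm{ad}^*_{\psi(\rho,v)}(\rho+\mathbf J_{V_m}(v))\big),$$ $$X_{V_m}=B_{V_m}^\sharp\big(D_{V_m}(h\circ\pi)(\rho,v)\big),$$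 where $D_{\mathfrak m^*}(h\circ\pi)$ in the second formula is evaluated at $(\rho,v)$.
   Context: Conventions. A left action $\Phi:G\times M\to M$ is canonical if $\Phi_g^*\omega=\omega$ for all $g\in G$. $\mathfrak g$ is the Lie algebra of $G$; $\xi_M(m)=\frac{d}{dt}|_{t=0}\exp(t\xi)\cdot m$; $\mathfrak g\cdot m=T_m(G\cdot m)$; the superscript $\omega$ denotes the $\omega(m)$-orthogonal complement. Hamiltonian vector fields satisfy $\mathbf i_{X_h}\omega=\mathbf dh$. $\langle\mathrm{ad}^*_\xi\mu,\eta\rangle=\langle\mu,[\xi,\eta]\rangle$. Symplectic normal space. $V_m:=T_m(G\cdot m)^\omega/(T_m(G\cdot m)^\omega\cap T_m(G\cdot m))$ with symplectic form $\omega_{V_m}([v],[w]):=\omega(m)(v,w)$. $H=G_m$, with Lie algebra $\mathfrak h$, is compact by properness and acts linearly and symplectically on $V_m$ by $h\cdot[v]=[T_m\Phi_hv]$, with momentum map $\mathbf J_{V_m}:V_m\to\mathfrak h^*$, $\langle\mathbf J_{V_m}(v),\zeta\rangle=\frac12\omega_{V_m}(\zeta\cdot v,v)$. Splittings. $\mathfrak k:=\{\eta\in\mathfrak g\mid\eta_M(m)\in(\mathfrak g\cdot m)^\omega\}$ is a Lie subalgebra of $\mathfrak g$ containing $\mathfrak h$. Fix $\mathrm{Ad}_H$-invariant complements $\mathfrak m$ of $\mathfrak h$ in $\mathfrak k$ and $\mathfrak q$ of $\mathfrak k$ in $\mathfrak g$, so $\mathfrak g=\mathfrak h\oplus\mathfrak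 m\oplus\mathfrak q$, $\mathfrak k=\mathfrak h\oplus\mathfrak m$, and dually $\mathfrak g^*=\mathfrak h^*\oplus\mathfrak m^*\oplus\mathfrak q^*$, $\mathfrak k^*=\mathfrak h^*\oplus\mathfrak m^*\subset\mathfrak g^*$, with projections $\mathbb P_{\mathfrak h^*},\mathbb P_{\mathfrak m^*},\mathbb P_{\mathfrak q^*}$. The form $\Omega$. On $G\times\mathfrak k^*$, for $\xi,\eta\in\mathfrak g$ and $\rho,\sigma\in\mathfrak k^*$, let $$\Omega(g,\nu)\big((T_eL_g\xi,\rho),(T_eL_g\eta,\sigma)\big)=\langle\sigma,\xi\rangle-\langle\rho,\eta\rangle+\langle\nu,[\xi,\eta]\rangle+\omega(m)(\xi_M(m),\eta_M(m)).$$ There is an $H$-invariant neighborhood of the origin in $\mathfrak k^*$ of the form $\mathfrak k_r^*=\mathfrak h_r^*\oplus\mathfrak m_r^*$ (with $H$-invariant neighborhoods of the origin in each factor) such that $\Omega$ is symplectic on $G\times\mathfrak k_r^*$. The model. Let $(V_m)_r$ be an $H$-invariant neighborhood of $0$ in $V_m$ with $\mathbf J_{V_m}((V_m)_r)\subset\mathfrak h_r^*$. $Y_r$ is the quotient of $G\times\mathfrak m_r^*\times(V_m)_r$ by the free $H$-action $h\cdot(g,\rho,v)=(gh^{-1},\mathrm{Ad}^*_{h^{-1}}\rho,h\cdot v)$, with projection $\pi$, $[g,\rho,v]:=\pi(g,\rho,v)$, and $G$-action $g'\cdot[g,\rho,v]=[g'g,\rho,v]$. With $l(g,\rho,v)=((g,\rho+\mathbf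 J_{V_m}(v)),v)\in(G\times\mathfrak k_r^* )\times(V_m)_r$, the symplectic form $\omega_{Y_r}$ (a Marsden–Weinstein reduced form at zero for the $H$-action) is the unique two-form with $\pi^*\omega_{Y_r}=l^*(\Omega\oplus\omega_{V_m})$ (neighborhoods taken small enough for $\omega_{Y_r}$ to be symplectic). The map $\tau$. The bilinear form $\langle\xi,\eta\rangle_{\mathfrak q}:=\omega(m)(\xi_M(m),\eta_M(m))$ on $\mathfrak q$ is nondegenerate. Let $F:\mathfrak k\times\mathfrak k^*\times\mathfrak q\to\mathfrak q^*$, $F(\xi,\lambda,\tau)=\mathbb P_{\mathfrak q^*}(\mathrm{ad}^*_{(\xi+\tau)}\lambda)+\langle\tau,\cdot\rangle_{\mathfrak q}$. Then $F(0,0,0)=0$ and $D_{\mathfrak q}F(0,0,0)$ is an isomorphism, and the Implicit Function Theorem gives a smooth map $\tau:\mathfrak k\times\mathfrak k^*\to\mathfrak q$, defined locally around the origin, with $\tau(0,0)=0$ and $\mathbb P_{\mathfrak q^*}\big(\mathrm{ad}^*_{(\xi+\tau(\xi,\lambda))}\lambda\big)+\langle\tau(\xi,\lambda),\cdot\rangle_{\mathfrak q}=0$. Other notation. $D_{\mathfrak m^*}(h\circ\pi)(\rho,v)\in\mathfrak m^{**}\cong\mathfrak m$ and $D_{V_m}(h\circ\pi)(\rho,v)\in V_m^*$ are the partial derivatives; $B^\sharp_{V_m}:V_m^*\to V_m$ is the isomorphism with $\omega_{V_m}(B^\sharp_{V_m}\alpha,w)=\alpha(w)$. *)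

theory Defs
  imports "HOL-Analysis.Analysis" "HOL-Algebra.Group_Action"
begin

section \<open>Smooth functions on open subsets of finite-dimensional subspaces\<close>

text \<open>
  Model spaces are finite-dimensional subspaces \<open>E\<close> of a normed space rather than types of class
  \<^class>\<open>euclidean_space\<close>: that class excludes dimension 0, and \<open>\<mm>\<^sup>*\<close>, \<open>\<kk>\<^sup>*\<close> occur as subspaces of
  \<open>\<gg>\<^sup>*\<close>. If \<open>S\<close> is open in \<open>E\<close> and \<open>x \<in> S\<close>, the derivative at \<open>x\<close> within \<open>S\<close> is uniquely determined
  on \<open>E\<close>; it is only ever applied to vectors of \<open>E\<close>.
\<close>

primrec Ck_on ::
  "nat \<Rightarrow> 'a::real_normed_vector set \<Rightarrow> 'a set \<Rightarrow> ('a \<Rightarrow> 'b::real_normed_vector) \<Rightarrow> bool" where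
  "Ck_on 0 E S f \<longleftrightarrow> continuous_on S f"
| "Ck_on (Suc k) E S f \<longleftrightarrow> (\<forall>x\<in>S. f differentiable (at x within S)) \<and>
     (\<forall>v\<in>E. Ck_on k E S (\<lambda>x. frechet_derivative f (at x within S) v))"

definition smooth_on ::
  "'a::real_normed_vector set \<Rightarrow> 'a set \<Rightarrow> ('a \<Rightarrow> 'b::real_normed_vector) \<Rightarrow> bool" where
  "smooth_on E S f \<longleftrightarrow> (\<forall>k. Ck_on k E S f)"

section \<open>Manifolds\<close>

text \<open>
  A chart is a pair of its domain and its coordinate map. As each point has a preferred chart
  \<open>chart_at M p\<close>, the tangent space at \<open>p\<close> is represented by the model space, a tangent vector being
  given by its coordinates in the preferred chart at \<open>p\<close>.
\<close>

type_synonym ('p, 'e) chart = "'p set \<times> ('p \<Rightarrow> 'e)"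

record ('p, 'e) manifold = "'p partial_object" +
  model :: "'e set"
  atlas :: "('p, 'e) chart set"
  chart_at :: "'p \<Rightarrow> ('p, 'e) chart"

abbreviation chart_dom :: "('p, 'e) chart \<Rightarrow> 'p set" where "chart_dom \<equiv> fst"
abbreviation chart_map :: "('p, 'e) chart \<Rightarrow> 'p \<Rightarrow> 'e" where "chart_map \<equiv> snd"

definition chart_inv :: "('p, 'e) chart \<Rightarrow> 'e \<Rightarrow> 'p" where
  "chart_inv c = inv_into (chart_dom c) (chart_map c)"

definition mtopology :: "('p, 'e::real_normed_vector) manifold \<Rightarrow> 'p topology" where
  "mtopology M = topology (\<lambda>U. U \<subseteq> carrier M \<and>
     (\<forall>c\<in>atlas M. openin (top_of_set (model M)) (chart_map c ` (U \<inter> chart_dom c))))"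

definition smooth_manifold :: "('p, 'e::real_normed_vector) manifold \<Rightarrow> bool" where
  "smooth_manifold M \<longleftrightarrow>
     (\<exists>B. finite B \<and> span B = model M) \<and>
     (\<forall>p\<in>carrier M. chart_at M p \<in> atlas M \<and> p \<in> chart_dom (chart_at M p)) \<and>
     (\<forall>c\<in>atlas M. chart_dom c \<subseteq> carrier M \<and> inj_on (chart_map c) (chart_dom c)) \<and>
     (\<forall>c\<in>atlas M. \<forall>d\<in>atlas M.
        openin (top_of_set (model M)) (chart_map c ` (chart_dom c \<inter> chart_dom d)) \<and>
        smooth_on (model M) (chart_map c ` (chart_dom c \<inter> chart_dom d))
          (chart_map d \<circ> chart_inv c)) \<and>
     Hausdorff_space (mtopology M) \<and> second_countable (mtopology M)"

text \<open>The open subset \<open>S\<close> of the vector space \<open>E\<close>.\<close>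
definition open_mfd :: "'e set \<Rightarrow> 'e set \<Rightarrow> ('e, 'e) manifold" where
  "open_mfd E S = \<lparr>carrier = S, model = E, atlas = {(S, id)}, chart_at = (\<lambda>_. (S, id))\<rparr>"

definition real_mfd :: "(real, real) manifold" where
  "real_mfd = open_mfd UNIV UNIV"

definition prod_chart :: "('p, 'e) chart \<Rightarrow> ('q, 'f) chart \<Rightarrow> ('p \<times> 'q, 'e \<times> 'f) chart" where
  "prod_chart c d = (chart_dom c \<times> chart_dom d, map_prod (chart_map c) (chart_map d))"

definition prod_mfd ::
  "('p, 'e) manifold \<Rightarrow> ('q, 'f) manifold \<Rightarrow> ('p \<times> 'q, 'e \<times> 'f) manifold" where
  "prod_mfd M N = \<lparr>carrier = carrier M \<times> carrier N, model = model M \<times> model N,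
     atlas = {prod_chart c d |c d. c \<in> atlas M \<and> d \<in> atlas N},
     chart_at = (\<lambda>(p, q). prod_chart (chart_at M p) (chart_at N q))\<rparr>"

definition smooth_map ::
  "('p, 'e::real_normed_vector) manifold \<Rightarrow> ('q, 'f::real_normed_vector) manifold \<Rightarrow>
   ('p \<Rightarrow> 'q) \<Rightarrow> bool" where
  "smooth_map M N f \<longleftrightarrow> f \<in> carrier M \<rightarrow> carrier N \<and>
     (\<forall>c\<in>atlas M. \<forall>d\<in>atlas N.
        let S = chart_map c ` {p \<in> chart_dom c. f p \<in> chart_dom d} in
        openin (top_of_set (model M)) S \<and>
        smooth_on (model M) S (chart_map d \<circ> f \<circ> chart_inv c))"

text \<open>The tangent map \<open>T\<^sub>p f : T\<^sub>p M \<Rightarrow> T\<^bsub>f p\<^esub> N\<close>.\<close>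
definition tmap ::
  "('p, 'e::real_normed_vector) manifold \<Rightarrow> ('q, 'f::real_normed_vector) manifold \<Rightarrow>
   ('p \<Rightarrow> 'q) \<Rightarrow> 'p \<Rightarrow> 'e \<Rightarrow> 'f" where
  "tmap M N f p = (let c = chart_at M p; d = chart_at N (f p) in
     frechet_derivative (chart_map d \<circ> f \<circ> chart_inv c)
       (at (chart_map c p) within chart_map c ` chart_dom c))"

definition submersion ::
  "('p, 'e::real_normed_vector) manifold \<Rightarrow> ('q, 'f::real_normed_vector) manifold \<Rightarrow>
   ('p \<Rightarrow> 'q) \<Rightarrow> bool" where
  "submersion M N f \<longleftrightarrow> smooth_map M N f \<and>
     (\<forall>p\<in>carrier M. tmap M N f p ` model M = model N)"

text \<open>Change of coordinates of tangent vectors from the chart \<open>c\<close> to the chart \<open>d\<close> at \<open>x\<close>.\<close>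
definition transition ::
  "('p, 'e::real_normed_vector) chart \<Rightarrow> ('p, 'e) chart \<Rightarrow> 'e \<Rightarrow> 'e \<Rightarrow> 'e" where
  "transition c d x = frechet_derivative (chart_map d \<circ> chart_inv c)
     (at x within chart_map c ` (chart_dom c \<inter> chart_dom d))"

definition field_in ::
  "('p, 'e::real_normed_vector) manifold \<Rightarrow> ('p, 'e) chart \<Rightarrow> ('p \<Rightarrow> 'e) \<Rightarrow> 'e \<Rightarrow> 'e" where
  "field_in M c X x = (let p = chart_inv c x in
     transition (chart_at M p) c (chart_map (chart_at M p) p) (X p))"

text \<open>The sign is that of \<open>[X, Y] f = X (Y f) - Y (X f)\<close>.\<close>
definition field_bracket ::
  "('p, 'e::real_normed_vector) manifold \<Rightarrow> ('p \<Rightarrow> 'e) \<Rightarrow> ('p \<Rightarrow> 'e) \<Rightarrow> 'p \<Rightarrow> 'e" where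
  "field_bracket M X Y p = (let c = chart_at M p; x = chart_map c p;
       F = at x within chart_map c ` chart_dom c in
     frechet_derivative (field_in M c Y) F (field_in M c X x) -
     frechet_derivative (field_in M c X) F (field_in M c Y x))"

section \<open>Symplectic forms\<close>

type_synonym ('p, 'e) form2 = "'p \<Rightarrow> 'e \<Rightarrow> 'e \<Rightarrow> real"

definition form_in ::
  "('p, 'e::real_normed_vector) manifold \<Rightarrow> ('p, 'e) chart \<Rightarrow> ('p, 'e) form2 \<Rightarrow> ('e, 'e) form2"
  where
  "form_in M c \<omega> x v w = (let p = chart_inv c x in
     \<omega> p (transition c (chart_at M p) x v) (transition c (chart_at M p) x w))"

definition two_form ::
  "('p, 'e::real_normed_vector) manifold \<Rightarrow> ('p, 'e) form2 \<Rightarrow> bool" where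
  "two_form M \<omega> \<longleftrightarrow>
     (\<forall>p\<in>carrier M. \<forall>u\<in>model M. \<forall>v\<in>model M. \<forall>w\<in>model M. \<forall>a b.
        \<omega> p (a *\<^sub>R u + b *\<^sub>R v) w = a * \<omega> p u w + b * \<omega> p v w \<and> \<omega> p v w = - \<omega> p w v) \<and>
     (\<forall>c\<in>atlas M. \<forall>v\<in>model M. \<forall>w\<in>model M.
        smooth_on (model M) (chart_map c ` chart_dom c) (\<lambda>x. form_in M c \<omega> x v w))"

text \<open>\<open>d\<omega>(u, v, w)\<close> in a chart, for constant \<open>u, v, w\<close>, is the cyclic sum below.\<close>
definition closed_form ::
  "('p, 'e::real_normed_vector) manifold \<Rightarrow> ('p, 'e) form2 \<Rightarrow> bool" where
  "closed_form M \<omega> \<longleftrightarrow>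
     (\<forall>c\<in>atlas M. \<forall>x\<in>chart_map c ` chart_dom c. \<forall>u\<in>model M. \<forall>v\<in>model M. \<forall>w\<in>model M.
        let D = (\<lambda>a b d. frechet_derivative (\<lambda>y. form_in M c \<omega> y b d)
                   (at x within chart_map c ` chart_dom c) a) in
        D u v w + D v w u + D w u v = 0)"

definition symplectic_form ::
  "('p, 'e::real_normed_vector) manifold \<Rightarrow> ('p, 'e) form2 \<Rightarrow> bool" where
  "symplectic_form M \<omega> \<longleftrightarrow> two_form M \<omega> \<and> closed_form M \<omega> \<and>
     (\<forall>p\<in>carrier M. \<forall>v\<in>model M. (\<forall>w\<in>model M. \<omega> p v w = 0) \<longrightarrow> v = 0)"

definition pullback ::
  "('p, 'e::real_normed_vector) manifold \<Rightarrow> ('q, 'f::real_normed_vector) manifold \<Rightarrow>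
   ('p \<Rightarrow> 'q) \<Rightarrow> ('q, 'f) form2 \<Rightarrow> ('p, 'e) form2" where
  "pullback M N f \<omega> p v w = \<omega> (f p) (tmap M N f p v) (tmap M N f p w)"

definition form_sum :: "('p, 'e) form2 \<Rightarrow> ('q, 'f) form2 \<Rightarrow> ('p \<times> 'q, 'e \<times> 'f) form2" where
  "form_sum \<omega> \<sigma> = (\<lambda>(p, q) (v, v') (w, w'). \<omega> p v w + \<sigma> q v' w')"

definition hamiltonian_field ::
  "('p, 'e::real_normed_vector) manifold \<Rightarrow> ('p, 'e) form2 \<Rightarrow> ('p \<Rightarrow> real) \<Rightarrow> 'p \<Rightarrow> 'e" where
  "hamiltonian_field M \<omega> f p =
     (THE X. X \<in> model M \<and> (\<forall>w\<in>model M. \<omega> p X w = tmap M real_mfd f p w))"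

definition orth_compl :: "'e set \<Rightarrow> ('e \<Rightarrow> 'e \<Rightarrow> real) \<Rightarrow> 'e set \<Rightarrow> 'e set" where
  "orth_compl E b A = {v \<in> E. \<forall>w\<in>A. b v w = 0}"

section \<open>Lie groups\<close>

text \<open>
  The model space of \<open>M\<close> is required to be a full type, so that the Lie algebra (the tangent space at
  the identity) is the type \<open>'g\<close> and its dual is \<open>'g \<Rightarrow>\<^sub>L real\<close>. As \<open>'g\<close> is an arbitrary normed space
  and \<^const>\<open>smooth_manifold\<close> makes it finite-dimensional, every dimension, including 0, is allowed.
\<close>
definition lie_group ::
  "'a monoid \<Rightarrow> ('a, 'g::real_normed_vector) manifold \<Rightarrow> bool" where
  "lie_group G M \<longleftrightarrow> group G \<and> smooth_manifold M \<and> carrier M = carrier G \<and> model M = UNIV \<and>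
     smooth_map (prod_mfd M M) M (\<lambda>(x, y). x \<otimes>\<^bsub>G\<^esub> y) \<and>
     smooth_map M M (\<lambda>x. inv\<^bsub>G\<^esub> x)"

text \<open>\<open>left_tr G M a g\<close> is the tangent map \<open>T\<^sub>a L\<^sub>g\<close>.\<close>
definition left_tr ::
  "'a monoid \<Rightarrow> ('a, 'g::real_normed_vector) manifold \<Rightarrow> 'a \<Rightarrow> 'a \<Rightarrow> 'g \<Rightarrow> 'g" where
  "left_tr G M a g = tmap M M (\<lambda>x. g \<otimes>\<^bsub>G\<^esub> x) a"

definition lie_bracket ::
  "'a monoid \<Rightarrow> ('a, 'g::real_normed_vector) manifold \<Rightarrow> 'g \<Rightarrow> 'g \<Rightarrow> 'g" where
  "lie_bracket G M \<xi> \<eta> = field_bracket M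
     (\<lambda>g. left_tr G M \<one>\<^bsub>G\<^esub> g \<xi>) (\<lambda>g. left_tr G M \<one>\<^bsub>G\<^esub> g \<eta>) \<one>\<^bsub>G\<^esub>"

text \<open>
  The property determines the exponential map uniquely: \<open>t \<mapsto> exp (t \<xi>)\<close> is the one-parameter
  subgroup with initial velocity \<open>\<xi>\<close>.
\<close>
definition exponential_map ::
  "'a monoid \<Rightarrow> ('a, 'g::real_normed_vector) manifold \<Rightarrow> ('g \<Rightarrow> 'a) \<Rightarrow> bool" where
  "exponential_map G M e \<longleftrightarrow> (\<forall>\<xi>.
     smooth_map real_mfd M (\<lambda>t. e (t *\<^sub>R \<xi>)) \<and>
     (\<forall>s t. e ((s + t) *\<^sub>R \<xi>) = e (s *\<^sub>R \<xi>) \<otimes>\<^bsub>G\<^esub> e (t *\<^sub>R \<xi>)) \<and>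
     tmap real_mfd M (\<lambda>t. e (t *\<^sub>R \<xi>)) 0 1 = \<xi>)"

definition subgroup_algebra :: "('g::real_vector \<Rightarrow> 'a) \<Rightarrow> 'a set \<Rightarrow> 'g set" where
  "subgroup_algebra e H = {\<xi>. \<forall>t::real. e (t *\<^sub>R \<xi>) \<in> H}"

definition Ad :: "'a monoid \<Rightarrow> ('a, 'g::real_normed_vector) manifold \<Rightarrow> 'a \<Rightarrow> 'g \<Rightarrow> 'g" where
  "Ad G M g = tmap M M (\<lambda>x. g \<otimes>\<^bsub>G\<^esub> x \<otimes>\<^bsub>G\<^esub> inv\<^bsub>G\<^esub> g) \<one>\<^bsub>G\<^esub>"

text \<open>\<open>\<langle>Ad\<^sup>*\<^sub>g \<mu>, \<eta>\<rangle> = \<langle>\<mu>, Ad\<^sub>g \<eta>\<rangle>\<close>, without inverse, so \<open>g \<mapsto> Ad\<^sup>*\<close> of \<open>g\<^sup>-\<^sup>1\<close> is the left action.\<close>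
definition coAd ::
  "'a monoid \<Rightarrow> ('a, 'g::real_normed_vector) manifold \<Rightarrow> 'a \<Rightarrow> ('g \<Rightarrow>\<^sub>L real) \<Rightarrow> ('g \<Rightarrow>\<^sub>L real)"
  where "coAd G M g \<mu> = Blinfun (\<lambda>\<eta>. blinfun_apply \<mu> (Ad G M g \<eta>))"

definition coad ::
  "'a monoid \<Rightarrow> ('a, 'g::real_normed_vector) manifold \<Rightarrow> 'g \<Rightarrow> ('g \<Rightarrow>\<^sub>L real) \<Rightarrow> ('g \<Rightarrow>\<^sub>L real)"
  where "coad G M \<xi> \<mu> = Blinfun (\<lambda>\<eta>. blinfun_apply \<mu> (lie_bracket G M \<xi> \<eta>))"

section \<open>Actions\<close>

definition smooth_action ::
  "'a monoid \<Rightarrow> ('a, 'g::real_normed_vector) manifold \<Rightarrow> ('p, 'e::real_normed_vector) manifold \<Rightarrow>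
   ('a \<Rightarrow> 'p \<Rightarrow> 'p) \<Rightarrow> bool" where
  "smooth_action G LG M \<Phi> \<longleftrightarrow> smooth_map (prod_mfd LG M) M (\<lambda>(g, p). \<Phi> g p) \<and>
     (\<forall>p\<in>carrier M. \<Phi> \<one>\<^bsub>G\<^esub> p = p \<and>
        (\<forall>g\<in>carrier G. \<forall>g'\<in>carrier G. \<Phi> (g \<otimes>\<^bsub>G\<^esub> g') p = \<Phi> g (\<Phi> g' p)))"

definition proper_action ::
  "('a, 'g::real_normed_vector) manifold \<Rightarrow> ('p, 'e::real_normed_vector) manifold \<Rightarrow>
   ('a \<Rightarrow> 'p \<Rightarrow> 'p) \<Rightarrow> bool" where
  "proper_action LG M \<Phi> \<longleftrightarrow>
     proper_map (prod_topology (mtopology LG) (mtopology M))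
       (prod_topology (mtopology M) (mtopology M)) (\<lambda>(g, p). (p, \<Phi> g p))"

definition canonical_action ::
  "'a monoid \<Rightarrow> ('p, 'e::real_normed_vector) manifold \<Rightarrow> ('p, 'e) form2 \<Rightarrow>
   ('a \<Rightarrow> 'p \<Rightarrow> 'p) \<Rightarrow> bool" where
  "canonical_action G M \<omega> \<Phi> \<longleftrightarrow>
     (\<forall>g\<in>carrier G. \<forall>p\<in>carrier M. \<forall>v\<in>model M. \<forall>w\<in>model M.
        pullback M M (\<Phi> g) \<omega> p v w = \<omega> p v w)"

definition inf_generator ::
  "('p, 'e::real_normed_vector) manifold \<Rightarrow> ('a \<Rightarrow> 'p \<Rightarrow> 'p) \<Rightarrow> ('g::real_vector \<Rightarrow> 'a) \<Rightarrow>
   'g \<Rightarrow> 'p \<Rightarrow> 'e" where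
  "inf_generator M \<Phi> e \<xi> p = tmap real_mfd M (\<lambda>t. \<Phi> (e (t *\<^sub>R \<xi>)) p) 0 1"

section \<open>Linear algebra\<close>

text \<open>\<open>q\<close> exhibits the whole type \<open>'v\<close> as the quotient vector space \<open>N / W\<close>, with \<open>[x] = q x\<close>.\<close>
definition quotient_space ::
  "'e::real_vector set \<Rightarrow> 'e set \<Rightarrow> ('e \<Rightarrow> 'v::real_vector) \<Rightarrow> bool" where
  "quotient_space N W q \<longleftrightarrow>
     (\<forall>x\<in>N. \<forall>y\<in>N. q (x + y) = q x + q y) \<and> (\<forall>x\<in>N. \<forall>a. q (a *\<^sub>R x) = a *\<^sub>R q x) \<and>
     q ` N = UNIV \<and> {x \<in> N. q x = 0} = W"

definition direct_sum_of :: "'g::real_vector set \<Rightarrow> 'g set \<Rightarrow> 'g set \<Rightarrow> bool" where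
  "direct_sum_of A B C \<longleftrightarrow> subspace A \<and> subspace B \<and> A \<inter> B = {0} \<and> {a + b |a b. a \<in> A \<and> b \<in> B} = C"

text \<open>Projection onto \<open>A\<close> along \<open>B\<close>.\<close>
definition proj_along :: "'g::real_vector set \<Rightarrow> 'g set \<Rightarrow> 'g \<Rightarrow> 'g" where
  "proj_along A B x = (THE a. a \<in> A \<and> x - a \<in> B)"

text \<open>
  For \<open>\<gg> = A \<oplus> B\<close>, the inclusion \<open>A\<^sup>* \<subseteq> \<gg>\<^sup>*\<close> of the dual splitting extends functionals by 0 on \<open>B\<close>.
\<close>
definition dual_summand :: "'g::real_normed_vector set \<Rightarrow> ('g \<Rightarrow>\<^sub>L real) set" where
  "dual_summand B = {\<mu>. \<forall>\<xi>\<in>B. blinfun_apply \<mu> \<xi> = 0}"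

definition dual_proj ::
  "'g::real_normed_vector set \<Rightarrow> 'g set \<Rightarrow> ('g \<Rightarrow>\<^sub>L real) \<Rightarrow> ('g \<Rightarrow>\<^sub>L real)" where
  "dual_proj A B \<mu> = Blinfun (\<lambda>\<xi>. blinfun_apply \<mu> (proj_along A B \<xi>))"

end

theory Submission
  imports Defs
begin

text \<open>
  As \<open>T\<pi>\<close> is onto and \<open>\<omega>\<^sub>Y\<close> is nondegenerate, it suffices that the vector \<open>X\<close> on
  \<open>G \<times> \<mm>\<^sup>* \<times> V\<close> given by the right-hand sides satisfies \<open>l\<^sup>* (\<Omega> \<oplus> \<omega>\<^sub>V) (X, X') = d (h \<circ> \<pi>) X'\<close> for all
  \<open>X'\<close>. The terms along \<open>\<mm>\<^sup>*\<close> and \<open>V\<close> agree by the choice of \<open>D\<^sub>m\<close> and \<open>B\<^sub>V\<close>, since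
  \<open>J\<close> takes values in \<open>\<hh>\<^sup>*\<close>. The term along \<open>\<gg> = \<hh> \<oplus> \<mm> \<oplus> \<qq>\<close> must vanish because \<open>h\<close> is
  \<open>G\<close>-invariant: on \<open>\<qq>\<close> this is the equation defining \<open>\<tau>\<close>, on \<open>\<mm>\<close> the formula for the
  \<open>\<mm>\<^sup>*\<close>-component, and on \<open>\<hh>\<close> it amounts to \<open>\<langle>\<rho>, [\<eta>, D\<^sub>m]\<rangle> = D\<^sub>V (\<eta> \<cdot> x)\<close>, the derivative of the
  \<open>H\<close>-invariance of \<open>h \<circ> \<pi>\<close> along \<open>exp (t \<eta>)\<close>.
\<close>

section \<open>Finite-dimensional subspaces of normed spaces\<close>

text \<open>Two encodings shape the work. A tangent vector is a coordinate vector in the preferred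
  chart at its point, and preferred charts need not vary continuously with the point; whatever is
  differentiated along \<open>exp (t \<eta>)\<close> is therefore read in one fixed chart, at the
  identity of G or at m. And the model spaces are subspaces of arbitrary normed spaces, dimension 0
  included, so completeness, boundedness of linear maps and derivatives within a subspace are built
  from a finite spanning set. The analytic core is that \<open>Ad (exp (t \<eta>)) \<zeta>\<close>
  has derivative [\<eta>, \<zeta>] at 0, for the bracket defined by left-invariant fields. This
  comes from the symmetry of the second derivative of the multiplication in the chart at the
  identity. It yields [\<hh>, \<mm>] \<subseteq> \<mm>, [\<hh>, \<qq>] \<subseteq> \<qq> and the
  derivative of the coadjoint action, which the \<hh>-part rests on. The terms with the derivative
  of J cancel without any choice: the factor 1/2 in J is absorbed by the two equal terms of the
  product rule, so this derivative pairs exactly with the reduced form.\<close>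

definition fin_dim :: "'a::real_vector set \<Rightarrow> bool" where
  "fin_dim S \<longleftrightarrow> (\<exists>B. finite B \<and> span B = S)"

text \<open>Linearity is asked only on \<open>S\<close>, because \<open>cls\<close>,
  \<open>\<omega> m\<close> and \<open>\<zeta> \<mapsto> genV \<zeta> x\<close> are controlled only
  on \<open>N\<close>, on the model space and on \<open>\<hh>\<close>.\<close>

definition lin_on :: "'a::real_vector set \<Rightarrow> ('a \<Rightarrow> 'b::real_vector) \<Rightarrow> bool" where
  "lin_on S f \<longleftrightarrow> (\<forall>x\<in>S. \<forall>y\<in>S. f (x + y) = f x + f y) \<and> (\<forall>x\<in>S. \<forall>a. f (a *\<^sub>R x) = a *\<^sub>R f x)"

lemma lin_on_UNIV_linear: "lin_on UNIV f \<longleftrightarrow> linear f"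
  by (auto simp: lin_on_def intro: linearI simp: linear_add linear_scale)

lemma linear_lin_on: "linear f \<Longrightarrow> lin_on S f"
  by (simp add: lin_on_def linear_add linear_scale)

lemma lin_on_add: "lin_on S f \<Longrightarrow> x \<in> S \<Longrightarrow> y \<in> S \<Longrightarrow> f (x + y) = f x + f y"
  and lin_on_scale: "lin_on S f \<Longrightarrow> x \<in> S \<Longrightarrow> f (a *\<^sub>R x) = a *\<^sub>R f x"
  unfolding lin_on_def by blast+

lemma lin_on_zero: "lin_on S f \<Longrightarrow> 0 \<in> S \<Longrightarrow> f 0 = 0"
  using lin_on_scale[of S f 0 0] by simp

lemma lin_on_minus: "lin_on S f \<Longrightarrow> subspace S \<Longrightarrow> x \<in> S \<Longrightarrow> f (- x) = - f x"
  using lin_on_scale[of S f x "-1"] by simp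

lemma lin_on_diff:
  "lin_on S f \<Longrightarrow> subspace S \<Longrightarrow> x \<in> S \<Longrightarrow> y \<in> S \<Longrightarrow> f (x - y) = f x - f y"
  using lin_on_add[of S f x "- y"] lin_on_minus[of S f y] by (simp add: subspace_neg)

lemma lin_on_sum:
  assumes "lin_on S f" "subspace S" "finite A" "\<And>a. a \<in> A \<Longrightarrow> g a \<in> S"
  shows "f (\<Sum>a\<in>A. g a) = (\<Sum>a\<in>A. f (g a))"
  using assms(3,4)
  by (induction A rule: finite_induct)
     (auto simp: lin_on_zero[OF assms(1)] subspace_0[OF assms(2)] lin_on_add[OF assms(1)]
        subspace_sum[OF assms(2)])

lemma fin_dim_subspace: "fin_dim S \<Longrightarrow> subspace S"
  unfolding fin_dim_def by auto

lemma fin_dim_basis: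
  assumes "fin_dim S"
  obtains B where "finite B" "independent B" "span B = S"
proof -
  obtain C where C: "finite C" "span C = S" using assms fin_dim_def by blast
  obtain B where B: "B \<subseteq> C" "independent B" "C \<subseteq> span B"
    using maximal_independent_subset[of C] by blast
  have "span B = span C" using B by (metis span_eq span_mono span_superset subset_trans)
  with that[of B] B C finite_subset show ?thesis by blast
qed

text \<open>Induction on the spanning set. A vector \<open>b\<close> outside the complete, hence
  closed, span has positive distance \<open>d\<close> from it, and rescaling bounds the coefficient
  of \<open>b\<close> in any vector by its norm over \<open>d\<close>. Along a Cauchy sequence the
  coefficients are thus Cauchy, and so are the remainders in the old span.\<close>

lemma complete_span_finite:
  fixes B :: "'a::real_normed_vector set"
  assumes "finite B" shows "complete (span B)"
  using assms
proof (induction B rule: finite_induct)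
  case empty
  show ?case by (simp add: compact_imp_complete)
next
  case (insert b B)
  show ?case
  proof (cases "b \<in> span B")
    case True
    then show ?thesis using insert.IH by (simp add: span_redundant)
  next
    case False
    define d where "d = infdist b (span B)"
    have "closed (span B)" using insert.IH by (rule complete_imp_closed)
    then have d: "d > 0"
      using False in_closed_iff_infdist_zero[of "span B" b] infdist_nonneg[of b "span B"] span_zero[of B]
      unfolding d_def by force
    have bound: "\<bar>k\<bar> * d \<le> norm (k *\<^sub>R b + w)" if "w \<in> span B" for k w
    proof (cases "k = 0")
      case False
      have "- (1 / k) *\<^sub>R w \<in> span B" using that by (intro span_scale)
      then have "d \<le> dist b (- (1 / k) *\<^sub>R w)" unfolding d_def by (rule infdist_le)
      also have "\<dots> = norm (b + (1 / k) *\<^sub>R w)" by (simp add: dist_norm)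
      finally have "\<bar>k\<bar> * d \<le> norm (k *\<^sub>R (b + (1 / k) *\<^sub>R w))"
        by (simp add: mult_left_mono)
      then show ?thesis using False by (simp add: algebra_simps)
    qed auto
    show ?thesis unfolding complete_def
    proof (intro allI impI)
      fix X :: "nat \<Rightarrow> 'a" assume X: "(\<forall>n. X n \<in> span (insert b B)) \<and> Cauchy X"
      then have "\<forall>n. \<exists>k. X n - k *\<^sub>R b \<in> span B" using span_breakdown_eq by blast
      then obtain k where k: "\<And>n. X n - k n *\<^sub>R b \<in> span B" by metis
      have kb: "\<bar>k i - k j\<bar> * d \<le> norm (X i - X j)" for i j
      proof -
        have "(k i - k j) *\<^sub>R b + ((X i - k i *\<^sub>R b) - (X j - k j *\<^sub>R b)) = X i - X j"
          by (simp add: algebra_simps)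
        then show ?thesis using bound[OF span_diff[OF k k], of "k i - k j" i j] by metis
      qed
      have "Cauchy k"
      proof (rule metric_CauchyI)
        fix e :: real assume "e > 0"
        then obtain N where "\<And>i j. i \<ge> N \<Longrightarrow> j \<ge> N \<Longrightarrow> norm (X i - X j) < e * d"
          using X d metric_CauchyD[of X "e * d"] by (metis dist_norm mult_pos_pos)
        then show "\<exists>M. \<forall>m\<ge>M. \<forall>n\<ge>M. dist (k m) (k n) < e"
          using kb d by (metis dist_real_def le_less_trans mult_less_cancel_right_pos)
      qed
      then obtain c where c: "k \<longlonglongrightarrow> c" using Cauchy_convergent convergent_def by blast
      have kb_Cauchy: "Cauchy (\<lambda>n. k n *\<^sub>R b)"
        by (rule LIMSEQ_imp_Cauchy[OF tendsto_scaleR[OF c tendsto_const]])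
      have "Cauchy (\<lambda>n. X n - k n *\<^sub>R b)"
      proof (rule CauchyI)
        fix e :: real assume "e > 0"
        then have "e / 2 > 0" by simp
        then obtain N1 N2 where N: "\<forall>i\<ge>N1. \<forall>j\<ge>N1. norm (X i - X j) < e / 2"
            "\<forall>i\<ge>N2. \<forall>j\<ge>N2. norm (k i *\<^sub>R b - k j *\<^sub>R b) < e / 2"
          using X kb_Cauchy unfolding Cauchy_iff by meson
        have "norm ((X i - k i *\<^sub>R b) - (X j - k j *\<^sub>R b)) < e"
          if "i \<ge> max N1 N2" "j \<ge> max N1 N2" for i j
        proof -
          have "(X i - k i *\<^sub>R b) - (X j - k j *\<^sub>R b) = (X i - X j) - (k i *\<^sub>R b - k j *\<^sub>R b)" by simp
          also have "norm \<dots> \<le> norm (X i - X j) + norm (k i *\<^sub>R b - k j *\<^sub>R b)"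
            by (rule norm_triangle_ineq4)
          also have "\<dots> < e / 2 + e / 2" using N that by (intro add_strict_mono) auto
          finally show ?thesis by simp
        qed
        then show "\<exists>M. \<forall>m\<ge>M. \<forall>n\<ge>M. norm ((X m - k m *\<^sub>R b) - (X n - k n *\<^sub>R b)) < e" by blast
      qed
      then obtain w where w: "w \<in> span B" "(\<lambda>n. X n - k n *\<^sub>R b) \<longlonglongrightarrow> w"
        using insert.IH[unfolded complete_def, rule_format, of "\<lambda>n. X n - k n *\<^sub>R b"] k by blast
      have "(\<lambda>n. (X n - k n *\<^sub>R b) + k n *\<^sub>R b) \<longlonglongrightarrow> w + c *\<^sub>R b"
        using w c by (intro tendsto_intros)
      moreover have "w + c *\<^sub>R b \<in> span (insert b B)"
        using w by (metis add_diff_cancel_right' span_breakdown_eq)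
      ultimately show "\<exists>l\<in>span (insert b B). X \<longlonglongrightarrow> l" by auto
    qed
  qed
qed

lemma fin_dim_closed: "fin_dim S \<Longrightarrow> closed (S :: 'a::real_normed_vector set)"
  unfolding fin_dim_def by (auto intro: complete_imp_closed complete_span_finite)

text \<open>The distance from \<open>b\<close> to the closed span of the other basis vectors is
  positive, and its reciprocal bounds the \<open>b\<close>-coordinate. Boundedness of all linear
  maps on finite-dimensional subspaces rests on this.\<close>

lemma bounded_representation:
  fixes B :: "'a::real_normed_vector set"
  assumes B: "finite B" "independent B" and b: "b \<in> B"
  shows "\<exists>K. \<forall>x\<in>span B. \<bar>representation B x b\<bar> \<le> K * norm x"
proof -
  define S where "S = span (B - {b})"
  define d where "d = infdist b S"
  have "closed S" unfolding S_def using B by (intro complete_imp_closed complete_span_finite) auto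
  moreover have "b \<notin> S" using B b dependent_def S_def by blast
  ultimately have d: "d > 0"
    using in_closed_iff_infdist_zero[of S b] infdist_nonneg[of b S] span_zero[of "B - {b}"]
    unfolding d_def S_def by force
  have "\<bar>representation B x b\<bar> \<le> (1 / d) * norm x" if x: "x \<in> span B" for x
  proof (cases "representation B x b = 0")
    case True
    then show ?thesis using d by simp
  next
    case False
    define r where "r = representation B x"
    define w where "w = (\<Sum>c\<in>B - {b}. r c *\<^sub>R c)"
    have "x = (\<Sum>c\<in>B. r c *\<^sub>R c)"
      unfolding r_def using sum_representation_eq[OF B(2) x B(1) order_refl] by simp
    also have "\<dots> = r b *\<^sub>R b + w" unfolding w_def using B b by (simp add: sum.remove)
    finally have xw: "x = r b *\<^sub>R b + w" .
    have "w \<in> S" unfolding w_def S_def by (intro span_sum span_scale span_base)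
    then have "- (1 / r b) *\<^sub>R w \<in> S" unfolding S_def by (intro span_scale)
    then have "d \<le> dist b (- (1 / r b) *\<^sub>R w)" unfolding d_def by (rule infdist_le)
    also have "\<dots> = norm (b + (1 / r b) *\<^sub>R w)" by (simp add: dist_norm)
    finally have "\<bar>r b\<bar> * d \<le> norm (r b *\<^sub>R (b + (1 / r b) *\<^sub>R w))" by (simp add: mult_left_mono)
    also have "r b *\<^sub>R (b + (1 / r b) *\<^sub>R w) = x"
      using False by (subst xw) (simp add: scaleR_right_distrib r_def)
    finally show ?thesis using d unfolding r_def by (simp add: field_simps)
  qed
  then show ?thesis by blast
qed

lemma lin_on_eq_sum_basis:
  assumes B: "finite B" "independent B" and f: "lin_on (span B) f" and x: "x \<in> span B"
  shows "f x = (\<Sum>b\<in>B. representation B x b *\<^sub>R f b)"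
proof -
  have "f x = f (\<Sum>c\<in>B. representation B x c *\<^sub>R c)"
    using sum_representation_eq[OF B(2) x B(1) order_refl] by simp
  also have "\<dots> = (\<Sum>b\<in>B. f (representation B x b *\<^sub>R b))"
    by (rule lin_on_sum[OF f]) (auto simp: B intro: span_scale span_base)
  finally show ?thesis using lin_on_scale[OF f] by (simp add: span_base)
qed

lemma fin_dim_lin_on_bounded:
  fixes f :: "'a::real_normed_vector \<Rightarrow> 'b::real_normed_vector"
  assumes S: "fin_dim S" and f: "lin_on S f"
  obtains K where "K > 0" "\<And>x. x \<in> S \<Longrightarrow> norm (f x) \<le> K * norm x"
proof -
  obtain B where B: "finite B" "independent B" "span B = S" using fin_dim_basis[OF S] .
  have "\<forall>b\<in>B. \<exists>K. \<forall>x\<in>S. \<bar>representation B x b\<bar> \<le> K * norm x"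
    using bounded_representation[OF B(1,2)] B(3) by blast
  then obtain k where k: "\<And>b x. b \<in> B \<Longrightarrow> x \<in> S \<Longrightarrow> \<bar>representation B x b\<bar> \<le> k b * norm x"
    by metis
  define K where "K = (\<Sum>b\<in>B. k b * norm (f b))"
  have le: "norm (f x) \<le> K * norm x" if x: "x \<in> S" for x
  proof -
    have "f x = (\<Sum>b\<in>B. representation B x b *\<^sub>R f b)"
      using lin_on_eq_sum_basis[OF B(1,2)] f x B(3) by blast
    then have "norm (f x) \<le> (\<Sum>b\<in>B. norm (representation B x b *\<^sub>R f b))"
      using norm_sum by metis
    also have "\<dots> \<le> (\<Sum>b\<in>B. (k b * norm x) * norm (f b))"
      using k x by (intro sum_mono) (auto intro: mult_right_mono)
    also have "\<dots> = K * norm x" unfolding K_def by (simp add: sum_distrib_right sum_distrib_left mult_ac)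
    finally show ?thesis .
  qed
  \<comment> \<open>Passing to \<open>\<bar>K\<bar> + 1\<close> keeps the constant positive even
    when the basis is empty.\<close>
  show ?thesis
  proof (rule that[of "\<bar>K\<bar> + 1"])
    fix x assume "x \<in> S"
    then show "norm (f x) \<le> (\<bar>K\<bar> + 1) * norm x"
      by (intro order_trans[OF le mult_right_mono]) auto
  qed simp
qed

lemma fin_dim_linear_bounded:
  fixes f :: "'a::real_normed_vector \<Rightarrow> 'b::real_normed_vector"
  assumes "fin_dim (UNIV :: 'a set)" "linear f" shows "bounded_linear f"
proof -
  obtain K where "\<And>x. norm (f x) \<le> K * norm x"
    using fin_dim_lin_on_bounded[OF assms(1) linear_lin_on[OF assms(2)]] by (metis UNIV_I)
  then show ?thesis
    using assms(2) by (intro bounded_linear_intro[of f K]) (auto simp: linear_add linear_scale mult.commute)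
qed

text \<open>By currying: \<open>x \<mapsto> Blinfun (f x)\<close> is a linear map into a normed
  space, so the linear case applies a second time.\<close>

lemma fin_dim_bilinear_bounded:
  fixes f :: "'a::real_normed_vector \<Rightarrow> 'b::real_normed_vector \<Rightarrow> 'c::real_normed_vector"
  assumes A: "fin_dim (UNIV :: 'a set)" "fin_dim (UNIV :: 'b set)"
    and l: "\<And>y. linear (\<lambda>x. f x y)" and r: "\<And>x. linear (f x)"
  shows "bounded_bilinear f"
proof -
  have bl: "bounded_linear (f x)" for x by (rule fin_dim_linear_bounded[OF A(2) r])
  have "linear (\<lambda>x. Blinfun (f x))"
    by (intro linearI blinfun_eqI)
       (auto simp: bounded_linear_Blinfun_apply bl linear_add[OF l] linear_scale[OF l]
          blinfun.add_left blinfun.scaleR_left)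
  then interpret bounded_linear "\<lambda>x. Blinfun (f x)" by (rule fin_dim_linear_bounded[OF A(1)])
  obtain K where K: "\<And>x. norm (Blinfun (f x)) \<le> norm x * K" using bounded by blast
  have "norm (f x y) \<le> norm x * norm y * K" for x y
  proof -
    have "norm (f x y) \<le> norm (Blinfun (f x)) * norm y"
      using norm_blinfun[of "Blinfun (f x)" y] by (simp add: bounded_linear_Blinfun_apply bl)
    also have "\<dots> \<le> norm x * K * norm y" using K by (intro mult_right_mono) auto
    finally show ?thesis by (simp add: mult_ac)
  qed
  then show ?thesis
    by (intro bounded_bilinear.intro exI)
       (auto simp: linear_add[OF l] linear_scale[OF l] linear_add[OF r] linear_scale[OF r])
qed

text \<open>The functionals \<open>r b\<close> are the coordinates dual to \<open>B\<close>. The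
  second expansion recovers an element of the dual from its values on \<open>B\<close>, so that
  derivatives of maps into the dual can be computed one real coordinate at a time.\<close>

lemma fin_dim_dual_basis:
  assumes "fin_dim (UNIV :: 'a::real_normed_vector set)"
  obtains B :: "'a::real_normed_vector set" and r :: "'a::real_normed_vector \<Rightarrow> 'a \<Rightarrow>\<^sub>L real"
  where "finite B" "\<And>x. x = (\<Sum>b\<in>B. blinfun_apply (r b) x *\<^sub>R b)"
    "\<And>\<mu> :: 'a::real_normed_vector \<Rightarrow>\<^sub>L real. \<mu> = (\<Sum>b\<in>B. blinfun_apply \<mu> b *\<^sub>R r b)"
proof -
  obtain B :: "'a set" where B: "finite B" "independent B" "span B = UNIV"
    using fin_dim_basis[OF assms] .
  define r where "r b = Blinfun (\<lambda>x. representation B x b)" for b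
  have "linear (\<lambda>x. representation B x b)" for b
    by (intro linearI) (auto simp: representation_add representation_scale B)
  then have r: "blinfun_apply (r b) x = representation B x b" for b x
    unfolding r_def by (simp add: bounded_linear_Blinfun_apply fin_dim_linear_bounded assms)
  have x: "x = (\<Sum>b\<in>B. blinfun_apply (r b) x *\<^sub>R b)" for x
    using sum_representation_eq[OF B(2) _ B(1) order_refl, of x] B(3) r by simp
  have "\<mu> = (\<Sum>b\<in>B. blinfun_apply \<mu> b *\<^sub>R r b)" for \<mu> :: "'a \<Rightarrow>\<^sub>L real"
  proof (rule blinfun_eqI)
    fix y
    have "blinfun_apply \<mu> y = blinfun_apply \<mu> (\<Sum>b\<in>B. blinfun_apply (r b) y *\<^sub>R b)" using x by simp
    also have "\<dots> = blinfun_apply (\<Sum>b\<in>B. blinfun_apply \<mu> b *\<^sub>R r b) y"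
      by (simp add: blinfun.sum_right blinfun.sum_left blinfun.scaleR_right blinfun.scaleR_left mult.commute)
    finally show "blinfun_apply \<mu> y = blinfun_apply (\<Sum>b\<in>B. blinfun_apply \<mu> b *\<^sub>R r b) y" .
  qed
  with that[of B r] B x show ?thesis by blast
qed

section \<open>Images, subspaces and injective endomorphisms in finite dimension\<close>

lemma fin_dim_image:
  fixes f :: "'a::real_vector \<Rightarrow> 'b::real_vector"
  assumes S: "fin_dim S" and f: "lin_on S f" shows "fin_dim (f ` S)"
proof -
  obtain B where B: "finite B" "independent B" "span B = S" using fin_dim_basis[OF S] .
  have "f ` S = span (f ` B)"
  proof (intro equalityI subsetI)
    fix y assume "y \<in> f ` S"
    then obtain x where x: "x \<in> S" "y = f x" by blast
    have "y = (\<Sum>b\<in>B. representation B x b *\<^sub>R f b)"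
      unfolding x(2) by (rule lin_on_eq_sum_basis) (use B f x in auto)
    then show "y \<in> span (f ` B)" by (auto intro: span_sum span_scale span_base)
  next
    fix y assume "y \<in> span (f ` B)"
    then have "y \<in> range (\<lambda>u. \<Sum>v\<in>f ` B. u v *\<^sub>R v)" using B by (simp add: span_finite)
    then obtain u where u: "y = (\<Sum>v\<in>f ` B. u v *\<^sub>R v)" by blast
    have sub: "subspace S" using S fin_dim_subspace by blast
    have ex: "\<forall>v\<in>f ` B. \<exists>b\<in>B. f b = v" by blast
    then obtain s where s: "\<And>v. v \<in> f ` B \<Longrightarrow> s v \<in> B \<and> f (s v) = v" by metis
    have sS: "s v \<in> S" if "v \<in> f ` B" for v using s[OF that] B(3) span_superset[of B] by blast
    have "f (\<Sum>v\<in>f ` B. u v *\<^sub>R s v) = (\<Sum>v\<in>f ` B. f (u v *\<^sub>R s v))"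
      by (rule lin_on_sum[OF f sub]) (auto simp: B sS subspace_scale[OF sub])
    also have "\<dots> = y" unfolding u using s sS lin_on_scale[OF f] by (intro sum.cong) auto
    finally have "y = f (\<Sum>v\<in>f ` B. u v *\<^sub>R s v)" by simp
    moreover have "(\<Sum>v\<in>f ` B. u v *\<^sub>R s v) \<in> S"
      by (rule subspace_sum[OF sub]) (auto simp: sS subspace_scale[OF sub])
    ultimately show "y \<in> f ` S" by blast
  qed
  moreover have "finite (f ` B)" using B by blast
  ultimately show ?thesis unfolding fin_dim_def by blast
qed

lemma fin_dim_subset:
  assumes S: "fin_dim S" and W: "subspace W" "W \<subseteq> S" shows "fin_dim W"
proof -
  obtain B where B: "finite B" "span B = S" using S fin_dim_def by blast
  obtain C where C: "C \<subseteq> W" "independent C" "W \<subseteq> span C"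
    using maximal_independent_subset[of W] by blast
  have "finite C" using independent_span_bound[of B C] B C W by blast
  moreover have "span C = W" using C W by (meson span_minimal subset_antisym)
  ultimately show ?thesis unfolding fin_dim_def by blast
qed

text \<open>A linear extension \<open>g\<close> of \<open>f\<close> carries a basis to an
  independent set of the same cardinality. If a basis vector lay outside its span, adjoining it
  would give more independent vectors in \<open>S\<close> than the basis has.\<close>

lemma fin_dim_inj_surj:
  assumes S: "fin_dim S" and f: "lin_on S f" and im: "f ` S \<subseteq> S"
    and inj: "\<And>x. x \<in> S \<Longrightarrow> f x = 0 \<Longrightarrow> x = 0"
  shows "f ` S = S"
proof -
  obtain B where B: "finite B" "independent B" "span B = S" using fin_dim_basis[OF S] .
  have sub: "subspace S" using S fin_dim_subspace by blast
  have BS: "B \<subseteq> S" using B span_superset by blast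
  obtain g where g: "linear g" "\<forall>x\<in>B. g x = f x"
    using linear_independent_extend[OF B(2)] by metis
  have gf: "g x = f x" if "x \<in> S" for x
    using lin_on_eq_sum_basis[OF B(1,2), of g x] lin_on_eq_sum_basis[OF B(1,2), of f x] g f that B(3)
    by (simp add: linear_lin_on)
  have injS: "inj_on g (span B)"
    using linear_inj_on_iff_eq_0[OF g(1) subspace_span] inj gf B(3) by auto
  then have ind: "independent (g ` B)" using linear_independent_injective_image g B by blast
  have card: "card (g ` B) = card B"
    by (rule card_image) (use injS inj_on_subset span_superset in blast)
  have "g ` B \<subseteq> span B" using gf im BS B(3) by auto
  then have sub_span: "insert b (g ` B) \<subseteq> span B" if "b \<in> B" for b
    using that span_superset[of B] by blast
  have "B \<subseteq> span (g ` B)"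
  proof
    fix b assume b: "b \<in> B"
    show "b \<in> span (g ` B)"
    proof (rule ccontr)
      assume n: "b \<notin> span (g ` B)"
      then have "independent (insert b (g ` B))" using ind by (simp add: independent_insert)
      then have "card (insert b (g ` B)) \<le> card B"
        using independent_span_bound[OF B(1) _ sub_span[OF b]] by blast
      moreover have "b \<notin> g ` B" using n span_superset[of "g ` B"] by blast
      ultimately show False using B(1) by (simp add: card)
    qed
  qed
  then have "S \<subseteq> g ` S" using B(3) linear_span_image[OF g(1), of B] by (metis span_minimal subspace_span)
  then show ?thesis using im gf by force
qed

subsection \<open>Nondegenerate forms\<close>

definition bilin_on :: "'a::real_vector set \<Rightarrow> ('a \<Rightarrow> 'a \<Rightarrow> real) \<Rightarrow> bool" where
  "bilin_on E b \<longleftrightarrow> (\<forall>v\<in>E. lin_on E (b v)) \<and> (\<forall>w\<in>E. lin_on E (\<lambda>v. b v w))"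

definition nondeg_on :: "'a::real_vector set \<Rightarrow> ('a \<Rightarrow> 'a \<Rightarrow> real) \<Rightarrow> bool" where
  "nondeg_on E b \<longleftrightarrow> (\<forall>v\<in>E. (\<forall>w\<in>E. b v w = 0) \<longrightarrow> v = 0)"

text \<open>Nondegeneracy says that \<open>x\<close> is determined by the values of
  \<open>b x\<close> on a basis; equality of dimensions turns this injectivity into
  surjectivity.\<close>

lemma nondeg_representer:
  assumes E: "fin_dim E" and b: "bilin_on E b" "nondeg_on E b" and f: "lin_on E f"
  obtains x where "x \<in> E" "\<And>w. w \<in> E \<Longrightarrow> b x w = f w"
proof -
  obtain B where B: "finite B" "independent B" "span B = E" using fin_dim_basis[OF E] .
  have BE: "B \<subseteq> E" using B(3) span_superset by blast
  \<comment> \<open>Recording the values of \<open>b x\<close> on the basis as a vector of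
    \<open>E\<close> itself, rather than of its dual, makes \<open>T\<close> an endomorphism, to
    which \<open>fin_dim_inj_surj\<close> applies.\<close>
  define T where "T x = (\<Sum>c\<in>B. b x c *\<^sub>R c)" for x
  have lr: "lin_on E (b v)" if "v \<in> E" for v using b that unfolding bilin_on_def by blast
  have ll: "lin_on E (\<lambda>v. b v w)" if "w \<in> E" for w using b that unfolding bilin_on_def by blast
  have coeff: "u c = 0" if "(\<Sum>c\<in>B. u c *\<^sub>R c) = 0" "c \<in> B" for u c
    using independentD[OF B(2) B(1) order_refl that] .
  have eqB: "b x w = g w" if "x \<in> E" "w \<in> E" "lin_on E g" "\<And>c. c \<in> B \<Longrightarrow> b x c = g c" for x w g
    using lin_on_eq_sum_basis[OF B(1,2), of "b x" w] lin_on_eq_sum_basis[OF B(1,2), of g w]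
      lr[OF that(1)] that B(3) by simp
  have "lin_on E T"
    unfolding lin_on_def T_def
    using lin_on_add[OF ll] lin_on_scale[OF ll] BE
    by (auto simp: subset_iff scaleR_add_left sum.distrib scaleR_sum_right intro!: sum.cong)
  moreover have "T ` E \<subseteq> E" unfolding T_def using B(3) by (auto intro: span_sum span_scale span_base)
  moreover have "x = 0" if x: "x \<in> E" "T x = 0" for x
  proof -
    have "b x w = 0" if "w \<in> E" for w
      using eqB[OF x(1) that, of "\<lambda>_. 0"] coeff[of "b x"] x(2) unfolding T_def lin_on_def by simp
    then show ?thesis using b(2) x(1) unfolding nondeg_on_def by blast
  qed
  ultimately have surj: "T ` E = E" by (intro fin_dim_inj_surj[OF E])
  have "(\<Sum>c\<in>B. f c *\<^sub>R c) \<in> E" using B(3) by (auto intro: span_sum span_scale span_base)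
  then obtain x where x: "x \<in> E" "T x = (\<Sum>c\<in>B. f c *\<^sub>R c)" using surj by (metis imageE)
  then have "(\<Sum>c\<in>B. (b x c - f c) *\<^sub>R c) = 0"
    unfolding T_def by (simp add: scaleR_diff_left sum_subtractf)
  then have "b x c = f c" if "c \<in> B" for c using coeff[of "\<lambda>c. b x c - f c"] that by simp
  then have "b x w = f w" if "w \<in> E" for w using eqB[OF x(1) that f] by blast
  with x(1) show ?thesis by (rule that)
qed

text \<open>Adjoining \<open>v\<close> to a basis of \<open>W\<close> leaves an independent set, on
  which the values of a linear functional may be prescribed.\<close>

lemma separating_functional:
  assumes "subspace W" "v \<notin> W"
  obtains f :: "'a::real_vector \<Rightarrow> real" where "linear f" "f v = 1" "\<And>w. w \<in> W \<Longrightarrow> f w = 0"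
proof -
  obtain B where B: "B \<subseteq> W" "independent B" "W \<subseteq> span B"
    using maximal_independent_subset[of W] by blast
  have W: "span B = W" using B assms(1) by (simp add: span_minimal subset_antisym)
  then have "independent (insert v B)" using B(2) assms(2) by (simp add: independent_insert)
  then obtain f where f: "linear f" "\<forall>x\<in>insert v B. f x = (if x = v then 1 else 0 :: real)"
    using linear_independent_extend[of "insert v B" "\<lambda>x. if x = v then 1 else 0 :: real"] by blast
  have "f w = 0" if "w \<in> W" for w
  proof -
    have "\<forall>x\<in>B. f x = 0" using f(2) B(1) assms(2) by auto
    then show ?thesis using linear_eq_0_on_span[OF f(1), of B w] that W by blast
  qed
  with f show ?thesis by (intro that[of f]) auto
qed

text \<open>If \<open>v\<close> were outside \<open>W\<close>, the element representing a functional
  that vanishes on \<open>W\<close> but not at \<open>v\<close> would lie in the complement and pair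
  nontrivially with \<open>v\<close>.\<close>

lemma orth_compl_orth_compl_subset:
  assumes E: "fin_dim E" and b: "bilin_on E b" "nondeg_on E b"
    and W: "subspace W" and v: "v \<in> E" "\<And>n. n \<in> orth_compl E b W \<Longrightarrow> b n v = 0"
    and WE: "W \<subseteq> E"
  shows "v \<in> W"
proof (rule ccontr)
  assume "v \<notin> W"
  then obtain f :: "'a \<Rightarrow> real" where f: "linear f" "f v = 1" "\<And>w. w \<in> W \<Longrightarrow> f w = 0"
    using separating_functional[OF W] by blast
  obtain x where x: "x \<in> E" "\<And>w. w \<in> E \<Longrightarrow> b x w = f w"
    using nondeg_representer[OF E b linear_lin_on[OF f(1)]] by blast
  have "x \<in> orth_compl E b W" unfolding orth_compl_def using x f(3) WE by auto
  then show False using v x(2) f(2) by fastforce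
qed

section \<open>Derivatives within a subspace\<close>

text \<open>This lets derivatives within a chart image be exchanged for derivatives within the whole
  model space, where limits along lines are available.\<close>

lemma at_within_openin:
  assumes "openin (top_of_set E) S" "x \<in> S"
  shows "at x within S = at x within E"
proof -
  obtain U where U: "open U" "S = E \<inter> U" using assms(1) by (auto simp: openin_open)
  show ?thesis by (rule at_within_nhd[of x U]) (use U assms(2) in auto)
qed

text \<open>Difference quotients are the convenient form here: those of a curve in a subspace stay
  in the subspace, so closedness applies to their limit.\<close>

lemma has_vector_derivative_at_iff_quotient:
  "(u has_vector_derivative u') (at t) \<longleftrightarrow> ((\<lambda>h. (u (t + h) - u t) /\<^sub>R h) \<longlongrightarrow> u') (at 0)"
proof -
  have "norm ((u (t + h) - u t) /\<^sub>R h - u') = norm (u (t + h) - u t - h *\<^sub>R u') / norm h"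
    if "h \<noteq> 0" for h :: real
  proof -
    have "(u (t + h) - u t) /\<^sub>R h - u' = (u (t + h) - u t - h *\<^sub>R u') /\<^sub>R h"
      using that by (simp add: scaleR_diff_right)
    then show ?thesis by (simp add: divide_inverse mult.commute)
  qed
  then have "\<forall>\<^sub>F h in at 0. norm (u (t + h) - u t - h *\<^sub>R u') / norm h
      = norm ((u (t + h) - u t) /\<^sub>R h - u')"
    by (auto simp: eventually_at_filter)
  then have eq: "((\<lambda>h. norm (u (t + h) - u t - h *\<^sub>R u') / norm h) \<longlongrightarrow> 0) (at 0)
    \<longleftrightarrow> ((\<lambda>h. norm ((u (t + h) - u t) /\<^sub>R h - u')) \<longlongrightarrow> 0) (at 0)"
    by (rule tendsto_cong)
  show ?thesis
    unfolding has_vector_derivative_def has_derivative_at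
    by (simp only: bounded_linear_scaleR_left eq tendsto_norm_zero_iff LIM_zero_iff simp_thms)
qed

lemma eventually_nhds_shift:
  assumes "\<forall>\<^sub>F s in nhds t. P (s :: real)" shows "\<forall>\<^sub>F h in at 0. P (t + h)"
  using assms
  by (simp add: at_to_0[of t] eventually_filtermap eventually_at_filter[of _ t, symmetric] add.commute
      eventually_nhds_conv_at)

lemma has_vector_derivative_eventually_eq:
  assumes "(f has_vector_derivative f') (at t)" "\<forall>\<^sub>F s in nhds t. g s = f s"
  shows "(g has_vector_derivative f') (at t)"
  using assms
  by (subst has_vector_derivative_cong_ev[where g = f])
     (auto dest: eventually_nhds_x_imp_x elim: eventually_mono)

text \<open>Difference quotients of \<open>u\<close> eventually lie in the closed set
  \<open>S\<close>, hence so does their limit. As \<open>f\<close> is linear only on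
  \<open>S\<close>, the chain rule is replaced by the bound for \<open>f\<close> on
  \<open>S\<close>, applied to the quotients.\<close>

lemma has_vector_derivative_lin_on:
  assumes S: "fin_dim S" and f: "lin_on S f" and u: "(u has_vector_derivative u') (at t)"
    and ev: "\<forall>\<^sub>F s in nhds t. u s \<in> S"
  shows "u' \<in> S" and "((\<lambda>s. f (u s)) has_vector_derivative f u') (at t)"
proof -
  have sub: "subspace S" using S by (rule fin_dim_subspace)
  have ut: "u t \<in> S" using ev by (rule eventually_nhds_x_imp_x)
  define q where "q h = (u (t + h) - u t) /\<^sub>R h" for h
  have q: "(q \<longlongrightarrow> u') (at 0)" using u unfolding q_def has_vector_derivative_at_iff_quotient .
  have evh: "\<forall>\<^sub>F h in at 0. u (t + h) \<in> S" using eventually_nhds_shift[OF ev] .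
  then have evq: "\<forall>\<^sub>F h in at 0. q h \<in> S"
    by eventually_elim (simp add: q_def ut subspace_diff[OF sub] subspace_scale[OF sub])
  show u': "u' \<in> S" by (rule Lim_in_closed_set[OF fin_dim_closed[OF S] evq _ q]) simp
  obtain K where K: "K > 0" "\<And>x. x \<in> S \<Longrightarrow> norm (f x) \<le> K * norm x"
    using fin_dim_lin_on_bounded[OF S f] by blast
  have "((\<lambda>h. f (q h)) \<longlongrightarrow> f u') (at 0)"
  proof (rule LIM_zero_cancel, rule tendsto_0_le[where K = K])
    show "((\<lambda>h. q h - u') \<longlongrightarrow> 0) (at 0)" using q by (rule LIM_zero)
    show "\<forall>\<^sub>F h in at 0. norm (f (q h) - f u') \<le> norm (q h - u') * K"
      using evq
    proof eventually_elim
      case (elim h)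
      then show ?case
        using K(2)[of "q h - u'"] u' subspace_diff[OF sub] lin_on_diff[OF f sub] by (simp add: mult.commute)
    qed
  qed
  moreover have "\<forall>\<^sub>F h in at 0. f (q h) = (f (u (t + h)) - f (u t)) /\<^sub>R h"
    using evh
    by eventually_elim (simp add: q_def ut subspace_diff[OF sub] lin_on_scale[OF f] lin_on_diff[OF f sub])
  ultimately show "((\<lambda>s. f (u s)) has_vector_derivative f u') (at t)"
    unfolding has_vector_derivative_at_iff_quotient using tendsto_cong by fast
qed

text \<open>The inner map need only reach \<open>E'\<close> near \<open>x\<close>; shrinking
  \<open>E\<close> to a neighbourhood of \<open>x\<close> reduces this to the usual chain
  rule.\<close>

lemma has_derivative_compose_within:
  assumes f: "(f has_derivative A) (at x within E)" and x: "x \<in> E"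
    and ev: "\<forall>\<^sub>F y in at x within E. f y \<in> E'" and fx: "f x \<in> E'"
    and g: "(g has_derivative B) (at (f x) within E')"
  shows "((\<lambda>y. g (f y)) has_derivative (\<lambda>v. B (A v))) (at x within E)"
proof -
  obtain U where U: "open U" "x \<in> U" "\<forall>y\<in>U. y \<noteq> x \<longrightarrow> y \<in> E \<longrightarrow> f y \<in> E'"
    using ev unfolding eventually_at_topological by blast
  have eq: "at x within (E \<inter> U) = at x within E"
    by (rule at_within_nhd[of x U]) (use U in auto)
  have "f ` (E \<inter> U) \<subseteq> E'" using U fx by auto
  then show ?thesis
    using has_derivative_in_compose[of f A x "E \<inter> U" g B] f g eq has_derivative_subset by metis
qed

lemma has_derivative_curve:
  assumes f: "(f has_derivative A) (at (u t) within E)"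
    and ev: "\<forall>\<^sub>F s in nhds t. u s \<in> E" and u: "(u has_vector_derivative u') (at t)"
  shows "((\<lambda>s. f (u s)) has_vector_derivative A u') (at t)"
proof -
  have "((\<lambda>s. f (u s)) has_derivative (\<lambda>h. A (h *\<^sub>R u'))) (at t)"
    using u unfolding has_vector_derivative_def
    by (rule has_derivative_compose_within[of u _ t UNIV E])
       (use ev f in \<open>auto simp: eventually_at_filter dest: eventually_nhds_x_imp_x elim: eventually_mono\<close>)
  then show ?thesis
    unfolding has_vector_derivative_def
    using linear_scale[OF bounded_linear.linear[OF has_derivative_bounded_linear[OF f]]] by simp
qed

lemma has_derivative_line:
  assumes f: "(f has_derivative A) (at x within E)" and E: "subspace E" "x \<in> E" "v \<in> E"
  shows "((\<lambda>s. f (x + s *\<^sub>R v)) has_vector_derivative A v) (at 0)"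
proof -
  have "((\<lambda>s. x + s *\<^sub>R v) has_vector_derivative v) (at 0)"
    by (auto intro!: derivative_eq_intros)
  moreover have "\<forall>\<^sub>F s in nhds 0. x + s *\<^sub>R v \<in> E"
    using E by (intro always_eventually) (auto intro: subspace_add subspace_scale)
  ultimately show ?thesis using has_derivative_curve[of f A "\<lambda>s. x + s *\<^sub>R v" 0 E v] f by simp
qed

text \<open>Within a proper subspace the derivative is determined only in directions of
  \<open>E\<close>, where it is read off along a line that stays in \<open>E\<close>.\<close>

lemma has_derivative_unique_within_subspace:
  assumes "(f has_derivative A) (at x within E)" "(f has_derivative B) (at x within E)"
    and "subspace E" "x \<in> E" "v \<in> E"
  shows "A v = B v"
  using has_derivative_line[OF assms(1,3,4,5)] has_derivative_line[OF assms(2,3,4,5)]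
  by (rule vector_derivative_unique_at)

lemma frechet_derivative_eq_within_subspace:
  assumes "(f has_derivative A) (at x within E)" "subspace E" "x \<in> E" "v \<in> E"
  shows "frechet_derivative f (at x within E) v = A v"
  using has_derivative_unique_within_subspace[OF _ assms] assms(1) frechet_derivative_works
    differentiable_def by blast

subsection \<open>Smooth functions\<close>

lemma smooth_on_has_derivative:
  assumes "smooth_on E S f" "x \<in> S"
  shows "(f has_derivative frechet_derivative f (at x within S)) (at x within S)"
proof -
  have "Ck_on (Suc 0) E S f" using assms(1) unfolding smooth_on_def by blast
  then show ?thesis using assms(2) frechet_derivative_works by auto
qed

lemma smooth_on_frechet_derivative:
  assumes "smooth_on E S f" "v \<in> E"
  shows "smooth_on E S (\<lambda>x. frechet_derivative f (at x within S) v)"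
  unfolding smooth_on_def
proof
  fix k
  have "Ck_on (Suc k) E S f" using assms(1) unfolding smooth_on_def by blast
  then show "Ck_on k E S (\<lambda>x. frechet_derivative f (at x within S) v)" using assms(2) by auto
qed

lemma smooth_on_continuous_on: "smooth_on E S f \<Longrightarrow> continuous_on S f"
  unfolding smooth_on_def using Ck_on.simps(1) by blast

lemma norm_increment_le:
  fixes k :: "real \<Rightarrow> 'b::real_normed_vector"
  assumes "s \<ge> 0" and k: "\<And>x. x \<in> {0..s} \<Longrightarrow> (k has_vector_derivative k' x) (at x)"
    and B: "\<And>x. x \<in> {0..s} \<Longrightarrow> norm (k' x) \<le> B"
  shows "norm (k s - k 0) \<le> B * s"
proof -
  have "norm (k s - k 0) \<le> B * norm (s - 0)"
  proof (rule differentiable_bound[where S = "{0..s}" and f' = "\<lambda>x h. h *\<^sub>R k' x"])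
    show "(k has_derivative (\<lambda>h. h *\<^sub>R k' x)) (at x within {0..s})" if "x \<in> {0..s}" for x
      using k[OF that] unfolding has_vector_derivative_def by (rule has_derivative_at_withinI)
    show "onorm (\<lambda>h. h *\<^sub>R k' x) \<le> B" if "x \<in> {0..s}" for x
      using B[OF that] by (intro onorm_le) (auto simp: mult.commute[of B] mult_left_mono)
  qed (use assms(1) in auto)
  then show ?thesis using assms(1) by simp
qed

text \<open>The second difference over the parallelogram spanned by \<open>s u\<close> and
  \<open>t w\<close> is \<open>s t\<close> times the iterated derivative, up to
  \<open>e s t\<close>. This follows by applying the mean value inequality once in each direction,
  using continuity of the iterated derivative at \<open>z\<close>.\<close>

lemma mixed_difference_bound:
  assumes E: "subspace E" and S: "openin (top_of_set E) S" and f: "smooth_on E S f"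
    and z: "z \<in> S" and u: "u \<in> E" and w: "w \<in> E" and e: "e > (0::real)"
  defines "Du \<equiv> \<lambda>x. frechet_derivative f (at x within S) u"
  defines "A \<equiv> \<lambda>x. frechet_derivative Du (at x within S) w"
  shows "\<exists>d>0. \<forall>s t. 0 < s \<and> s < d \<and> 0 < t \<and> t < d \<longrightarrow>
     norm (f (z + s *\<^sub>R u + t *\<^sub>R w) - f (z + s *\<^sub>R u) - f (z + t *\<^sub>R w) + f z - (s * t) *\<^sub>R A z)
       \<le> e * (s * t)"
proof -
  have smDu: "smooth_on E S Du" unfolding Du_def using f u by (rule smooth_on_frechet_derivative)
  have smA: "smooth_on E S A" unfolding A_def using smDu w by (rule smooth_on_frechet_derivative)
  have SE: "S \<subseteq> E" using S openin_imp_subset by blast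
  have "\<forall>\<^sub>F x in at z within S. dist (A x) (A z) < e"
    using smooth_on_continuous_on[OF smA] z e unfolding continuous_on_def by (blast intro: tendstoD)
  then obtain r1 where r1: "r1 > 0" "\<And>x. x \<in> S \<Longrightarrow> dist x z < r1 \<Longrightarrow> dist (A x) (A z) < e"
    using e unfolding eventually_at by (metis dist_self)
  obtain r2 where r2: "r2 > 0" "ball z r2 \<inter> E \<subseteq> S"
    using S z unfolding openin_contains_ball by blast
  define r where "r = min r1 r2"
  have r: "r > 0" "\<And>x. x \<in> E \<Longrightarrow> dist x z < r \<Longrightarrow> x \<in> S \<and> norm (A x - A z) \<le> e"
    using r1 r2 unfolding r_def by (auto simp: dist_commute subset_iff dist_norm intro: less_imp_le)
  \<comment> \<open>With this \<open>d\<close> the whole parallelogram stays in the ball of radius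
    \<open>r\<close>; the summand 1 covers the case that \<open>u\<close> and \<open>w\<close> both
    vanish.\<close>
  define d where "d = r / (norm u + norm w + 1)"
  have npos: "norm u + norm w + 1 > 0" by (smt (verit) norm_ge_zero)
  then have d: "d > 0" using r by (simp add: d_def)
  have zE: "z \<in> E" using z SE by blast
  have inE: "z + s *\<^sub>R u + t *\<^sub>R w \<in> E" for s t
    using zE u w E by (intro subspace_add subspace_scale)
  have near: "dist (z + s *\<^sub>R u + t *\<^sub>R w) z < r" if "0 \<le> s" "s < d" "0 \<le> t" "t < d" for s t
  proof -
    have "dist (z + s *\<^sub>R u + t *\<^sub>R w) z = norm (s *\<^sub>R u + t *\<^sub>R w)" by (simp add: dist_norm)
    also have "\<dots> \<le> s * norm u + t * norm w" using that norm_triangle_ineq[of "s *\<^sub>R u" "t *\<^sub>R w"] by simp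
    also have "\<dots> \<le> d * norm u + d * norm w" using that by (intro add_mono mult_right_mono) auto
    also have "\<dots> < d * (norm u + norm w + 1)" using d by (simp add: algebra_simps)
    also have "\<dots> = r" using npos by (simp add: d_def)
    finally show ?thesis .
  qed
  have inS: "z + s *\<^sub>R u + t *\<^sub>R w \<in> S" if "0 \<le> s" "s < d" "0 \<le> t" "t < d" for s t
    using r(2)[OF inE near] that by blast
  have der: "((\<lambda>s. g (y + s *\<^sub>R v)) has_vector_derivative
      frechet_derivative g (at (y + s *\<^sub>R v) within S) v) (at s)"
    if "smooth_on E S g" "y \<in> E" "v \<in> E" "y + s *\<^sub>R v \<in> S" for g :: "'a \<Rightarrow> 'b" and y v s
  proof -
    have "(g has_derivative frechet_derivative g (at (y + s *\<^sub>R v) within S)) (at (y + s *\<^sub>R v) within E)"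
      using smooth_on_has_derivative[OF that(1,4)] at_within_openin[OF S that(4)] by simp
    moreover have "((\<lambda>s. y + s *\<^sub>R v) has_vector_derivative v) (at s)"
      by (auto intro!: derivative_eq_intros)
    moreover have "\<forall>\<^sub>F s in nhds s. y + s *\<^sub>R v \<in> E"
      using that E by (intro always_eventually) (auto intro: subspace_add subspace_scale)
    ultimately show ?thesis using has_derivative_curve[of g _ "\<lambda>s. y + s *\<^sub>R v" s E v] by simp
  qed
  have "norm (f (z + s *\<^sub>R u + t *\<^sub>R w) - f (z + s *\<^sub>R u) - f (z + t *\<^sub>R w) + f z - (s * t) *\<^sub>R A z)
       \<le> e * (s * t)" if st: "0 < s" "s < d" "0 < t" "t < d" for s t
  proof -
    \<comment> \<open>\<open>g s - g 0\<close> is the second difference minus its expected value, so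
      a bound on the derivative of \<open>g\<close> suffices.\<close>
    define g where "g x = f (z + x *\<^sub>R u + t *\<^sub>R w) - f (z + x *\<^sub>R u) - (x * t) *\<^sub>R A z" for x
    define g' where "g' x = Du (z + x *\<^sub>R u + t *\<^sub>R w) - Du (z + x *\<^sub>R u) - t *\<^sub>R A z" for x
    have "norm (g s - g 0) \<le> (e * t) * s"
    proof (rule norm_increment_le)
      fix x assume x: "x \<in> {0..s}"
      have xd: "0 \<le> x" "x < d" using x st by auto
      have sw: "z + x *\<^sub>R u + t *\<^sub>R w = z + t *\<^sub>R w + x *\<^sub>R u" for x t by simp
      have "((\<lambda>x. f (z + t *\<^sub>R w + x *\<^sub>R u)) has_vector_derivative Du (z + t *\<^sub>R w + x *\<^sub>R u)) (at x)"
        unfolding Du_def by (rule der[OF f])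
          (use inS[OF xd, of t] inE[of 0 t] u st sw in \<open>auto simp: algebra_simps\<close>)
      moreover have "((\<lambda>x. f (z + x *\<^sub>R u)) has_vector_derivative Du (z + x *\<^sub>R u)) (at x)"
        unfolding Du_def by (rule der[OF f]) (use inS[OF xd, of 0] zE u d in auto)
      ultimately show "(g has_vector_derivative g' x) (at x)"
        unfolding g_def g'_def sw by (auto intro!: derivative_eq_intros)
      \<comment> \<open>The derivative \<open>g' x\<close> is itself an increment, namely
        \<open>k t - k 0\<close> in the direction \<open>w\<close>.\<close>
      define k where "k y = Du (z + x *\<^sub>R u + y *\<^sub>R w) - y *\<^sub>R A z" for y
      have "norm (k t - k 0) \<le> e * t"
      proof (rule norm_increment_le)
        fix y assume y: "y \<in> {0..t}"
        have yd: "0 \<le> y" "y < d" using y st by auto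
        have "((\<lambda>y. Du (z + x *\<^sub>R u + y *\<^sub>R w)) has_vector_derivative A (z + x *\<^sub>R u + y *\<^sub>R w)) (at y)"
          unfolding A_def by (rule der[OF smDu]) (use inS[OF xd yd] inE[of x 0] w in auto)
        then show "(k has_vector_derivative (A (z + x *\<^sub>R u + y *\<^sub>R w) - A z)) (at y)"
          unfolding k_def by (auto intro!: derivative_eq_intros)
        show "norm (A (z + x *\<^sub>R u + y *\<^sub>R w) - A z) \<le> e" using r(2)[OF inE near[OF xd yd]] by blast
      qed (use st in auto)
      moreover have "k t - k 0 = g' x" unfolding k_def g'_def by simp
      ultimately show "norm (g' x) \<le> e * t" by simp
    qed (use st in auto)
    moreover have "g s - g 0
      = f (z + s *\<^sub>R u + t *\<^sub>R w) - f (z + s *\<^sub>R u) - f (z + t *\<^sub>R w) + f z - (s * t) *\<^sub>R A z"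
      unfolding g_def by simp
    ultimately show ?thesis by (simp add: mult_ac)
  qed
  with d show ?thesis by blast
qed

text \<open>For equal step lengths the second difference is symmetric in \<open>u\<close> and
  \<open>w\<close>, and it approximates both iterated derivatives.\<close>

lemma second_derivative_symmetric:
  assumes E: "subspace E" and S: "openin (top_of_set E) S" and f: "smooth_on E S f"
    and z: "z \<in> S" and u: "u \<in> E" and w: "w \<in> E"
  shows "frechet_derivative (\<lambda>x. frechet_derivative f (at x within S) u) (at z within S) w
       = frechet_derivative (\<lambda>x. frechet_derivative f (at x within S) w) (at z within S) u"
    (is "?A = ?B")
proof (rule ccontr)
  assume ne: "?A \<noteq> ?B"
  \<comment> \<open>The two approximations together bound the norm of \<open>?A - ?B\<close> by
    \<open>2 * e\<close>, which is half of it; hence the divisor 4.\<close>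
  define e where "e = norm (?A - ?B) / 4"
  have e: "e > 0" using ne by (simp add: e_def)
  obtain d1 where d1: "d1 > 0" "\<And>s t. 0 < s \<and> s < d1 \<and> 0 < t \<and> t < d1 \<Longrightarrow>
     norm (f (z + s *\<^sub>R u + t *\<^sub>R w) - f (z + s *\<^sub>R u) - f (z + t *\<^sub>R w) + f z - (s * t) *\<^sub>R ?A) \<le> e * (s * t)"
    using mixed_difference_bound[OF E S f z u w e] by blast
  obtain d2 where d2: "d2 > 0" "\<And>s t. 0 < s \<and> s < d2 \<and> 0 < t \<and> t < d2 \<Longrightarrow>
     norm (f (z + s *\<^sub>R w + t *\<^sub>R u) - f (z + s *\<^sub>R w) - f (z + t *\<^sub>R u) + f z - (s * t) *\<^sub>R ?B) \<le> e * (s * t)"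
    using mixed_difference_bound[OF E S f z w u e] by blast
  define s where "s = min d1 d2 / 2"
  have s: "0 < s" "s < d1" "s < d2" using d1(1) d2(1) unfolding s_def by auto
  define \<Delta> where "\<Delta> = f (z + s *\<^sub>R u + s *\<^sub>R w) - f (z + s *\<^sub>R u) - f (z + s *\<^sub>R w) + f z"
  have "norm (\<Delta> - (s * s) *\<^sub>R ?A) \<le> e * (s * s)" unfolding \<Delta>_def using d1(2) s by blast
  moreover have "norm (\<Delta> - (s * s) *\<^sub>R ?B) \<le> e * (s * s)"
  proof -
    have "\<Delta> = f (z + s *\<^sub>R w + s *\<^sub>R u) - f (z + s *\<^sub>R w) - f (z + s *\<^sub>R u) + f z"
      unfolding \<Delta>_def by (simp add: algebra_simps)
    then show ?thesis using d2(2)[of s s] s by simp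
  qed
  moreover have "(s * s) *\<^sub>R (?A - ?B) = (\<Delta> - (s * s) *\<^sub>R ?B) - (\<Delta> - (s * s) *\<^sub>R ?A)"
    by (simp add: scaleR_diff_right)
  then have "(s * s) * norm (?A - ?B) = norm ((\<Delta> - (s * s) *\<^sub>R ?B) - (\<Delta> - (s * s) *\<^sub>R ?A))"
    by (metis abs_of_nonneg norm_scaleR zero_le_square)
  ultimately have "(s * s) * norm (?A - ?B) \<le> e * (s * s) + e * (s * s)"
    using norm_triangle_ineq4[of "\<Delta> - (s * s) *\<^sub>R ?B" "\<Delta> - (s * s) *\<^sub>R ?A"] by linarith
  then have "norm (?A - ?B) \<le> 2 * e" using s by (simp add: algebra_simps)
  then show False using e unfolding e_def by simp
qed

section \<open>Derivatives in charts\<close>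

text \<open>The part of \<open>smooth_manifold\<close> that calculus in charts uses: no
  compatibility of charts and no topology. It passes to products and open subsets by short
  arguments, so the product spaces of the model need not be shown to be smooth manifolds.\<close>

definition charted :: "('p, 'e::real_normed_vector) manifold \<Rightarrow> bool" where
  "charted M \<longleftrightarrow> subspace (model M) \<and>
     (\<forall>p\<in>carrier M. chart_at M p \<in> atlas M \<and> p \<in> chart_dom (chart_at M p)) \<and>
     (\<forall>c\<in>atlas M. chart_dom c \<subseteq> carrier M \<and> inj_on (chart_map c) (chart_dom c) \<and>
        openin (top_of_set (model M)) (chart_map c ` chart_dom c))"

lemma smooth_manifold_charted: "smooth_manifold M \<Longrightarrow> charted M"
  unfolding smooth_manifold_def charted_def by (metis subspace_span inf.idem)

lemma smooth_manifold_fin_dim: "smooth_manifold M \<Longrightarrow> fin_dim (model M)"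
  unfolding smooth_manifold_def fin_dim_def by blast

lemma chartedD:
  assumes "charted M"
  shows "subspace (model M)"
    and "p \<in> carrier M \<Longrightarrow> chart_at M p \<in> atlas M"
    and "p \<in> carrier M \<Longrightarrow> p \<in> chart_dom (chart_at M p)"
    and "c \<in> atlas M \<Longrightarrow> chart_dom c \<subseteq> carrier M"
    and "c \<in> atlas M \<Longrightarrow> inj_on (chart_map c) (chart_dom c)"
    and "c \<in> atlas M \<Longrightarrow> openin (top_of_set (model M)) (chart_map c ` chart_dom c)"
  using assms unfolding charted_def by blast+

lemma charted_chart_map_in_model:
  "charted M \<Longrightarrow> c \<in> atlas M \<Longrightarrow> p \<in> chart_dom c \<Longrightarrow> chart_map c p \<in> model M"
  using chartedD(6) openin_imp_subset by blast

lemma charted_chart_inv: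
  "charted M \<Longrightarrow> c \<in> atlas M \<Longrightarrow> p \<in> chart_dom c \<Longrightarrow> chart_inv c (chart_map c p) = p"
  unfolding chart_inv_def by (simp add: chartedD(5))

section \<open>Charts of open subsets of vector spaces and of products\<close>

lemma charted_open_mfd: "subspace E \<Longrightarrow> openin (top_of_set E) S \<Longrightarrow> charted (open_mfd E S)"
  unfolding charted_def open_mfd_def by simp

lemma charted_real_mfd: "charted real_mfd"
  unfolding real_mfd_def by (rule charted_open_mfd) auto

lemma prod_mfd_sel:
  "carrier (prod_mfd M N) = carrier M \<times> carrier N" "model (prod_mfd M N) = model M \<times> model N"
  "chart_at (prod_mfd M N) (p, q) = prod_chart (chart_at M p) (chart_at N q)"
  "c \<in> atlas M \<Longrightarrow> d \<in> atlas N \<Longrightarrow> prod_chart c d \<in> atlas (prod_mfd M N)"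
  unfolding prod_mfd_def by (simp_all del: split_paired_Ex) blast

lemma prod_chart_sel:
  "chart_dom (prod_chart c d) = chart_dom c \<times> chart_dom d"
  "chart_map (prod_chart c d) (p, q) = (chart_map c p, chart_map d q)"
  unfolding prod_chart_def by auto

lemma charted_prod_mfd:
  assumes "charted M" "charted N" shows "charted (prod_mfd M N)"
  unfolding charted_def
proof (intro conjI ballI)
  show "subspace (model (prod_mfd M N))"
    by (simp add: prod_mfd_sel subspace_Times chartedD(1) assms)
next
  fix p assume "p \<in> carrier (prod_mfd M N)"
  then obtain a b where p: "p = (a, b)" "a \<in> carrier M" "b \<in> carrier N"
    by (cases p) (auto simp: prod_mfd_sel)
  show "chart_at (prod_mfd M N) p \<in> atlas (prod_mfd M N)"
    unfolding p(1) prod_mfd_sel(3)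
    by (rule prod_mfd_sel(4)[OF chartedD(2)[OF assms(1) p(2)] chartedD(2)[OF assms(2) p(3)]])
  show "p \<in> chart_dom (chart_at (prod_mfd M N) p)"
    unfolding p(1) prod_mfd_sel(3) prod_chart_sel using chartedD(3)[OF assms(1) p(2)] chartedD(3)[OF assms(2) p(3)] by simp
next
  fix e assume "e \<in> atlas (prod_mfd M N)"
  then obtain c d where e: "e = prod_chart c d" and c: "c \<in> atlas M" and d: "d \<in> atlas N"
    unfolding prod_mfd_def by auto
  show "chart_dom e \<subseteq> carrier (prod_mfd M N)"
    unfolding e prod_mfd_sel prod_chart_sel using chartedD(4)[OF assms(1) c] chartedD(4)[OF assms(2) d] by blast
  show "inj_on (chart_map e) (chart_dom e)"
    using map_prod_inj_on[OF chartedD(5)[OF assms(1) c] chartedD(5)[OF assms(2) d]]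
    unfolding e prod_chart_def by simp
  have "openin (top_of_set (model M \<times> model N)) ((chart_map c ` chart_dom c) \<times> (chart_map d ` chart_dom d))"
    using chartedD(6)[OF assms(1) c] chartedD(6)[OF assms(2) d] by (rule openin_Times)
  moreover have "chart_map e ` chart_dom e = (chart_map c ` chart_dom c) \<times> (chart_map d ` chart_dom d)"
    unfolding e prod_chart_def by auto
  ultimately show "openin (top_of_set (model (prod_mfd M N))) (chart_map e ` chart_dom e)"
    by (simp add: prod_mfd_sel)
qed

lemma open_mfd_sel:
  "carrier (open_mfd E S) = S" "model (open_mfd E S) = E" "atlas (open_mfd E S) = {(S, id)}"
  "chart_at (open_mfd E S) x = (S, id)"
  unfolding open_mfd_def by auto

lemma real_mfd_sel:
  "carrier real_mfd = UNIV" "model real_mfd = UNIV" "atlas real_mfd = {(UNIV, id)}"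
  "chart_at real_mfd x = (UNIV, id)"
  unfolding real_mfd_def open_mfd_sel by auto

lemma chart_inv_id: "x \<in> S \<Longrightarrow> chart_inv (S, id) x = x"
  unfolding chart_inv_def by simp

text \<open>\<open>T\<close> represents the tangent map of \<open>f\<close> at \<open>p\<close> in the charts \<open>c\<close> and \<open>d\<close>; unlike
  \<^const>\<open>tmap\<close>, the charts are free.\<close>
definition chart_deriv ::
  "('p, 'e::real_normed_vector) manifold \<Rightarrow> ('p, 'e) chart \<Rightarrow>
   ('q, 'f::real_normed_vector) manifold \<Rightarrow> ('q, 'f) chart \<Rightarrow> ('p \<Rightarrow> 'q) \<Rightarrow> 'p \<Rightarrow> ('e \<Rightarrow> 'f) \<Rightarrow> bool"
  where
  "chart_deriv M c N d f p T \<longleftrightarrow> charted M \<and> charted N \<and> c \<in> atlas M \<and> d \<in> atlas N \<and>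
     p \<in> chart_dom c \<and> f p \<in> chart_dom d \<and>
     (\<forall>\<^sub>F y in at (chart_map c p) within model M. f (chart_inv c y) \<in> chart_dom d) \<and>
     ((chart_map d \<circ> f \<circ> chart_inv c) has_derivative T) (at (chart_map c p) within model M)"

lemma eventually_at_within_openin:
  assumes "openin (top_of_set E) S" "x \<in> S" "\<And>y. y \<in> S \<Longrightarrow> P y"
  shows "\<forall>\<^sub>F y in at x within E. P y"
proof -
  obtain U where U: "open U" "S = E \<inter> U" using assms(1) by (auto simp: openin_open)
  then show ?thesis using assms(2,3) unfolding eventually_at_topological by blast
qed

lemma chart_derivI:
  assumes "charted M" "charted N" "c \<in> atlas M" "d \<in> atlas N" "p \<in> chart_dom c"
    and S: "openin (top_of_set (model M)) S" "chart_map c p \<in> S" "S \<subseteq> chart_map c ` chart_dom c"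
      "\<And>y. y \<in> S \<Longrightarrow> f (chart_inv c y) \<in> chart_dom d"
    and "((chart_map d \<circ> f \<circ> chart_inv c) has_derivative T) (at (chart_map c p) within S)"
  shows "chart_deriv M c N d f p T"
  using assms eventually_at_within_openin[OF S(1,2), of "\<lambda>y. f (chart_inv c y) \<in> chart_dom d"]
    at_within_openin[OF S(1,2)] S(4)[OF S(2)]
  unfolding chart_deriv_def by (simp add: charted_chart_inv)

lemma smooth_map_chart_image:
  assumes f: "smooth_map M N f" and c: "charted M" "c \<in> atlas M" "d \<in> atlas N"
  defines "S \<equiv> chart_map c ` {p \<in> chart_dom c. f p \<in> chart_dom d}"
  shows "openin (top_of_set (model M)) S"
    and "smooth_on (model M) S (chart_map d \<circ> f \<circ> chart_inv c)"
    and "S \<subseteq> chart_map c ` chart_dom c"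
    and "y \<in> S \<Longrightarrow> f (chart_inv c y) \<in> chart_dom d"
    and "p \<in> chart_dom c \<Longrightarrow> f p \<in> chart_dom d \<Longrightarrow> chart_map c p \<in> S"
  using f c charted_chart_inv[OF c(1,2)] unfolding smooth_map_def S_def Let_def by auto

lemma smooth_map_chart_deriv:
  assumes f: "smooth_map M N f" and M: "charted M" "charted N" and c: "c \<in> atlas M" "d \<in> atlas N"
    and p: "p \<in> chart_dom c" "f p \<in> chart_dom d"
  shows "chart_deriv M c N d f p
    (frechet_derivative (chart_map d \<circ> f \<circ> chart_inv c) (at (chart_map c p) within model M))"
proof -
  note S = smooth_map_chart_image[OF f M(1) c]
  show ?thesis
    using smooth_on_has_derivative[OF S(2) S(5)[OF p]] at_within_openin[OF S(1) S(5)[OF p]]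
    by (intro chart_derivI[where f = f and d = d, OF M c p(1) S(1) S(5)[OF p] S(3) S(4)]) simp_all
qed

lemma chart_derivD:
  assumes "chart_deriv M c N d f p T"
  shows "charted M" "charted N" "c \<in> atlas M" "d \<in> atlas N" "p \<in> chart_dom c" "f p \<in> chart_dom d"
    and "\<forall>\<^sub>F y in at (chart_map c p) within model M. f (chart_inv c y) \<in> chart_dom d"
    and "((chart_map d \<circ> f \<circ> chart_inv c) has_derivative T) (at (chart_map c p) within model M)"
    and "subspace (model M)" "chart_map c p \<in> model M" "chart_inv c (chart_map c p) = p"
    and "at (chart_map c p) within chart_map c ` chart_dom c = at (chart_map c p) within model M"
proof -
  show *: "charted M" "charted N" "c \<in> atlas M" "d \<in> atlas N" "p \<in> chart_dom c" "f p \<in> chart_dom d"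
    "\<forall>\<^sub>F y in at (chart_map c p) within model M. f (chart_inv c y) \<in> chart_dom d"
    "((chart_map d \<circ> f \<circ> chart_inv c) has_derivative T) (at (chart_map c p) within model M)"
    using assms unfolding chart_deriv_def by simp_all
  show "subspace (model M)" by (rule chartedD(1)[OF *(1)])
  show "chart_map c p \<in> model M" by (rule charted_chart_map_in_model[OF *(1,3,5)])
  show "chart_inv c (chart_map c p) = p" by (rule charted_chart_inv[OF *(1,3,5)])
  show "at (chart_map c p) within chart_map c ` chart_dom c = at (chart_map c p) within model M"
    by (rule at_within_openin[OF chartedD(6)[OF *(1,3)]]) (use *(5) in blast)
qed

text \<open>Chain rule, with the intermediate chart \<open>d\<close> shared by both maps. Besides
  the derivative, the composite must be shown to reach the domain of \<open>e\<close> near the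
  point.\<close>

lemma chart_deriv_comp:
  assumes f: "chart_deriv M c N d f p T" and g: "chart_deriv N d L e g (f p) U"
  shows "chart_deriv M c L e (\<lambda>x. g (f x)) p (\<lambda>v. U (T v))"
proof -
  let ?F = "at (chart_map c p) within model M"
  let ?k = "chart_map d \<circ> f \<circ> chart_inv c"
  note fD = chart_derivD[OF f] and gD = chart_derivD[OF g]
  note domd = fD(7)
  have kp: "?k (chart_map c p) = chart_map d (f p)" by (simp add: fD(11))
  have evN: "\<forall>\<^sub>F y in ?F. ?k y \<in> model N"
    using domd
  proof eventually_elim
    case (elim y)
    then show ?case using charted_chart_map_in_model[OF gD(1,3)] by simp
  qed
  have der: "((\<lambda>y. (chart_map e \<circ> g \<circ> chart_inv d) (?k y)) has_derivative (\<lambda>v. U (T v))) ?F"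
    by (rule has_derivative_compose_within[OF fD(8,10) evN])
       (simp_all only: kp gD(8,10))
  have eq: "(chart_map e \<circ> g \<circ> chart_inv d) (?k y) = (chart_map e \<circ> (\<lambda>x. g (f x)) \<circ> chart_inv c) y"
    if "f (chart_inv c y) \<in> chart_dom d" for y
    using charted_chart_inv[OF gD(1,3) that] by simp
  have "((chart_map e \<circ> (\<lambda>x. g (f x)) \<circ> chart_inv c) has_derivative (\<lambda>v. U (T v))) ?F"
  proof (rule has_derivative_transform_eventually[OF der _ _ fD(10)])
    show "\<forall>\<^sub>F y in ?F. (chart_map e \<circ> g \<circ> chart_inv d) (?k y)
        = (chart_map e \<circ> (\<lambda>x. g (f x)) \<circ> chart_inv c) y"
      using domd by eventually_elim (rule eq)
  qed (rule eq, simp add: fD)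
  \<comment> \<open>The coordinate expression of \<open>f\<close> is continuous at the point, so
    nearby values fall into the neighbourhood on which \<open>g\<close> reaches the domain of
    \<open>e\<close>.\<close>
  moreover have "\<forall>\<^sub>F y in ?F. g (f (chart_inv c y)) \<in> chart_dom e"
  proof -
    obtain W where W: "open W" "chart_map d (f p) \<in> W"
      "\<forall>z\<in>W. z \<noteq> chart_map d (f p) \<longrightarrow> z \<in> model N \<longrightarrow> g (chart_inv d z) \<in> chart_dom e"
      using gD(7) unfolding eventually_at_topological by blast
    have "(?k \<longlongrightarrow> chart_map d (f p)) ?F"
      using has_derivative_continuous[OF fD(8)] unfolding continuous_within kp .
    then have "\<forall>\<^sub>F y in ?F. ?k y \<in> W" by (rule topological_tendstoD[OF _ W(1,2)])
    with evN domd show ?thesis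
    proof eventually_elim
      case (elim y)
      have i: "chart_inv d (?k y) = f (chart_inv c y)"
        using charted_chart_inv[OF gD(1,3) elim(2)] by simp
      \<comment> \<open>The neighbourhood obtained for \<open>g\<close> is punctured, so a
        \<open>y\<close> that is sent to the base point itself is treated separately.\<close>
      show ?case
      proof (cases "?k y = chart_map d (f p)")
        case True
        have "f (chart_inv c y) = f p" using i unfolding True gD(11) by (rule sym)
        then show ?thesis using gD(6) by (simp only:)
      next
        case False
        from W(3)[rule_format, OF elim(3) this elim(1)] show ?thesis unfolding i .
      qed
    qed
  qed
  ultimately show ?thesis using fD gD unfolding chart_deriv_def by simp
qed

lemma chart_deriv_unique:
  assumes T: "chart_deriv M c N d f p T" and U: "chart_deriv M c N d f p U" and v: "v \<in> model M"
  shows "T v = U v"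
  using has_derivative_unique_within_subspace[OF chart_derivD(8)[OF T] chart_derivD(8)[OF U]
      chart_derivD(9)[OF T] chart_derivD(10)[OF T] v] .

lemma chart_deriv_linear: "chart_deriv M c N d f p T \<Longrightarrow> bounded_linear T"
  using has_derivative_bounded_linear[OF chart_derivD(8)] .

text \<open>In the chart, the image of a line through the point is locally a curve in the model
  space of \<open>N\<close>, which is closed.\<close>

lemma chart_deriv_into:
  assumes f: "chart_deriv M c N d f p T" and N: "fin_dim (model N)" and v: "v \<in> model M"
  shows "T v \<in> model N"
proof -
  let ?k = "chart_map d \<circ> f \<circ> chart_inv c" and ?x = "chart_map c p"
  note fD = chart_derivD[OF f]
  have der: "((\<lambda>s. ?k (?x + s *\<^sub>R v)) has_vector_derivative T v) (at 0)"
    by (rule has_derivative_line[OF fD(8,9,10) v])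
  obtain W where W: "open W" "?x \<in> W"
      "\<forall>z\<in>W. z \<noteq> ?x \<longrightarrow> z \<in> model M \<longrightarrow> f (chart_inv c z) \<in> chart_dom d"
    using fD(7) unfolding eventually_at_topological by blast
  have all: "?k z \<in> model N" if "z \<in> W" "z \<in> model M" for z
  proof -
    have "f (chart_inv c z) \<in> chart_dom d" using W(3) that fD(6,11) by (cases "z = ?x") auto
    then show ?thesis using charted_chart_map_in_model[OF fD(2,4)] by simp
  qed
  have "((\<lambda>s. ?x + s *\<^sub>R v) \<longlongrightarrow> ?x + 0 *\<^sub>R v) (nhds 0)" by (intro tendsto_intros filterlim_ident)
  then have "\<forall>\<^sub>F s in nhds 0. ?x + s *\<^sub>R v \<in> W" using topological_tendstoD[OF _ W(1)] W(2) by simp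
  then have "\<forall>\<^sub>F s in nhds 0. ?k (?x + s *\<^sub>R v) \<in> model N"
    by eventually_elim (rule all, auto intro!: subspace_add subspace_scale fD v)
  then show ?thesis
    by (rule has_vector_derivative_lin_on(1)[OF N linear_lin_on[OF linear_id] der])
qed

text \<open>Agreement on the carrier is enough because charts see nothing else. Group and action
  laws, which hold only on carriers, enter tangent maps through this lemma.\<close>

lemma chart_deriv_cong:
  assumes f: "chart_deriv M c N d f p T" and fg: "\<And>x. x \<in> carrier M \<Longrightarrow> f x = g x"
  shows "chart_deriv M c N d g p T"
proof -
  note fD = chart_derivD[OF f]
  let ?S = "chart_map c ` chart_dom c"
  have cM: "chart_dom c \<subseteq> carrier M" by (rule chartedD(4)[OF fD(1,3)])
  have S: "openin (top_of_set (model M)) ?S" by (rule chartedD(6)[OF fD(1,3)])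
  have xS: "chart_map c p \<in> ?S" using fD(5) by blast
  have eq: "f (chart_inv c y) = g (chart_inv c y)" if "y \<in> ?S" for y
    using that charted_chart_inv[OF fD(1,3)] cM fg by auto
  have ev: "\<forall>\<^sub>F y in at (chart_map c p) within model M. f (chart_inv c y) = g (chart_inv c y)"
    by (rule eventually_at_within_openin[OF S xS eq])
  have "((chart_map d \<circ> g \<circ> chart_inv c) has_derivative T) (at (chart_map c p) within model M)"
    by (rule has_derivative_transform_eventually[OF fD(8) _ _ fD(10)])
       (use eq[OF xS] ev in \<open>auto elim: eventually_mono\<close>)
  moreover have "\<forall>\<^sub>F y in at (chart_map c p) within model M. g (chart_inv c y) \<in> chart_dom d"
    using ev fD(7) by eventually_elim simp
  moreover have "f p = g p" using fg fD(5) cM by blast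
  ultimately show ?thesis using fD unfolding chart_deriv_def by simp
qed

lemma chart_deriv_tmap_eq:
  assumes f: "chart_deriv M (chart_at M p) N (chart_at N (f p)) f p T" and v: "v \<in> model M"
  shows "tmap M N f p v = T v"
  unfolding tmap_def Let_def chart_derivD(12)[OF f]
  by (rule frechet_derivative_eq_within_subspace[OF chart_derivD(8,9,10)[OF f] v])

text \<open>\<open>T\<close> is only a witness of differentiability; replacing it by
  \<open>tmap\<close> also gives the boundedness and linearity of \<open>tmap\<close> outside the
  model space, where the two may differ.\<close>

lemma chart_deriv_tmap:
  assumes f: "chart_deriv M (chart_at M p) N (chart_at N (f p)) f p T"
  shows "chart_deriv M (chart_at M p) N (chart_at N (f p)) f p (tmap M N f p)"
proof -
  note fD = chart_derivD[OF f]
  have "(chart_map (chart_at N (f p)) \<circ> f \<circ> chart_inv (chart_at M p)) differentiable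
      (at (chart_map (chart_at M p) p) within model M)"
    using fD(8) unfolding differentiable_def by blast
  then show ?thesis
    using fD unfolding chart_deriv_def tmap_def Let_def fD(12) frechet_derivative_works by simp
qed

lemma smooth_map_chart_deriv_tmap:
  assumes f: "smooth_map M N f" and M: "charted M" and N: "charted N" and p: "p \<in> carrier M"
  shows "chart_deriv M (chart_at M p) N (chart_at N (f p)) f p (tmap M N f p)"
proof -
  have fp: "f p \<in> carrier N" using f p unfolding smooth_map_def by blast
  show ?thesis
    by (rule chart_deriv_tmap, rule smooth_map_chart_deriv[OF f M N])
       (simp_all add: chartedD(2,3)[OF M p] chartedD(2,3)[OF N fp])
qed

text \<open>A change of chart is the tangent map of the identity read in two charts, so it composes
  with other tangent maps by the chain rule.\<close>

lemma chart_deriv_transition: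
  assumes M: "smooth_manifold M" and c: "c \<in> atlas M" "d \<in> atlas M" and p: "p \<in> chart_dom c" "p \<in> chart_dom d"
  shows "chart_deriv M c M d (\<lambda>x. x) p (transition c d (chart_map c p))"
proof -
  have ch: "charted M" using M by (rule smooth_manifold_charted)
  let ?S = "chart_map c ` (chart_dom c \<inter> chart_dom d)"
  have S: "openin (top_of_set (model M)) ?S" "smooth_on (model M) ?S (chart_map d \<circ> chart_inv c)"
    using M c unfolding smooth_manifold_def by simp_all
  show ?thesis
  proof (rule chart_derivI[OF ch ch c p(1) S(1)])
    show "chart_map c p \<in> ?S" using p by blast
    then show "((chart_map d \<circ> (\<lambda>x. x) \<circ> chart_inv c) has_derivative transition c d (chart_map c p))
        (at (chart_map c p) within ?S)"
      using smooth_on_has_derivative[OF S(2)] unfolding transition_def by (simp add: comp_def)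
    show "chart_inv c y \<in> chart_dom d" if "y \<in> ?S" for y using that charted_chart_inv[OF ch c(1)] by auto
  qed blast
qed

lemma chart_inv_prod_chart:
  assumes "charted M" "charted N" "c \<in> atlas M" "d \<in> atlas N"
    "x \<in> chart_map c ` chart_dom c" "y \<in> chart_map d ` chart_dom d"
  shows "chart_inv (prod_chart c d) (x, y) = (chart_inv c x, chart_inv d y)"
proof -
  obtain p q where pq: "p \<in> chart_dom c" "x = chart_map c p" "q \<in> chart_dom d" "y = chart_map d q"
    using assms(5,6) by blast
  have "chart_inv (prod_chart c d) (chart_map (prod_chart c d) (p, q)) = (p, q)"
    by (rule charted_chart_inv[OF charted_prod_mfd[OF assms(1,2)] prod_mfd_sel(4)])
       (use assms pq in \<open>auto simp: prod_chart_sel\<close>)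
  then show ?thesis
    using pq charted_chart_inv[OF assms(1,3)] charted_chart_inv[OF assms(2,4)]
    by (simp add: prod_chart_sel)
qed

text \<open>Composing with the derivative of a binary map freezes its second argument and gives a
  partial derivative.\<close>

lemma chart_deriv_Pair1:
  assumes "charted M" "charted N" "c \<in> atlas M" "d \<in> atlas N" "p \<in> chart_dom c" "q \<in> chart_dom d"
  shows "chart_deriv M c (prod_mfd M N) (prod_chart c d) (\<lambda>x. (x, q)) p (\<lambda>v. (v, 0))"
proof (rule chart_derivI[where S = "chart_map c ` chart_dom c"])
  show "((chart_map (prod_chart c d) \<circ> (\<lambda>x. (x, q)) \<circ> chart_inv c) has_derivative (\<lambda>v. (v, 0)))
      (at (chart_map c p) within chart_map c ` chart_dom c)"
    by (rule has_derivative_transform_within[where f = "\<lambda>y. (y, chart_map d q)" and d = 1])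
       (use assms charted_chart_inv[OF assms(1,3)] charted_chart_inv[OF assms(2,4)]
         in \<open>auto simp: prod_chart_sel intro!: derivative_eq_intros\<close>)
qed (use assms chartedD(6)[OF assms(1,3)] chartedD(6)[OF assms(2,4)]
      charted_chart_inv[OF assms(1,3)] charted_chart_inv[OF assms(2,4)] in
      \<open>auto simp: prod_chart_sel prod_mfd_sel charted_prod_mfd\<close>)

lemma chart_deriv_Pair2:
  assumes "charted M" "charted N" "c \<in> atlas M" "d \<in> atlas N" "p \<in> chart_dom c" "q \<in> chart_dom d"
  shows "chart_deriv N d (prod_mfd M N) (prod_chart c d) (\<lambda>y. (p, y)) q (\<lambda>v. (0, v))"
proof (rule chart_derivI[where S = "chart_map d ` chart_dom d"])
  show "((chart_map (prod_chart c d) \<circ> (\<lambda>y. (p, y)) \<circ> chart_inv d) has_derivative (\<lambda>v. (0, v)))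
      (at (chart_map d q) within chart_map d ` chart_dom d)"
    by (rule has_derivative_transform_within[where f = "\<lambda>y. (chart_map c p, y)" and d = 1])
       (use assms charted_chart_inv[OF assms(1,3)] charted_chart_inv[OF assms(2,4)]
         in \<open>auto simp: prod_chart_sel intro!: derivative_eq_intros\<close>)
qed (use assms chartedD(6)[OF assms(1,3)] chartedD(6)[OF assms(2,4)]
      charted_chart_inv[OF assms(1,3)] charted_chart_inv[OF assms(2,4)] in
      \<open>auto simp: prod_chart_sel prod_mfd_sel charted_prod_mfd\<close>)

lemma chart_deriv_curve:
  assumes \<gamma>: "smooth_map real_mfd M \<gamma>" and M: "charted M" and c: "c \<in> atlas M" "\<gamma> t \<in> chart_dom c"
  shows "\<forall>\<^sub>F s in nhds t. \<gamma> s \<in> chart_dom c"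
    and "chart_deriv real_mfd (UNIV, id) M c \<gamma> t T
      \<Longrightarrow> ((\<lambda>s. chart_map c (\<gamma> s)) has_vector_derivative T 1) (at t)"
proof -
  have inv: "chart_inv (UNIV, id) = (\<lambda>x::real. x)" by (simp add: chart_inv_id fun_eq_iff)
  have "(UNIV, id) \<in> atlas real_mfd" by (simp add: real_mfd_sel)
  note S = smooth_map_chart_image[OF \<gamma> charted_real_mfd this c(1)]
  have "open {s. \<gamma> s \<in> chart_dom c}" using S(1) by (simp add: real_mfd_sel)
  then show "\<forall>\<^sub>F s in nhds t. \<gamma> s \<in> chart_dom c"
    unfolding eventually_nhds using c(2) by blast
  show "((\<lambda>s. chart_map c (\<gamma> s)) has_vector_derivative T 1) (at t)"
    if "chart_deriv real_mfd (UNIV, id) M c \<gamma> t T"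
  proof -
    have "((\<lambda>s. chart_map c (\<gamma> s)) has_derivative T) (at t)"
      using that unfolding chart_deriv_def by (simp add: real_mfd_sel inv comp_def)
    moreover have "T = (\<lambda>h. h *\<^sub>R T 1)"
    proof
      fix h
      from linear_scale[OF bounded_linear.linear[OF chart_deriv_linear[OF that]], of h 1]
      show "T h = h *\<^sub>R T 1" unfolding real_scaleR_def mult_1_right .
    qed
    ultimately show ?thesis unfolding has_vector_derivative_def by (simp only:)
  qed
qed

text \<open>The vector \<open>u\<close> sits inside the function being differentiated, so linearity
  in it is not immediate; symmetry moves \<open>u\<close> to the outer derivative, which is
  linear.\<close>

lemma second_derivative_lin_on:
  assumes E: "subspace E" and S: "openin (top_of_set E) S" and f: "smooth_on E S f" and z: "z \<in> S"
    and v: "v \<in> E"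
  shows "lin_on E (\<lambda>u. frechet_derivative (\<lambda>x. frechet_derivative f (at x within S) u) (at z within S) v)"
proof -
  define T where "T = frechet_derivative (\<lambda>x. frechet_derivative f (at x within S) v) (at z within S)"
  have "bounded_linear T"
    using has_derivative_bounded_linear[OF smooth_on_has_derivative[OF smooth_on_frechet_derivative[OF f v] z]]
    unfolding T_def .
  then have "lin_on E T" by (intro linear_lin_on bounded_linear.linear)
  moreover have "frechet_derivative (\<lambda>x. frechet_derivative f (at x within S) u) (at z within S) v = T u"
    if "u \<in> E" for u
    unfolding T_def by (rule second_derivative_symmetric[OF E S f z that v])
  ultimately show ?thesis
    unfolding lin_on_def by (auto simp: subspace_add[OF E] subspace_scale[OF E])
qed

text \<open>Product rule for a moving base point with a moving vector. Expanding the vector in a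
  basis leaves finitely many products of a scalar curve with a derivative in a fixed direction, so
  no operator-valued derivative is needed.\<close>

lemma has_vector_derivative_tangent_curve:
  assumes E: "fin_dim E" and S: "openin (top_of_set E) S" and f: "smooth_on E S f" and z0: "z t \<in> S"
    and zE: "\<forall>\<^sub>F s in nhds t. z s \<in> S" and z: "(z has_vector_derivative z') (at t)"
    and wE: "\<forall>\<^sub>F s in nhds t. w s \<in> E" and w: "(w has_vector_derivative w') (at t)"
  shows "((\<lambda>s. frechet_derivative f (at (z s) within S) (w s)) has_vector_derivative
     (frechet_derivative (\<lambda>x. frechet_derivative f (at x within S) (w t)) (at (z t) within S) z'
       + frechet_derivative f (at (z t) within S) w')) (at t)"
proof -
  define Df where "Df x = frechet_derivative f (at x within S)" for x
  define D2 where "D2 u = frechet_derivative (\<lambda>x. Df x u) (at (z t) within S)" for u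
  have sub: "subspace E" using E by (rule fin_dim_subspace)
  have SE: "S \<subseteq> E" using S by (rule openin_imp_subset)
  obtain B where B: "finite B" "independent B" "span B = E" using fin_dim_basis[OF E] .
  have BE: "b \<in> E" if "b \<in> B" for b using B(3) that by (auto intro: span_base)
  define r where "r b = (\<lambda>x. representation B x b)" for b
  have r: "lin_on E (r b)" for b
    unfolding lin_on_def r_def using B by (auto simp: representation_add representation_scale)
  have zE': "\<forall>\<^sub>F s in nhds t. z s \<in> E" using zE by (rule eventually_mono) (use SE in blast)
  have z': "z' \<in> E"
    by (rule has_vector_derivative_lin_on(1)[OF E linear_lin_on[OF linear_id] z zE'])
  have w': "w' \<in> E"
    by (rule has_vector_derivative_lin_on(1)[OF E linear_lin_on[OF linear_id] w wE])
  have wt: "w t \<in> E" using wE by (rule eventually_nhds_x_imp_x)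
  have Df_lin: "lin_on E (Df x)" if "x \<in> S" for x
    unfolding Df_def
    by (intro linear_lin_on bounded_linear.linear has_derivative_bounded_linear[OF smooth_on_has_derivative[OF f that]])
  have expand: "g u = (\<Sum>b\<in>B. r b u *\<^sub>R g b)" if "lin_on E g" "u \<in> E" for u and g :: "'a \<Rightarrow> 'b"
    unfolding r_def by (rule lin_on_eq_sum_basis[OF B(1,2)]) (use that B(3) in auto)
  have "((\<lambda>s. r b (w s) *\<^sub>R Df (z s) b) has_vector_derivative
      (r b (w t) *\<^sub>R D2 b z' + r b w' *\<^sub>R Df (z t) b)) (at t)" if b: "b \<in> B" for b
  proof -
    have "((\<lambda>s. r b (w s)) has_vector_derivative r b w') (at t)"
      by (rule has_vector_derivative_lin_on(2)[OF E r w wE])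
    then have 1: "((\<lambda>s. r b (w s)) has_real_derivative r b w') (at t)"
      by (simp add: has_real_derivative_iff_has_vector_derivative)
    have "((\<lambda>x. Df x b) has_derivative D2 b) (at (z t) within E)"
      using smooth_on_has_derivative[OF smooth_on_frechet_derivative[OF f BE[OF b]] z0]
      unfolding D2_def Df_def at_within_openin[OF S z0] .
    then have 2: "((\<lambda>s. Df (z s) b) has_vector_derivative D2 b z') (at t)"
      using zE' z by (rule has_derivative_curve)
    show ?thesis by (rule has_vector_derivative_scaleR[OF 1 2])
  qed
  then have der: "((\<lambda>s. \<Sum>b\<in>B. r b (w s) *\<^sub>R Df (z s) b) has_vector_derivative
      (\<Sum>b\<in>B. r b (w t) *\<^sub>R D2 b z' + r b w' *\<^sub>R Df (z t) b)) (at t)"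
    by (rule has_vector_derivative_sum)
  have val: "(\<Sum>b\<in>B. r b (w t) *\<^sub>R D2 b z' + r b w' *\<^sub>R Df (z t) b) = D2 (w t) z' + Df (z t) w'"
    unfolding sum.distrib
    using expand[OF Df_lin[OF z0] w'] expand[OF second_derivative_lin_on[OF sub S f z0 z'] wt]
    unfolding D2_def Df_def by simp
  have ev: "\<forall>\<^sub>F s in nhds t. Df (z s) (w s) = (\<Sum>b\<in>B. r b (w s) *\<^sub>R Df (z s) b)"
    using zE wE by eventually_elim (rule expand[OF Df_lin])
  have "((\<lambda>s. Df (z s) (w s)) has_vector_derivative (D2 (w t) z' + Df (z t) w')) (at t)"
    using has_vector_derivative_eventually_eq[OF der ev] unfolding val .
  then show ?thesis unfolding D2_def Df_def .
qed

lemma fin_dim_Times: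
  assumes "fin_dim A" "fin_dim B" shows "fin_dim (A \<times> B)"
proof -
  obtain a b where a: "finite a" "span a = A" and b: "finite b" "span b = B"
    using assms unfolding fin_dim_def by blast
  define c where "c = (\<lambda>x. (x, 0)) ` a \<union> (\<lambda>y. (0, y)) ` b"
  have l: "linear (\<lambda>x. (x, 0))" "linear (\<lambda>y. (0, y))"
    by (auto intro!: linearI)
  have "span c = A \<times> B"
  proof (intro equalityI subsetI)
    fix p assume "p \<in> span c"
    moreover have "subspace (A \<times> B)" using a b by (metis subspace_Times subspace_span)
    moreover have "c \<subseteq> A \<times> B"
      unfolding c_def a(2)[symmetric] b(2)[symmetric] by (auto intro: span_base span_zero)
    ultimately show "p \<in> A \<times> B" using span_minimal by blast
  next
    fix p assume p: "p \<in> A \<times> B"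
    have "(\<lambda>x. (x, 0)) ` span a \<subseteq> span c" "(\<lambda>y. (0, y)) ` span b \<subseteq> span c"
      unfolding linear_span_image[OF l(1), symmetric] linear_span_image[OF l(2), symmetric] c_def
      by (auto intro!: span_mono)
    then have "(fst p, 0) \<in> span c" "(0, snd p) \<in> span c" using p a b by auto
    then have "(fst p, 0) + (0, snd p) \<in> span c" by (rule span_add)
    then show "p \<in> span c" by simp
  qed
  moreover have "finite c" using a b unfolding c_def by blast
  ultimately show ?thesis unfolding fin_dim_def by blast
qed

lemma chart_deriv_ident:
  assumes M: "charted M" and c: "c \<in> atlas M" and p: "p \<in> chart_dom c"
  shows "chart_deriv M c M c (\<lambda>x. x) p (\<lambda>v. v)"
proof (rule chart_derivI[where S = "chart_map c ` chart_dom c"])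
  show "((chart_map c \<circ> (\<lambda>x. x) \<circ> chart_inv c) has_derivative (\<lambda>v. v))
      (at (chart_map c p) within chart_map c ` chart_dom c)"
    by (rule has_derivative_transform_within[OF has_derivative_ident, where d = 1])
       (use p charted_chart_inv[OF M c] in auto)
qed (use M c p chartedD(6)[OF M c] charted_chart_inv[OF M c] in auto)

section \<open>Lie groups\<close>

locale lie_grp =
  fixes G (structure) and LG :: "('a, 'g::real_normed_vector) manifold" and expG :: "'g \<Rightarrow> 'a"
  assumes lie: "lie_group G LG" and exp: "exponential_map G LG expG"
begin

section \<open>Left and right translations\<close>

lemma is_group: "group G" and LG: "smooth_manifold LG" and carrier_LG: "carrier LG = carrier G"
  and model_LG: "model LG = UNIV" and smooth_mult: "smooth_map (prod_mfd LG LG) LG (\<lambda>(x, y). x \<otimes> y)"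
  using lie unfolding lie_group_def by auto

sublocale group G by (rule is_group)

lemma charted_LG: "charted LG"
  using LG by (rule smooth_manifold_charted)

lemma fin_dim_algebra: "fin_dim (UNIV :: 'g set)"
  using smooth_manifold_fin_dim[OF LG] model_LG by simp

lemma model_LG2: "model (prod_mfd LG LG) = UNIV"
  by (simp add: prod_mfd_sel model_LG)

lemmas charted_LG2 = charted_prod_mfd[OF charted_LG charted_LG]

lemma chart_at_LG:
  "p \<in> carrier G \<Longrightarrow> chart_at LG p \<in> atlas LG" "p \<in> carrier G \<Longrightarrow> p \<in> chart_dom (chart_at LG p)"
  using chartedD(2,3)[OF charted_LG] carrier_LG by auto

text \<open>The fixed chart in which all group elements near the identity are read, in place of
  their own preferred charts.\<close>

definition "c1 = chart_at LG \<one>"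
definition "x1 = chart_map c1 \<one>"

lemma c1: "c1 \<in> atlas LG" "\<one> \<in> chart_dom c1"
  unfolding c1_def by (auto intro: chart_at_LG)

lemma c1_carrier: "p \<in> chart_dom c1 \<Longrightarrow> p \<in> carrier G"
  using chartedD(4)[OF charted_LG c1(1)] carrier_LG by blast

lemma open_c1: "open (chart_map c1 ` chart_dom c1)"
  using chartedD(6)[OF charted_LG c1(1)] by (simp add: model_LG)

lemma chart_deriv_mult_at:
  assumes g: "g \<in> carrier G" and p: "p \<in> carrier G"
  shows "chart_deriv LG (chart_at LG p) LG (chart_at LG (g \<otimes> p)) (\<lambda>x. g \<otimes> x) p
      (\<lambda>v. tmap (prod_mfd LG LG) LG (\<lambda>(x, y). x \<otimes> y) (g, p) (0, v))"
    and "chart_deriv LG (chart_at LG g) LG (chart_at LG (g \<otimes> p)) (\<lambda>x. x \<otimes> p) g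
      (\<lambda>v. tmap (prod_mfd LG LG) LG (\<lambda>(x, y). x \<otimes> y) (g, p) (v, 0))"
proof -
  have *: "chart_deriv (prod_mfd LG LG) (prod_chart (chart_at LG g) (chart_at LG p)) LG
      (chart_at LG (g \<otimes> p)) (\<lambda>(x, y). x \<otimes> y) (g, p) (tmap (prod_mfd LG LG) LG (\<lambda>(x, y). x \<otimes> y) (g, p))"
    using smooth_map_chart_deriv_tmap[OF smooth_mult charted_LG2 charted_LG, of "(g, p)"] g p
    by (simp add: prod_mfd_sel carrier_LG)
  note charts = charted_LG charted_LG chart_at_LG(1)[OF g] chart_at_LG(1)[OF p]
    chart_at_LG(2)[OF g] chart_at_LG(2)[OF p]
  show "chart_deriv LG (chart_at LG p) LG (chart_at LG (g \<otimes> p)) (\<lambda>x. g \<otimes> x) p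
      (\<lambda>v. tmap (prod_mfd LG LG) LG (\<lambda>(x, y). x \<otimes> y) (g, p) (0, v))"
    using chart_deriv_comp[OF chart_deriv_Pair2[OF charts] *] by simp
  show "chart_deriv LG (chart_at LG g) LG (chart_at LG (g \<otimes> p)) (\<lambda>x. x \<otimes> p) g
      (\<lambda>v. tmap (prod_mfd LG LG) LG (\<lambda>(x, y). x \<otimes> y) (g, p) (v, 0))"
    using chart_deriv_comp[OF chart_deriv_Pair1[OF charts] *] by simp
qed

lemma chart_deriv_left:
  "g \<in> carrier G \<Longrightarrow> p \<in> carrier G \<Longrightarrow>
    chart_deriv LG (chart_at LG p) LG (chart_at LG (g \<otimes> p)) (\<lambda>x. g \<otimes> x) p (left_tr G LG p g)"
  unfolding left_tr_def by (rule chart_deriv_tmap[OF chart_deriv_mult_at(1)])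

text \<open>Chain rule for \<open>inv g \<otimes> (g \<otimes> x) = x\<close>. It is what recovers
  \<xi> from \<open>T\<^sub>e L\<^sub>g \<xi>\<close> in the formula for
  \<open>\<Omega>\<close>.\<close>

lemma left_tr_inverse:
  assumes g: "g \<in> carrier G"
  shows "left_tr G LG g (inv g) (left_tr G LG \<one> g \<xi>) = \<xi>"
proof -
  have 1: "chart_deriv LG c1 LG (chart_at LG g) (\<lambda>x. g \<otimes> x) \<one> (left_tr G LG \<one> g)"
    using chart_deriv_left[OF g one_closed] g unfolding c1_def by simp
  have 2: "chart_deriv LG (chart_at LG g) LG c1 (\<lambda>x. inv g \<otimes> x) (g \<otimes> \<one>) (left_tr G LG g (inv g))"
    using chart_deriv_left[OF inv_closed[OF g] g] g unfolding c1_def by simp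
  have "chart_deriv LG c1 LG c1 (\<lambda>x. x) \<one> (\<lambda>v. left_tr G LG g (inv g) (left_tr G LG \<one> g v))"
    by (rule chart_deriv_cong[OF chart_deriv_comp[OF 1 2]])
       (simp add: g carrier_LG m_assoc[symmetric])
  moreover have "chart_deriv LG c1 LG c1 (\<lambda>x. x) \<one> (\<lambda>v. v)"
    by (rule chart_deriv_ident[OF charted_LG c1])
  ultimately show ?thesis using chart_deriv_unique model_LG by (metis UNIV_I)
qed

end

context lie_grp
begin

text \<open>The multiplication read in \<open>c1\<close> and its derivatives.
  \<open>D2\<mu> v w\<close> differentiates first along \<open>v\<close>, then along
  \<open>w\<close>, at the coordinates of the pair of identities.\<close>

definition "\<mu> = chart_map c1 \<circ> (\<lambda>(x, y). x \<otimes> y) \<circ> chart_inv (prod_chart c1 c1)"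
definition "S\<mu> = chart_map (prod_chart c1 c1) `
  {p \<in> chart_dom (prod_chart c1 c1). (\<lambda>(x, y). x \<otimes> y) p \<in> chart_dom c1}"
definition "D\<mu> z v = frechet_derivative \<mu> (at z within S\<mu>) v"
definition "D2\<mu> v w = frechet_derivative (\<lambda>z. D\<mu> z v) (at (x1, x1) within S\<mu>) w"

lemma c11: "prod_chart c1 c1 \<in> atlas (prod_mfd LG LG)"
  by (rule prod_mfd_sel(4)[OF c1(1) c1(1)])

lemma S\<mu>: "openin (top_of_set UNIV) S\<mu>" "open S\<mu>" and smooth_\<mu>: "smooth_on UNIV S\<mu> \<mu>"
  using smooth_map_chart_image(1,2)[OF smooth_mult charted_LG2 c11 c1(1)]
  unfolding S\<mu>_def \<mu>_def model_LG2 by simp_all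

lemma in_S\<mu>:
  "p \<in> chart_dom c1 \<Longrightarrow> q \<in> chart_dom c1 \<Longrightarrow> p \<otimes> q \<in> chart_dom c1
     \<Longrightarrow> (chart_map c1 p, chart_map c1 q) \<in> S\<mu>"
  unfolding S\<mu>_def by (force simp: prod_chart_sel image_iff)

lemma x1_S\<mu>: "(x1, x1) \<in> S\<mu>"
  unfolding x1_def using c1 by (intro in_S\<mu>) auto

lemma chart_deriv_mult:
  assumes "p \<in> chart_dom c1" "q \<in> chart_dom c1" "p \<otimes> q \<in> chart_dom c1"
  shows "chart_deriv (prod_mfd LG LG) (prod_chart c1 c1) LG c1 (\<lambda>(x, y). x \<otimes> y) (p, q)
    (D\<mu> (chart_map c1 p, chart_map c1 q))"
proof -
  have D: "D\<mu> (chart_map c1 p, chart_map c1 q) = frechet_derivative \<mu> (at (chart_map c1 p, chart_map c1 q))"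
    unfolding D\<mu>_def using at_within_openin[OF S\<mu>(1) in_S\<mu>[OF assms]] by (simp add: fun_eq_iff)
  show ?thesis
    using smooth_map_chart_deriv[OF smooth_mult charted_LG2 charted_LG c11 c1(1), of "(p, q)"] assms
    unfolding D \<mu>_def by (simp add: prod_chart_sel model_LG2)
qed

lemma chart_deriv_left1:
  assumes "p \<in> chart_dom c1" "q \<in> chart_dom c1" "p \<otimes> q \<in> chart_dom c1"
  shows "chart_deriv LG c1 LG c1 (\<lambda>x. p \<otimes> x) q (\<lambda>v. D\<mu> (chart_map c1 p, chart_map c1 q) (0, v))"
  using chart_deriv_comp[OF chart_deriv_Pair2[OF charted_LG charted_LG c1(1) c1(1) assms(1,2)]
      chart_deriv_mult[OF assms]] by simp

lemma chart_deriv_right1: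
  assumes "p \<in> chart_dom c1" "q \<in> chart_dom c1" "p \<otimes> q \<in> chart_dom c1"
  shows "chart_deriv LG c1 LG c1 (\<lambda>x. x \<otimes> q) p (\<lambda>v. D\<mu> (chart_map c1 p, chart_map c1 q) (v, 0))"
  using chart_deriv_comp[OF chart_deriv_Pair1[OF charted_LG charted_LG c1(1) c1(1) assms(1,2)]
      chart_deriv_mult[OF assms]] by simp

text \<open>Right multiplication by the identity is the identity map. This holds at every
  \<open>y\<close> of the chart, so the expression is constant in \<open>y\<close> and can be
  differentiated once more.\<close>

lemma D\<mu>_right_one:
  assumes "y \<in> chart_map c1 ` chart_dom c1" shows "D\<mu> (y, x1) (v, 0) = v"
proof -
  obtain p where p: "p \<in> chart_dom c1" "y = chart_map c1 p" using assms by blast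
  have pG: "p \<in> carrier G" by (rule c1_carrier[OF p(1)])
  have 1: "chart_deriv LG c1 LG c1 (\<lambda>x. x \<otimes> \<one>) p (\<lambda>v. D\<mu> (y, x1) (v, 0))"
    unfolding p(2) x1_def using p c1 pG by (intro chart_deriv_right1) auto
  have 2: "chart_deriv LG c1 LG c1 (\<lambda>x. x) p (\<lambda>v. D\<mu> (y, x1) (v, 0))"
    by (rule chart_deriv_cong[OF 1]) (simp add: carrier_LG)
  show ?thesis
    using chart_deriv_unique[OF 2 chart_deriv_ident[OF charted_LG c1(1) p(1)]] by (simp add: model_LG)
qed

lemma D\<mu>_one_left: "D\<mu> (x1, x1) (0, v) = v"
proof -
  have 1: "chart_deriv LG c1 LG c1 (\<lambda>x. \<one> \<otimes> x) \<one> (\<lambda>v. D\<mu> (x1, x1) (0, v))"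
    unfolding x1_def using c1 by (intro chart_deriv_left1) auto
  have 2: "chart_deriv LG c1 LG c1 (\<lambda>x. x) \<one> (\<lambda>v. D\<mu> (x1, x1) (0, v))"
    by (rule chart_deriv_cong[OF 1]) (simp add: carrier_LG)
  show ?thesis
    using chart_deriv_unique[OF 2 chart_deriv_ident[OF charted_LG c1]] by (simp add: model_LG)
qed

lemma x1_in: "x1 \<in> chart_map c1 ` chart_dom c1"
  unfolding x1_def using c1(2) by blast

text \<open>The preferred chart at \<open>p\<close>, in which \<open>left_tr\<close> is expressed,
  cancels against the transition to \<open>c1\<close>. What remains is the partial derivative of the
  multiplication in its second factor, which is smooth in \<open>y\<close>.\<close>

lemma field_in_left_invariant:
  assumes "y \<in> chart_map c1 ` chart_dom c1"
  shows "field_in LG c1 (\<lambda>g. left_tr G LG \<one> g \<xi>) y = D\<mu> (y, x1) (0, \<xi>)"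
proof -
  obtain p where p: "p \<in> chart_dom c1" "y = chart_map c1 p" using assms by blast
  have pG: "p \<in> carrier G" by (rule c1_carrier[OF p(1)])
  have inv: "chart_inv c1 y = p" unfolding p(2) by (rule charted_chart_inv[OF charted_LG c1(1) p(1)])
  have 1: "chart_deriv LG c1 LG (chart_at LG p) (\<lambda>x. p \<otimes> x) \<one> (left_tr G LG \<one> p)"
    using chart_deriv_left[OF pG one_closed] pG unfolding c1_def by simp
  have 2: "chart_deriv LG (chart_at LG p) LG c1 (\<lambda>x. x) (p \<otimes> \<one>)
      (transition (chart_at LG p) c1 (chart_map (chart_at LG p) (p \<otimes> \<one>)))"
    by (rule chart_deriv_transition[OF LG]) (simp_all add: chart_at_LG pG c1 p(1))
  have 3: "chart_deriv LG c1 LG c1 (\<lambda>x. p \<otimes> x) \<one> (\<lambda>v. D\<mu> (y, x1) (0, v))"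
    unfolding p(2) x1_def using p c1 pG by (intro chart_deriv_left1) auto
  show ?thesis
    using chart_deriv_unique[OF chart_deriv_comp[OF 1 2] 3] pG
    unfolding field_in_def Let_def inv by (simp add: model_LG)
qed

lemma D2\<mu>_has_derivative: "((\<lambda>z. D\<mu> z v) has_derivative D2\<mu> v) (at (x1, x1))"
  using smooth_on_has_derivative[OF smooth_on_frechet_derivative[OF smooth_\<mu> UNIV_I] x1_S\<mu>, of v]
  unfolding D2\<mu>_def D\<mu>_def at_within_open[OF x1_S\<mu> S\<mu>(2)] .

lemma D2\<mu>_linear: "linear (D2\<mu> v)"
  using D2\<mu>_has_derivative has_derivative_bounded_linear bounded_linear.linear by blast

lemma D2\<mu>_sym: "D2\<mu> v w = D2\<mu> w v"
  unfolding D2\<mu>_def D\<mu>_def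
  by (rule second_derivative_symmetric[OF subspace_UNIV S\<mu>(1) smooth_\<mu> x1_S\<mu> UNIV_I UNIV_I])

text \<open>At the identity the left-invariant fields take the values \<xi> and \<eta>, and their
  derivatives are mixed second derivatives of the multiplication; the bracket is the
  antisymmetrisation of these.\<close>

lemma lie_bracket_D2\<mu>: "lie_bracket G LG \<xi> \<eta> = D2\<mu> (0, \<eta>) (\<xi>, 0) - D2\<mu> (0, \<xi>) (\<eta>, 0)"
proof -
  have der: "(field_in LG c1 (\<lambda>g. left_tr G LG \<one> g \<zeta>) has_derivative (\<lambda>v. D2\<mu> (0, \<zeta>) (v, 0))) (at x1)"
    for \<zeta>
  proof (rule has_derivative_transform_within_open[OF _ open_c1 x1_in])
    have "((\<lambda>y. (y, x1)) has_derivative (\<lambda>v. (v, 0))) (at x1)" by (auto intro!: derivative_eq_intros)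
    from has_derivative_compose[OF this D2\<mu>_has_derivative]
    show "((\<lambda>y. D\<mu> (y, x1) (0, \<zeta>)) has_derivative (\<lambda>v. D2\<mu> (0, \<zeta>) (v, 0))) (at x1)" .
  qed (simp add: field_in_left_invariant)
  have at: "at x1 within chart_map c1 ` chart_dom c1 = at x1"
    by (rule at_within_open[OF x1_in open_c1])
  show ?thesis
    unfolding lie_bracket_def field_bracket_def Let_def c1_def[symmetric] x1_def[symmetric] at
      frechet_derivative_at[OF der, symmetric] field_in_left_invariant[OF x1_in] D\<mu>_one_left ..
qed

text \<open>\<open>D2\<mu>\<close> is visibly linear only in its second argument; its symmetry
  supplies the first.\<close>

lemma linear_lie_bracket: "linear (lie_bracket G LG \<xi>)" "linear (\<lambda>\<xi>. lie_bracket G LG \<xi> \<eta>)"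
proof -
  have add: "(0::'g, a + b) = (0, a) + (0, b)" "(a + b, 0::'g) = (a, 0) + (b, 0)"
    and scale: "(0::'g, r *\<^sub>R a) = r *\<^sub>R (0, a)" "(r *\<^sub>R a, 0::'g) = r *\<^sub>R (a, 0)" for a b :: 'g and r by auto
  note s = linear_add[OF D2\<mu>_linear] linear_scale[OF D2\<mu>_linear]
  have l: "linear (\<lambda>a. D2\<mu> v (0, a))" "linear (\<lambda>a. D2\<mu> v (a, 0))" for v
    by (auto intro!: linearI simp only: add scale s)
  have l2: "linear (\<lambda>a. D2\<mu> (0, a) v)" "linear (\<lambda>a. D2\<mu> (a, 0) v)" for v
    using l[of v] by (simp_all add: D2\<mu>_sym[of v])
  show "linear (lie_bracket G LG \<xi>)" "linear (\<lambda>\<xi>. lie_bracket G LG \<xi> \<eta>)"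
    unfolding lie_bracket_D2\<mu> by (intro linear_compose_sub l l2)+
qed

lemma lie_bracket_skew: "lie_bracket G LG \<eta> \<xi> = - lie_bracket G LG \<xi> \<eta>"
  unfolding lie_bracket_D2\<mu> by simp

subsection \<open>The exponential map and the adjoint representation\<close>

lemma exp_smooth: "smooth_map real_mfd LG (\<lambda>t. expG (t *\<^sub>R \<xi>))"
  and exp_add: "expG ((s + t) *\<^sub>R \<xi>) = expG (s *\<^sub>R \<xi>) \<otimes> expG (t *\<^sub>R \<xi>)"
  and exp_tmap: "tmap real_mfd LG (\<lambda>t. expG (t *\<^sub>R \<xi>)) 0 1 = \<xi>"
  using exp unfolding exponential_map_def by blast+

lemma exp_carrier: "expG (t *\<^sub>R \<xi>) \<in> carrier G"
  using exp_smooth[of \<xi>] unfolding smooth_map_def by (auto simp: real_mfd_sel carrier_LG)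

lemma exp_zero: "expG 0 = \<one>"
proof -
  have "expG 0 \<in> carrier G" using exp_carrier[of 0] by simp
  moreover have "expG 0 = expG 0 \<otimes> expG 0" using exp_add[of 0 0] by simp
  ultimately show ?thesis using r_cancel_one' by metis
qed

lemma exp_minus: "inv (expG (t *\<^sub>R \<xi>)) = expG ((- t) *\<^sub>R \<xi>)"
  using exp_add[of "- t" t \<xi>] exp_carrier[of t \<xi>] exp_carrier[of "- t" \<xi>] exp_zero
  by (intro inv_equality) auto

lemma exp_eventually_c1: "\<forall>\<^sub>F t in nhds 0. expG (t *\<^sub>R \<xi>) \<in> chart_dom c1"
  by (rule chart_deriv_curve(1)[OF exp_smooth charted_LG c1(1)]) (simp add: exp_zero c1)

lemma chart_deriv_exp:
  "chart_deriv real_mfd (UNIV, id) LG c1 (\<lambda>t. expG (t *\<^sub>R \<xi>)) 0 (\<lambda>s. s *\<^sub>R \<xi>)"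
proof -
  have 1: "chart_deriv real_mfd (UNIV, id) LG c1 (\<lambda>t. expG (t *\<^sub>R \<xi>)) 0
      (tmap real_mfd LG (\<lambda>t. expG (t *\<^sub>R \<xi>)) 0)"
    using smooth_map_chart_deriv_tmap[OF exp_smooth charted_real_mfd charted_LG, of 0 \<xi>]
    by (simp add: real_mfd_sel exp_zero c1_def)
  have "tmap real_mfd LG (\<lambda>t. expG (t *\<^sub>R \<xi>)) 0 = (\<lambda>s. s *\<^sub>R \<xi>)"
  proof
    fix s
    from linear_scale[OF bounded_linear.linear[OF chart_deriv_linear[OF 1]], of s 1]
    show "tmap real_mfd LG (\<lambda>t. expG (t *\<^sub>R \<xi>)) 0 s = s *\<^sub>R \<xi>"
      unfolding real_scaleR_def mult_1_right exp_tmap .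
  qed
  with 1 show ?thesis by (simp only:)
qed

lemma exp_curve: "((\<lambda>t. chart_map c1 (expG (t *\<^sub>R \<xi>))) has_vector_derivative \<xi>) (at 0)"
  using chart_deriv_curve(2)[OF exp_smooth charted_LG c1(1) _ chart_deriv_exp, of \<xi>]
  by (simp add: exp_zero c1)

text \<open>Conjugation is a left translation to \<open>g\<close> followed by a right translation
  back. It fixes the identity, so \<open>c1\<close> serves at both ends although \<open>g\<close>
  may lie outside its domain.\<close>

lemma chart_deriv_conj:
  assumes g: "g \<in> carrier G"
  shows "chart_deriv LG c1 LG c1 (\<lambda>x. g \<otimes> x \<otimes> inv g) \<one> (Ad G LG g)"
proof -
  have right: "chart_deriv LG (chart_at LG g) LG c1 (\<lambda>x. x \<otimes> inv g) (g \<otimes> \<one>)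
      (\<lambda>v. tmap (prod_mfd LG LG) LG (\<lambda>(x, y). x \<otimes> y) (g, inv g) (v, 0))"
    using chart_deriv_mult_at(2)[OF g inv_closed[OF g]] g by (simp add: c1_def)
  have left: "chart_deriv LG c1 LG (chart_at LG g) (\<lambda>x. g \<otimes> x) \<one> (left_tr G LG \<one> g)"
    using chart_deriv_left[OF g one_closed] g unfolding c1_def by simp
  note comp = chart_deriv_comp[OF left right]
  have "chart_at LG (g \<otimes> \<one> \<otimes> inv g) = c1" using g by (simp add: c1_def)
  then show ?thesis
    using chart_deriv_tmap[of LG \<one> LG "\<lambda>x. g \<otimes> x \<otimes> inv g"] comp
    unfolding Ad_def by (simp add: c1_def[symmetric])
qed

lemma linear_Ad: "g \<in> carrier G \<Longrightarrow> linear (Ad G LG g)"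
  by (rule bounded_linear.linear[OF chart_deriv_linear[OF chart_deriv_conj]])

lemma Ad_mult:
  assumes g: "g \<in> carrier G" and k: "k \<in> carrier G"
  shows "Ad G LG (g \<otimes> k) \<xi> = Ad G LG g (Ad G LG k \<xi>)"
proof -
  have k1: "k \<otimes> \<one> \<otimes> inv k = \<one>" using k by simp
  have "chart_deriv LG c1 LG c1 (\<lambda>x. g \<otimes> x \<otimes> inv g) (k \<otimes> \<one> \<otimes> inv k) (Ad G LG g)"
    unfolding k1 by (rule chart_deriv_conj[OF g])
  note comp = chart_deriv_comp[OF chart_deriv_conj[OF k] this]
  have "chart_deriv LG c1 LG c1 (\<lambda>x. g \<otimes> k \<otimes> x \<otimes> inv (g \<otimes> k)) \<one> (\<lambda>v. Ad G LG g (Ad G LG k v))"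
    by (rule chart_deriv_cong[OF comp]) (simp add: carrier_LG g k inv_mult_group m_assoc)
  from chart_deriv_unique[OF chart_deriv_conj[OF m_closed[OF g k]] this]
  show ?thesis by (simp add: model_LG)
qed

lemma Ad_one: "Ad G LG \<one> \<xi> = \<xi>"
proof -
  have "chart_deriv LG c1 LG c1 (\<lambda>x. x) \<one> (Ad G LG \<one>)"
    by (rule chart_deriv_cong[OF chart_deriv_conj[OF one_closed]]) (simp add: carrier_LG)
  from chart_deriv_unique[OF this chart_deriv_ident[OF charted_LG c1]]
  show ?thesis by (simp add: model_LG)
qed

text \<open>While the exponential and its inverse are both in the domain of \<open>c1\<close>, the
  two translations that make up the conjugation can be read in that chart.\<close>

lemma Ad_exp_D\<mu>:
  assumes p: "expG (t *\<^sub>R \<eta>) \<in> chart_dom c1" and q: "expG ((- t) *\<^sub>R \<eta>) \<in> chart_dom c1"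
  shows "Ad G LG (expG (t *\<^sub>R \<eta>)) \<zeta> =
    D\<mu> (chart_map c1 (expG (t *\<^sub>R \<eta>)), chart_map c1 (expG ((- t) *\<^sub>R \<eta>)))
      (D\<mu> (chart_map c1 (expG (t *\<^sub>R \<eta>)), x1) (0, \<zeta>), 0)"
proof -
  let ?p = "expG (t *\<^sub>R \<eta>)" and ?q = "expG ((- t) *\<^sub>R \<eta>)"
  have pG: "?p \<in> carrier G" and qG: "?q \<in> carrier G" by (rule exp_carrier)+
  have iq: "?q = inv ?p" by (rule exp_minus[symmetric])
  have 1: "chart_deriv LG c1 LG c1 (\<lambda>x. ?p \<otimes> x) \<one> (\<lambda>v. D\<mu> (chart_map c1 ?p, x1) (0, v))"
    unfolding x1_def using p pG c1 by (intro chart_deriv_left1) auto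
  have 2: "chart_deriv LG c1 LG c1 (\<lambda>x. x \<otimes> ?q) (?p \<otimes> \<one>) (\<lambda>v. D\<mu> (chart_map c1 ?p, chart_map c1 ?q) (v, 0))"
  proof -
    have "?p \<otimes> ?q \<in> chart_dom c1" using c1(2) pG unfolding iq by simp
    from chart_deriv_right1[OF p q this] show ?thesis using pG by simp
  qed
  have "chart_deriv LG c1 LG c1 (\<lambda>x. ?p \<otimes> x \<otimes> inv ?p) \<one>
      (\<lambda>v. D\<mu> (chart_map c1 ?p, chart_map c1 ?q) (D\<mu> (chart_map c1 ?p, x1) (0, v), 0))"
    using chart_deriv_comp[OF 1 2] unfolding iq .
  from chart_deriv_unique[OF chart_deriv_conj[OF pG] this] show ?thesis by (simp add: model_LG)
qed

text \<open>The product rule is applied to the formula of \<open>Ad_exp_D\<mu>\<close>. Its terms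
  are \<open>D2\<mu> (0, \<zeta>) (\<eta>, 0)\<close> from the left translation and
  \<open>D2\<mu> (\<zeta>, 0) (\<eta>, - \<eta>)\<close> from the right one; only the part along
  \<open>(0, - \<eta>)\<close> of the latter survives, and the symmetry of \<open>D2\<mu>\<close>
  makes the sum the bracket.\<close>

lemma Ad_exp_derivative:
  "((\<lambda>t. Ad G LG (expG (t *\<^sub>R \<eta>)) \<zeta>) has_vector_derivative lie_bracket G LG \<eta> \<zeta>) (at 0)"
proof -
  define \<gamma> where "\<gamma> t = chart_map c1 (expG (t *\<^sub>R \<eta>))" for t
  have \<gamma>: "(\<gamma> has_vector_derivative \<eta>) (at 0)" unfolding \<gamma>_def by (rule exp_curve)
  have \<gamma>0: "\<gamma> 0 = x1" unfolding \<gamma>_def x1_def by (simp add: exp_zero)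
  have \<gamma>m: "((\<lambda>t. \<gamma> (- t)) has_vector_derivative - \<eta>) (at 0)"
  proof -
    have m: "\<gamma> (- t) = chart_map c1 (expG (t *\<^sub>R (- \<eta>)))" for t unfolding \<gamma>_def by simp
    show ?thesis unfolding m by (rule exp_curve)
  qed
  have ev: "\<forall>\<^sub>F t in nhds 0. expG (t *\<^sub>R \<eta>) \<in> chart_dom c1" by (rule exp_eventually_c1)
  have evm: "\<forall>\<^sub>F t in nhds 0. expG ((- t) *\<^sub>R \<eta>) \<in> chart_dom c1"
    using exp_eventually_c1[of "- \<eta>"] by simp
  define a where "a t = D\<mu> (\<gamma> t, x1) (0, \<zeta>)" for t
  have a0: "a 0 = \<zeta>" unfolding a_def \<gamma>0 by (rule D\<mu>_one_left)
  have a: "(a has_vector_derivative D2\<mu> (0, \<zeta>) (\<eta>, 0)) (at 0)"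
  proof -
    have "((\<lambda>z. D\<mu> z (0, \<zeta>)) has_derivative D2\<mu> (0, \<zeta>)) (at (\<gamma> 0, x1) within UNIV)"
      unfolding \<gamma>0 by (rule D2\<mu>_has_derivative)
    moreover have "((\<lambda>t. (\<gamma> t, x1)) has_vector_derivative (\<eta>, 0)) (at 0)"
      by (intro has_vector_derivative_Pair \<gamma> has_vector_derivative_const)
    ultimately show ?thesis
      unfolding a_def using has_derivative_curve[of "\<lambda>z. D\<mu> z (0, \<zeta>)" _ "\<lambda>t. (\<gamma> t, x1)"] by simp
  qed
  define z where "z t = (\<gamma> t, \<gamma> (- t))" for t
  have z: "(z has_vector_derivative (\<eta>, - \<eta>)) (at 0)"
    unfolding z_def by (intro has_vector_derivative_Pair \<gamma> \<gamma>m)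
  have z0: "z 0 = (x1, x1)" by (simp add: z_def \<gamma>0)
  have zS: "\<forall>\<^sub>F t in nhds 0. z t \<in> S\<mu>"
    using ev evm
  proof eventually_elim
    case (elim t)
    have "expG (t *\<^sub>R \<eta>) \<otimes> expG ((- t) *\<^sub>R \<eta>) = \<one>"
      using exp_add[of t "- t" \<eta>] exp_zero by simp
    then show ?case using in_S\<mu>[OF elim] c1(2) unfolding z_def \<gamma>_def by simp
  qed
  have w: "((\<lambda>t. (a t, 0)) has_vector_derivative (D2\<mu> (0, \<zeta>) (\<eta>, 0), 0)) (at 0)"
    by (intro has_vector_derivative_Pair a has_vector_derivative_const)
  have fd: "fin_dim (UNIV :: ('g \<times> 'g) set)"
    using fin_dim_Times[OF fin_dim_algebra fin_dim_algebra] by simp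
  have D: "((\<lambda>t. D\<mu> (z t) (a t, 0)) has_vector_derivative
      (D2\<mu> (a 0, 0) (\<eta>, - \<eta>) + D\<mu> (z 0) (D2\<mu> (0, \<zeta>) (\<eta>, 0), 0))) (at 0)"
    using has_vector_derivative_tangent_curve[OF fd S\<mu>(1) smooth_\<mu> _ zS z _ w] x1_S\<mu>
    unfolding D2\<mu>_def D\<mu>_def z0 by simp
  \<comment> \<open>By \<open>D\<mu>_right_one\<close> the function differentiated here is
    constantly \<zeta>.\<close>
  have zz: "D2\<mu> (\<zeta>, 0) (\<eta>, 0) = 0"
  proof -
    have "((\<lambda>y. (y, x1)) has_derivative (\<lambda>v. (v, 0))) (at x1)" by (auto intro!: derivative_eq_intros)
    from has_derivative_compose[OF this D2\<mu>_has_derivative]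
    have "((\<lambda>y. D\<mu> (y, x1) (\<zeta>, 0)) has_derivative (\<lambda>v. D2\<mu> (\<zeta>, 0) (v, 0))) (at x1)" .
    then have "((\<lambda>y. \<zeta>) has_derivative (\<lambda>v. D2\<mu> (\<zeta>, 0) (v, 0))) (at x1)"
      by (rule has_derivative_transform_within_open[OF _ open_c1 x1_in]) (rule D\<mu>_right_one)
    then have "(\<lambda>v. D2\<mu> (\<zeta>, 0) (v, 0)) = (\<lambda>v. 0)"
      using has_derivative_const by (rule has_derivative_unique)
    then show ?thesis by meson
  qed
  have "(\<eta>, - \<eta>) = (\<eta>, 0) - (0, \<eta>)" by simp
  then have "D2\<mu> (\<zeta>, 0) (\<eta>, - \<eta>) = D2\<mu> (\<zeta>, 0) (\<eta>, 0) - D2\<mu> (\<zeta>, 0) (0, \<eta>)"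
    by (simp only: linear_diff[OF D2\<mu>_linear])
  then have val: "D2\<mu> (a 0, 0) (\<eta>, - \<eta>) + D\<mu> (z 0) (D2\<mu> (0, \<zeta>) (\<eta>, 0), 0) = lie_bracket G LG \<eta> \<zeta>"
    unfolding a0 z0 lie_bracket_D2\<mu> D\<mu>_right_one[OF x1_in] zz D2\<mu>_sym[of "(\<zeta>, 0)" "(0, \<eta>)"] by simp
  have "\<forall>\<^sub>F t in nhds 0. Ad G LG (expG (t *\<^sub>R \<eta>)) \<zeta> = D\<mu> (z t) (a t, 0)"
    using ev evm
  proof eventually_elim
    case (elim t)
    show ?case unfolding z_def a_def \<gamma>_def by (rule Ad_exp_D\<mu>[OF elim])
  qed
  with D show ?thesis unfolding val by (rule has_vector_derivative_eventually_eq)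
qed

end

section \<open>Actions and isotropy representations\<close>

locale lie_action = lie_grp G LG expG
  for G (structure) and LG :: "('a, 'g::real_normed_vector) manifold" and expG :: "'g \<Rightarrow> 'a" +
  fixes M :: "('p, 'e::real_normed_vector) manifold" and \<Phi> :: "'a \<Rightarrow> 'p \<Rightarrow> 'p" and m :: 'p
  assumes M: "smooth_manifold M" and action: "smooth_action G LG M \<Phi>" and m: "m \<in> carrier M"
begin

lemma smooth_\<Phi>: "smooth_map (prod_mfd LG M) M (\<lambda>(g, p). \<Phi> g p)"
  and \<Phi>_one: "p \<in> carrier M \<Longrightarrow> \<Phi> \<one> p = p"
  and \<Phi>_mult: "p \<in> carrier M \<Longrightarrow> g \<in> carrier G \<Longrightarrow> g' \<in> carrier G \<Longrightarrow> \<Phi> (g \<otimes> g') p = \<Phi> g (\<Phi> g' p)"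
  using action unfolding smooth_action_def by blast+

lemma \<Phi>_carrier: "p \<in> carrier M \<Longrightarrow> g \<in> carrier G \<Longrightarrow> \<Phi> g p \<in> carrier M"
  using funcset_mem[of "\<lambda>(g, p). \<Phi> g p" "carrier G \<times> carrier M" "carrier M" "(g, p)"] smooth_\<Phi>
  unfolding smooth_map_def prod_mfd_sel carrier_LG by simp

lemma charted_M: "charted M"
  using M by (rule smooth_manifold_charted)

lemma fin_dim_M: "fin_dim (model M)"
  using M by (rule smooth_manifold_fin_dim)

lemmas subspace_M = chartedD(1)[OF charted_M]

definition "cm = chart_at M m"
definition "xm = chart_map cm m"

lemma cm: "cm \<in> atlas M" "m \<in> chart_dom cm"
  unfolding cm_def by (auto intro: chartedD(2,3)[OF charted_M m])

lemmas charted_LGM = charted_prod_mfd[OF charted_LG charted_M]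

definition "\<phi> = chart_map cm \<circ> (\<lambda>(g, p). \<Phi> g p) \<circ> chart_inv (prod_chart c1 cm)"
definition "S\<phi> = chart_map (prod_chart c1 cm) `
  {p \<in> chart_dom (prod_chart c1 cm). (\<lambda>(g, p). \<Phi> g p) p \<in> chart_dom cm}"
definition "D\<phi> z v = frechet_derivative \<phi> (at z within S\<phi>) v"

lemma model_LGM: "model (prod_mfd LG M) = UNIV \<times> model M"
  by (simp add: prod_mfd_sel model_LG)

lemma c1m: "prod_chart c1 cm \<in> atlas (prod_mfd LG M)"
  by (rule prod_mfd_sel(4)[OF c1(1) cm(1)])

lemma S\<phi>: "openin (top_of_set (UNIV \<times> model M)) S\<phi>"
  and smooth_\<phi>: "smooth_on (UNIV \<times> model M) S\<phi> \<phi>"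
  using smooth_map_chart_image(1,2)[OF smooth_\<Phi> charted_LGM c1m cm(1)]
  unfolding S\<phi>_def \<phi>_def model_LGM by simp_all

lemma in_S\<phi>:
  "p \<in> chart_dom c1 \<Longrightarrow> q \<in> chart_dom cm \<Longrightarrow> \<Phi> p q \<in> chart_dom cm
     \<Longrightarrow> (chart_map c1 p, chart_map cm q) \<in> S\<phi>"
  unfolding S\<phi>_def by (force simp: prod_chart_sel image_iff)

lemma x1m_S\<phi>: "(x1, xm) \<in> S\<phi>"
  unfolding x1_def xm_def using c1 cm \<Phi>_one[OF m] by (intro in_S\<phi>) auto

lemma chart_deriv_\<Phi>:
  assumes "p \<in> chart_dom c1" "q \<in> chart_dom cm" "\<Phi> p q \<in> chart_dom cm"
  shows "chart_deriv (prod_mfd LG M) (prod_chart c1 cm) M cm (\<lambda>(g, p). \<Phi> g p) (p, q)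
    (D\<phi> (chart_map c1 p, chart_map cm q))"
proof -
  have D: "D\<phi> (chart_map c1 p, chart_map cm q)
      = frechet_derivative \<phi> (at (chart_map c1 p, chart_map cm q) within UNIV \<times> model M)"
    unfolding D\<phi>_def using at_within_openin[OF S\<phi>(1) in_S\<phi>[OF assms]] by (simp add: fun_eq_iff)
  show ?thesis
    using smooth_map_chart_deriv[OF smooth_\<Phi> charted_LGM charted_M c1m cm(1), of "(p, q)"] assms
    unfolding D \<phi>_def by (simp add: prod_chart_sel model_LGM)
qed

definition "gen \<xi> = inf_generator M \<Phi> expG \<xi> m"

text \<open>The generator is defined by one curve for each \<xi>. Identifying it with the tangent
  map of the orbit map at the identity shows that it is linear in \<xi>.\<close>

lemma chart_deriv_orbit: "chart_deriv LG c1 M cm (\<lambda>g. \<Phi> g m) \<one> gen"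
proof -
  have "chart_deriv (prod_mfd LG M) (prod_chart c1 cm) M cm (\<lambda>(g, p). \<Phi> g p) (\<one>, m) (D\<phi> (x1, xm))"
    using chart_deriv_\<Phi>[OF c1(2) cm(2)] \<Phi>_one[OF m] cm(2) unfolding x1_def xm_def by simp
  from chart_deriv_comp[OF chart_deriv_Pair1[OF charted_LG charted_M c1(1) cm(1) c1(2) cm(2)] this]
  have 1: "chart_deriv LG c1 M cm (\<lambda>g. \<Phi> g m) \<one> (\<lambda>v. D\<phi> (x1, xm) (v, 0))" by simp
  have eq: "gen \<xi> = D\<phi> (x1, xm) (\<xi>, 0)" for \<xi>
  proof -
    have e0: "expG (0 *\<^sub>R \<xi>) = \<one>" by (simp add: exp_zero)
    have "chart_deriv real_mfd (UNIV, id) M cm (\<lambda>t. \<Phi> (expG (t *\<^sub>R \<xi>)) m) 0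
        (\<lambda>s. D\<phi> (x1, xm) (s *\<^sub>R \<xi>, 0))"
      by (rule chart_deriv_comp[OF chart_deriv_exp]) (unfold e0, rule 1)
    then have "chart_deriv real_mfd (chart_at real_mfd 0) M (chart_at M (\<Phi> (expG (0 *\<^sub>R \<xi>)) m))
        (\<lambda>t. \<Phi> (expG (t *\<^sub>R \<xi>)) m) 0 (\<lambda>s. D\<phi> (x1, xm) (s *\<^sub>R \<xi>, 0))"
      unfolding e0 \<Phi>_one[OF m] real_mfd_sel cm_def .
    from chart_deriv_tmap_eq[OF this, of 1] show ?thesis
      unfolding gen_def inf_generator_def by (simp add: real_mfd_sel)
  qed
  show ?thesis using 1 unfolding eq[symmetric] .
qed

lemma linear_gen: "linear gen"
  by (rule bounded_linear.linear[OF chart_deriv_linear[OF chart_deriv_orbit]])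

lemma gen_in_model: "gen \<xi> \<in> model M"
  by (rule chart_deriv_into[OF chart_deriv_orbit fin_dim_M]) (simp add: model_LG)

section \<open>The isotropy group and its linear representation at m\<close>

definition "H = stabilizer G \<Phi> m"

lemma H_iff: "k \<in> H \<longleftrightarrow> k \<in> carrier G \<and> \<Phi> k m = m"
  unfolding H_def stabilizer_def by blast

lemma H_carrier: "k \<in> H \<Longrightarrow> k \<in> carrier G"
  by (simp add: H_iff)

lemma H_one: "\<one> \<in> H"
  by (simp add: H_iff \<Phi>_one m)

lemma H_mult: "k \<in> H \<Longrightarrow> j \<in> H \<Longrightarrow> k \<otimes> j \<in> H"
  by (simp add: H_iff \<Phi>_mult m)

lemma H_inv:
  assumes "k \<in> H" shows "inv k \<in> H"
proof -
  have k: "k \<in> carrier G" "\<Phi> k m = m" using assms H_iff by auto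
  have "\<Phi> (inv k) (\<Phi> k m) = \<Phi> (inv k \<otimes> k) m" using k(1) m by (simp only: \<Phi>_mult inv_closed)
  then have "\<Phi> (inv k) m = m" using k \<Phi>_one[OF m] by simp
  then show ?thesis using k H_iff by simp
qed

definition "T k = tmap M M (\<Phi> k) m"

text \<open>Since \<open>k\<close> fixes \<open>m\<close>, the chart \<open>cm\<close> serves at
  both ends; differentiability comes from freezing the group element in the action.\<close>

lemma chart_deriv_T:
  assumes "k \<in> H" shows "chart_deriv M cm M cm (\<Phi> k) m (T k)"
proof -
  have k: "k \<in> carrier G" "\<Phi> k m = m" using assms H_iff by auto
  have "chart_deriv (prod_mfd LG M) (prod_chart (chart_at LG k) cm) M cm (\<lambda>(g, p). \<Phi> g p) (k, m)
      (tmap (prod_mfd LG M) M (\<lambda>(g, p). \<Phi> g p) (k, m))"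
    using smooth_map_chart_deriv_tmap[OF smooth_\<Phi> charted_LGM charted_M, of "(k, m)"] k m
    by (simp add: prod_mfd_sel carrier_LG cm_def)
  from chart_deriv_comp[OF chart_deriv_Pair2[OF charted_LG charted_M chart_at_LG(1)[OF k(1)] cm(1)
        chart_at_LG(2)[OF k(1)] cm(2)] this]
  have "chart_deriv M (chart_at M m) M (chart_at M (\<Phi> k m)) (\<Phi> k) m
      (\<lambda>v. tmap (prod_mfd LG M) M (\<lambda>(g, p). \<Phi> g p) (k, m) (0, v))"
    unfolding k(2) cm_def[symmetric] by simp
  from chart_deriv_tmap[OF this] show ?thesis unfolding k(2) cm_def[symmetric] T_def .
qed

lemma linear_T: "k \<in> H \<Longrightarrow> linear (T k)"
  by (rule bounded_linear.linear[OF chart_deriv_linear[OF chart_deriv_T]])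

lemma T_in_model: "k \<in> H \<Longrightarrow> v \<in> model M \<Longrightarrow> T k v \<in> model M"
  by (rule chart_deriv_into[OF chart_deriv_T fin_dim_M])

lemma T_mult:
  assumes "k \<in> H" "j \<in> H" "v \<in> model M"
  shows "T (k \<otimes> j) v = T k (T j v)"
proof -
  have j: "\<Phi> j m = m" using assms H_iff by auto
  have "chart_deriv M cm M cm (\<Phi> k) (\<Phi> j m) (T k)" unfolding j by (rule chart_deriv_T[OF assms(1)])
  note comp = chart_deriv_comp[OF chart_deriv_T[OF assms(2)] this]
  have "chart_deriv M cm M cm (\<Phi> (k \<otimes> j)) m (\<lambda>v. T k (T j v))"
    by (rule chart_deriv_cong[OF comp]) (simp add: \<Phi>_mult H_carrier assms)
  from chart_deriv_unique[OF chart_deriv_T[OF H_mult[OF assms(1,2)]] this assms(3)] show ?thesis .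
qed

lemma T_one:
  assumes "v \<in> model M" shows "T \<one> v = v"
proof -
  have "chart_deriv M cm M cm (\<lambda>x. x) m (T \<one>)"
    by (rule chart_deriv_cong[OF chart_deriv_T[OF H_one]]) (rule \<Phi>_one)
  from chart_deriv_unique[OF this chart_deriv_ident[OF charted_M cm] assms] show ?thesis .
qed

lemma T_inv: "k \<in> H \<Longrightarrow> v \<in> model M \<Longrightarrow> T k (T (inv k) v) = v"
  using T_mult[of k "inv k" v] T_one[of v] H_inv H_carrier by simp

text \<open>Both sides are tangent maps at the identity of the same map, because k g m = (k g k^-1)
  m when k fixes m.\<close>

lemma T_gen:
  assumes "k \<in> H" shows "T k (gen \<xi>) = gen (Ad G LG k \<xi>)"
proof -
  have k: "k \<in> carrier G" "\<Phi> k m = m" using assms H_iff by auto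
  have ik: "\<Phi> (inv k) m = m" using H_inv[OF assms] H_iff by auto
  have "chart_deriv M cm M cm (\<Phi> k) (\<Phi> \<one> m) (T k)"
    unfolding \<Phi>_one[OF m] by (rule chart_deriv_T[OF assms])
  note 1 = chart_deriv_comp[OF chart_deriv_orbit this]
  have "chart_deriv LG c1 M cm (\<lambda>g. \<Phi> g m) (k \<otimes> \<one> \<otimes> inv k) gen"
    using chart_deriv_orbit k by simp
  note 2 = chart_deriv_comp[OF chart_deriv_conj[OF k(1)] this]
  have "chart_deriv LG c1 M cm (\<lambda>g. \<Phi> k (\<Phi> g m)) \<one> (\<lambda>v. gen (Ad G LG k v))"
    by (rule chart_deriv_cong[OF 2]) (simp add: carrier_LG \<Phi>_mult \<Phi>_carrier k ik m)
  from chart_deriv_unique[OF 1 this] show ?thesis by (simp add: model_LG)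
qed

definition "\<hh> = subgroup_algebra expG H"

lemma exp_in_H: "\<zeta> \<in> \<hh> \<Longrightarrow> expG (t *\<^sub>R \<zeta>) \<in> H"
  unfolding \<hh>_def subgroup_algebra_def by blast

text \<open>The mixed second derivative of the action in the charts at the identity and at m. It is
  defined for every \<zeta> of the Lie algebra, so its linearity in \<zeta> does not presuppose that
  \<open>\<hh>\<close> is a subspace.\<close>

definition "L \<zeta> v = frechet_derivative (\<lambda>z. D\<phi> z (0, v)) (at (x1, xm) within S\<phi>) (\<zeta>, 0)"

lemma L_has_derivative:
  assumes "v \<in> model M"
  shows "((\<lambda>z. D\<phi> z (0, v)) has_derivative frechet_derivative (\<lambda>z. D\<phi> z (0, v)) (at (x1, xm) within S\<phi>))
    (at (x1, xm) within UNIV \<times> model M)"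
proof -
  have "(0, v) \<in> UNIV \<times> model M" using assms by simp
  from smooth_on_has_derivative[OF smooth_on_frechet_derivative[OF smooth_\<phi> this] x1m_S\<phi>]
  show ?thesis unfolding D\<phi>_def at_within_openin[OF S\<phi> x1m_S\<phi>] .
qed

lemma linear_L:
  assumes "v \<in> model M" shows "linear (\<lambda>\<zeta>. L \<zeta> v)"
proof -
  have l: "linear (\<lambda>\<zeta>. (\<zeta>, 0 :: 'e))" by (auto intro!: linearI)
  show ?thesis
    unfolding L_def
    using linear_compose[OF l bounded_linear.linear[OF has_derivative_bounded_linear[OF L_has_derivative[OF assms]]]]
    by (simp add: comp_def)
qed

text \<open>For \<open>g\<close> near the identity, \<open>T\<^sub>m \<Phi>\<^sub>g\<close> is read in the fixed chart at \<open>m\<close>, where it depends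
  smoothly on \<open>g\<close>; hence its derivative along \<open>exp (t \<zeta>)\<close> is linear in \<open>\<zeta>\<close>.\<close>
lemma T_exp_derivative:
  assumes \<zeta>: "\<zeta> \<in> \<hh>" and v: "v \<in> model M"
  shows "((\<lambda>t. T (expG (t *\<^sub>R \<zeta>)) v) has_vector_derivative L \<zeta> v) (at 0)"
proof -
  define \<gamma> where "\<gamma> t = chart_map c1 (expG (t *\<^sub>R \<zeta>))" for t
  have \<gamma>: "(\<gamma> has_vector_derivative \<zeta>) (at 0)" unfolding \<gamma>_def by (rule exp_curve)
  have \<gamma>0: "\<gamma> 0 = x1" unfolding \<gamma>_def x1_def by (simp add: exp_zero)
  have xm: "xm \<in> model M" unfolding xm_def by (rule charted_chart_map_in_model[OF charted_M cm])
  have "((\<lambda>t. (\<gamma> t, xm)) has_vector_derivative (\<zeta>, 0)) (at 0)"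
    by (intro has_vector_derivative_Pair \<gamma> has_vector_derivative_const)
  then have der: "((\<lambda>t. D\<phi> (\<gamma> t, xm) (0, v)) has_vector_derivative L \<zeta> v) (at 0)"
    using has_derivative_curve[of "\<lambda>z. D\<phi> z (0, v)" _ "\<lambda>t. (\<gamma> t, xm)" 0 "UNIV \<times> model M" "(\<zeta>, 0)"]
      L_has_derivative[OF v] xm unfolding L_def \<gamma>0 by simp
  have eq: "T (expG (t *\<^sub>R \<zeta>)) v = D\<phi> (\<gamma> t, xm) (0, v)" if t: "expG (t *\<^sub>R \<zeta>) \<in> chart_dom c1" for t
  proof -
    let ?k = "expG (t *\<^sub>R \<zeta>)"
    have k: "?k \<in> H" by (rule exp_in_H[OF \<zeta>])
    then have "\<Phi> ?k m \<in> chart_dom cm" using cm H_iff by auto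
    from chart_deriv_comp[OF chart_deriv_Pair2[OF charted_LG charted_M c1(1) cm(1) t cm(2)]
        chart_deriv_\<Phi>[OF t cm(2) this]]
    have "chart_deriv M cm M cm (\<Phi> ?k) m (\<lambda>v. D\<phi> (\<gamma> t, xm) (0, v))" unfolding \<gamma>_def xm_def by simp
    from chart_deriv_unique[OF chart_deriv_T[OF k] this v] show ?thesis .
  qed
  have "\<forall>\<^sub>F t in nhds 0. T (expG (t *\<^sub>R \<zeta>)) v = D\<phi> (\<gamma> t, xm) (0, v)"
    using exp_eventually_c1 by (rule eventually_mono) (rule eq)
  with der show ?thesis by (rule has_vector_derivative_eventually_eq)
qed

end

section \<open>The symplectic normal space\<close>

locale normal_space = lie_action G LG expG M \<Phi> m
  for G (structure) and LG :: "('a, 'g::real_normed_vector) manifold" and expG :: "'g \<Rightarrow> 'a"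
    and M :: "('p, 'e::real_normed_vector) manifold" and \<Phi> :: "'a \<Rightarrow> 'p \<Rightarrow> 'p" and m :: 'p +
  fixes \<omega> :: "('p, 'e) form2" and cls :: "'e \<Rightarrow> 'v::real_normed_vector"
  assumes \<omega>: "symplectic_form M \<omega>" and canonical: "canonical_action G M \<omega> \<Phi>"
    and cls: "quotient_space (orth_compl (model M) (\<omega> m) (range gen))
      (orth_compl (model M) (\<omega> m) (range gen) \<inter> range gen) cls"
begin

definition "N = orth_compl (model M) (\<omega> m) (range gen)"

lemma \<omega>_lin: "u \<in> model M \<Longrightarrow> v \<in> model M \<Longrightarrow> w \<in> model M
    \<Longrightarrow> \<omega> m (a *\<^sub>R u + b *\<^sub>R v) w = a * \<omega> m u w + b * \<omega> m v w"
  and \<omega>_skew: "v \<in> model M \<Longrightarrow> w \<in> model M \<Longrightarrow> \<omega> m v w = - \<omega> m w v"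
  and \<omega>_nondeg: "nondeg_on (model M) (\<omega> m)"
proof -
  have *: "two_form M \<omega>" "\<forall>p\<in>carrier M. \<forall>v\<in>model M. (\<forall>w\<in>model M. \<omega> p v w = 0) \<longrightarrow> v = 0"
    using \<omega> unfolding symplectic_form_def by simp_all
  have two: "\<omega> m (a *\<^sub>R u + b *\<^sub>R v) w = a * \<omega> m u w + b * \<omega> m v w \<and> \<omega> m v w = - \<omega> m w v"
    if "u \<in> model M" "v \<in> model M" "w \<in> model M" for u v w a b
    using *(1)[unfolded two_form_def, THEN conjunct1] m that by blast
  show "u \<in> model M \<Longrightarrow> v \<in> model M \<Longrightarrow> w \<in> model M
    \<Longrightarrow> \<omega> m (a *\<^sub>R u + b *\<^sub>R v) w = a * \<omega> m u w + b * \<omega> m v w"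
    using two by blast
  show "v \<in> model M \<Longrightarrow> w \<in> model M \<Longrightarrow> \<omega> m v w = - \<omega> m w v"
    using two[of v v w] by blast
  show "nondeg_on (model M) (\<omega> m)"
    unfolding nondeg_on_def by (rule bspec[OF *(2) m])
qed

lemma \<omega>_lin1: "w \<in> model M \<Longrightarrow> lin_on (model M) (\<lambda>v. \<omega> m v w)"
  unfolding lin_on_def using \<omega>_lin[of _ _ w 1 1] \<omega>_lin[of _ _ w _ 0] by auto

lemma \<omega>_lin2:
  assumes "v \<in> model M" shows "lin_on (model M) (\<omega> m v)"
  using \<omega>_lin1[OF assms]
  unfolding lin_on_def
  by (simp add: \<omega>_skew[OF assms] subspace_add[OF subspace_M] subspace_scale[OF subspace_M])

lemma \<omega>_bilin: "bilin_on (model M) (\<omega> m)"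
  unfolding bilin_on_def using \<omega>_lin1 \<omega>_lin2 by blast

lemma N_iff: "v \<in> N \<longleftrightarrow> v \<in> model M \<and> (\<forall>\<xi>. \<omega> m v (gen \<xi>) = 0)"
  unfolding N_def orth_compl_def by blast

lemma N_model: "v \<in> N \<Longrightarrow> v \<in> model M"
  by (simp add: N_iff)

lemma subspace_N: "subspace N"
  unfolding subspace_def
  using lin_on_zero[OF \<omega>_lin1[OF gen_in_model] subspace_0[OF subspace_M]]
    lin_on_add[OF \<omega>_lin1[OF gen_in_model]] lin_on_scale[OF \<omega>_lin1[OF gen_in_model]]
  by (auto simp: N_iff subspace_0[OF subspace_M] subspace_add[OF subspace_M] subspace_scale[OF subspace_M])

lemma fin_dim_N: "fin_dim N"
  by (rule fin_dim_subset[OF fin_dim_M subspace_N]) (auto simp: N_iff)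

lemma cls_lin: "lin_on N cls"
  and cls_surj: "cls ` N = UNIV"
  and cls_zero: "x \<in> N \<Longrightarrow> cls x = 0 \<longleftrightarrow> x \<in> range gen"
  using cls unfolding N_def[symmetric] quotient_space_def lin_on_def by blast+

text \<open>A mere choice of representatives, which need not be linear or equivariant; hence the
  lemmas that compare \<open>rep (cls a)\<close> with \<open>a\<close>.\<close>

definition "rep = inv_into N cls"

lemma rep_N: "rep x \<in> N" and cls_rep: "cls (rep x) = x"
  unfolding rep_def using inv_into_into[of x cls N] f_inv_into_f[of x cls N] cls_surj by auto

lemma rep_model: "rep x \<in> model M"
  using rep_N N_model by blast

lemma fin_dim_V: "fin_dim (UNIV :: 'v set)"
  using fin_dim_image[OF fin_dim_N cls_lin] cls_surj by simp

lemma cls_eq_iff: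
  assumes "a \<in> N" "b \<in> N" shows "cls a = cls b \<longleftrightarrow> a - b \<in> range gen"
  using lin_on_diff[OF cls_lin subspace_N assms] cls_zero[OF subspace_diff[OF subspace_N assms]] by simp

lemma rep_cls: "a \<in> N \<Longrightarrow> rep (cls a) - a \<in> range gen"
  using cls_eq_iff[OF rep_N, of a "cls a"] cls_rep by simp

section \<open>The reduced symplectic form on the normal space\<close>

definition "\<omega>V x y = \<omega> m (rep x) (rep y)"

text \<open>Changing a representative adds an orbit direction, to which every vector of
  \<open>N\<close> is orthogonal.\<close>

lemma \<omega>V_cls:
  assumes a: "a \<in> N" and b: "b \<in> N"
  shows "\<omega>V (cls a) (cls b) = \<omega> m a b"
proof -
  let ?a = "rep (cls a)" and ?b = "rep (cls b)"
  have 1: "\<omega> m a' (?b - b) = 0" if "a' \<in> N" for a'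
    using rep_cls[OF b] that N_iff by auto
  have 2: "\<omega> m (?a - a) b = 0"
    using rep_cls[OF a] b N_iff \<omega>_skew[OF gen_in_model N_model[OF b]] by auto
  have "\<omega> m ?a ?b = \<omega> m ?a b"
    using 1[OF rep_N, of "cls a"] lin_on_diff[OF \<omega>_lin2[OF rep_model] subspace_M rep_model N_model[OF b], of "cls a" "cls b"]
    by simp
  also have "\<dots> = \<omega> m a b"
    using 2 lin_on_diff[OF \<omega>_lin1[OF N_model[OF b]] subspace_M rep_model N_model[OF a], of "cls a"] by simp
  finally show ?thesis unfolding \<omega>V_def .
qed

lemma \<omega>V_skew: "\<omega>V x y = - \<omega>V y x"
  unfolding \<omega>V_def by (rule \<omega>_skew[OF rep_model rep_model])

lemma \<omega>V_linear2: "linear (\<omega>V x)"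
proof (rule linearI)
  fix y z r
  show "\<omega>V x (y + z) = \<omega>V x y + \<omega>V x z"
    using \<omega>V_cls[OF rep_N subspace_add[OF subspace_N rep_N rep_N], of x y z]
    by (simp add: lin_on_add[OF cls_lin rep_N rep_N] cls_rep lin_on_add[OF \<omega>_lin2[OF rep_model] rep_model rep_model])
       (simp add: \<omega>V_def)
  show "\<omega>V x (r *\<^sub>R y) = r *\<^sub>R \<omega>V x y"
    using \<omega>V_cls[OF rep_N subspace_scale[OF subspace_N rep_N], of x r y]
    by (simp add: lin_on_scale[OF cls_lin rep_N] cls_rep lin_on_scale[OF \<omega>_lin2[OF rep_model] rep_model])
       (simp add: \<omega>V_def)
qed

lemma \<omega>V_linear1: "linear (\<lambda>x. \<omega>V x y)"
  unfolding \<omega>V_skew[of _ y] by (rule linear_compose_neg[OF \<omega>V_linear2])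

lemma bounded_bilinear_\<omega>V: "bounded_bilinear \<omega>V"
  by (rule fin_dim_bilinear_bounded[OF fin_dim_V fin_dim_V \<omega>V_linear1 \<omega>V_linear2])

lemma subspace_orbit: "subspace (range gen)"
  using linear_gen subspace_UNIV by (rule linear_subspace_image)

text \<open>A representative of a null vector is orthogonal to \<open>N\<close>, the complement of
  the orbit directions. By the double complement it is itself an orbit direction, so its class is
  zero.\<close>

lemma \<omega>V_nondeg:
  assumes "\<And>y. \<omega>V x y = 0" shows "x = 0"
proof -
  have "rep x \<in> range gen"
  proof (rule orth_compl_orth_compl_subset[OF fin_dim_M \<omega>_bilin \<omega>_nondeg subspace_orbit rep_model])
    show "\<omega> m n (rep x) = 0" if "n \<in> orth_compl (model M) (\<omega> m) (range gen)" for n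
    proof -
      have n: "n \<in> N" using that unfolding N_def .
      have "\<omega> m (rep x) n = 0" using \<omega>V_cls[OF rep_N n, of x] assms[of "cls n"] cls_rep by simp
      then show ?thesis using \<omega>_skew[OF N_model[OF n] rep_model] by simp
    qed
  qed (auto simp: gen_in_model)
  then show ?thesis using cls_zero[OF rep_N] cls_rep by metis
qed

text \<open>This justifies the definite description behind the sharp map of the normal
  space.\<close>

lemma \<omega>V_representer:
  assumes "linear f" shows "\<exists>!x. \<forall>w. \<omega>V x w = f w"
proof -
  have "bilin_on UNIV \<omega>V" "nondeg_on UNIV \<omega>V"
    unfolding bilin_on_def nondeg_on_def lin_on_UNIV_linear
    using \<omega>V_linear1 \<omega>V_linear2 \<omega>V_nondeg by auto
  then obtain x where x: "\<And>w. \<omega>V x w = f w"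
    using nondeg_representer[OF fin_dim_V _ _ linear_lin_on[OF assms]] by (metis UNIV_I)
  moreover have "y = x" if "\<forall>w. \<omega>V y w = f w" for y
  proof -
    have "\<omega>V (y - x) w = 0" for w using that x by (simp add: linear_diff[OF \<omega>V_linear1])
    then show ?thesis using \<omega>V_nondeg[of "y - x"] by simp
  qed
  ultimately show ?thesis by blast
qed

lemma T_\<omega>:
  assumes "k \<in> H" "v \<in> model M" "w \<in> model M"
  shows "\<omega> m (T k v) (T k w) = \<omega> m v w"
proof -
  have "pullback M M (\<Phi> k) \<omega> m v w = \<omega> m v w"
    using canonical assms m H_carrier unfolding canonical_action_def by blast
  then show ?thesis using assms(1) unfolding pullback_def T_def H_iff by simp
qed

text \<open>The isotropy representation preserves the form and maps the orbit directions onto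
  themselves, hence preserves their complement.\<close>

lemma T_N:
  assumes k: "k \<in> H" and v: "v \<in> N" shows "T k v \<in> N"
  unfolding N_iff
proof (intro conjI allI)
  show "T k v \<in> model M" by (rule T_in_model[OF k N_model[OF v]])
  fix \<xi>
  have "gen \<xi> = T k (gen (Ad G LG (inv k) \<xi>))"
    using T_inv[OF k gen_in_model[of \<xi>]] by (simp add: T_gen[OF H_inv[OF k]])
  then have "\<omega> m (T k v) (gen \<xi>) = \<omega> m v (gen (Ad G LG (inv k) \<xi>))"
    using T_\<omega>[OF k N_model[OF v] gen_in_model] by simp
  then show "\<omega> m (T k v) (gen \<xi>) = 0" using v N_iff by simp
qed

section \<open>The linear isotropy action on the normal space\<close>

definition "actV k x = cls (T k (rep x))"

text \<open>\<open>T k\<close> sends orbit directions to orbit directions, so the class of the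
  result is independent of the representative.\<close>

lemma actV_cls:
  assumes k: "k \<in> H" and a: "a \<in> N" shows "actV k (cls a) = cls (T k a)"
proof -
  obtain \<xi> where "rep (cls a) - a = gen \<xi>" using rep_cls[OF a] by blast
  then have "T k (rep (cls a)) - T k a = gen (Ad G LG k \<xi>)"
    using linear_diff[OF linear_T[OF k]] T_gen[OF k] by metis
  then show ?thesis unfolding actV_def using cls_eq_iff[OF T_N[OF k rep_N] T_N[OF k a]] by auto
qed

lemma linear_actV:
  assumes k: "k \<in> H" shows "linear (actV k)"
proof (rule linearI)
  fix x y r
  have "actV k (cls (rep x + rep y)) = cls (T k (rep x + rep y))"
    by (rule actV_cls[OF k subspace_add[OF subspace_N rep_N rep_N]])
  then show "actV k (x + y) = actV k x + actV k y"
    by (simp add: lin_on_add[OF cls_lin rep_N rep_N] cls_rep linear_add[OF linear_T[OF k]]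
        lin_on_add[OF cls_lin T_N[OF k rep_N] T_N[OF k rep_N]] actV_def[symmetric])
  have "actV k (cls (r *\<^sub>R rep x)) = cls (T k (r *\<^sub>R rep x))"
    by (rule actV_cls[OF k subspace_scale[OF subspace_N rep_N]])
  then show "actV k (r *\<^sub>R x) = r *\<^sub>R actV k x"
    by (simp add: lin_on_scale[OF cls_lin rep_N] cls_rep linear_scale[OF linear_T[OF k]]
        lin_on_scale[OF cls_lin T_N[OF k rep_N]] actV_def[symmetric])
qed

lemma actV_mult: "k \<in> H \<Longrightarrow> j \<in> H \<Longrightarrow> actV (k \<otimes> j) x = actV k (actV j x)"
  using actV_cls[OF _ T_N[OF _ rep_N], of k j x] T_mult[OF _ _ rep_model, of k j x]
  by (simp add: actV_def)

lemma actV_one: "actV \<one> x = x"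
  unfolding actV_def by (simp add: T_one rep_model cls_rep)

lemma \<omega>V_actV: "k \<in> H \<Longrightarrow> \<omega>V (actV k x) (actV k y) = \<omega>V x y"
  unfolding actV_def
  by (subst \<omega>V_cls) (simp_all add: T_N rep_N T_\<omega> rep_model \<omega>V_def)

definition "genV \<zeta> x = vector_derivative (\<lambda>t. actV (expG (t *\<^sub>R \<zeta>)) x) (at 0)"

text \<open>The curve \<open>T (exp (t \<zeta>)) v\<close> stays in \<open>N\<close>, which is
  closed, and \<open>cls\<close> is bounded on \<open>N\<close>; so the derivative stays in
  \<open>N\<close> and commutes with \<open>cls\<close>.\<close>

lemma L_N: "\<zeta> \<in> \<hh> \<Longrightarrow> v \<in> N \<Longrightarrow> L \<zeta> v \<in> N"
  and actV_exp_L: "\<zeta> \<in> \<hh> \<Longrightarrow> v \<in> N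
    \<Longrightarrow> ((\<lambda>t. cls (T (expG (t *\<^sub>R \<zeta>)) v)) has_vector_derivative cls (L \<zeta> v)) (at 0)"
proof -
  assume \<zeta>: "\<zeta> \<in> \<hh>" and v: "v \<in> N"
  have ev: "\<forall>\<^sub>F t in nhds 0. T (expG (t *\<^sub>R \<zeta>)) v \<in> N"
    using T_N[OF exp_in_H[OF \<zeta>] v] by (intro always_eventually) blast
  note * = has_vector_derivative_lin_on[OF fin_dim_N cls_lin T_exp_derivative[OF \<zeta> N_model[OF v]] ev]
  show "L \<zeta> v \<in> N" by (rule *(1))
  show "((\<lambda>t. cls (T (expG (t *\<^sub>R \<zeta>)) v)) has_vector_derivative cls (L \<zeta> v)) (at 0)" by (rule *(2))
qed

lemma genV_L: "\<zeta> \<in> \<hh> \<Longrightarrow> genV \<zeta> x = cls (L \<zeta> (rep x))"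
  unfolding genV_def actV_def by (rule vector_derivative_at[OF actV_exp_L[OF _ rep_N]])

lemma actV_exp_derivative:
  "\<zeta> \<in> \<hh> \<Longrightarrow> ((\<lambda>t. actV (expG (t *\<^sub>R \<zeta>)) x) has_vector_derivative genV \<zeta> x) (at 0)"
  using actV_exp_L[OF _ rep_N] unfolding genV_L actV_def .

text \<open>Linearity in \<zeta> is not visible from the defining curves and is inherited from
  \<open>L\<close>. That \<open>\<hh>\<close> is a subspace is supplied later by the
  splitting.\<close>

lemma genV_lin_on:
  assumes \<hh>: "subspace \<hh>" shows "lin_on \<hh> (\<lambda>\<zeta>. genV \<zeta> x)"
  unfolding lin_on_def
proof (intro conjI ballI allI)
  fix \<zeta> \<eta> assume z: "\<zeta> \<in> \<hh>" "\<eta> \<in> \<hh>"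
  show "genV (\<zeta> + \<eta>) x = genV \<zeta> x + genV \<eta> x"
    by (simp add: genV_L z subspace_add[OF \<hh>] linear_add[OF linear_L[OF rep_model]]
        lin_on_add[OF cls_lin L_N[OF z(1) rep_N] L_N[OF z(2) rep_N]])
next
  fix \<zeta> r assume z: "\<zeta> \<in> \<hh>"
  show "genV (r *\<^sub>R \<zeta>) x = r *\<^sub>R genV \<zeta> x"
    by (simp add: genV_L z subspace_scale[OF \<hh>] linear_scale[OF linear_L[OF rep_model]]
        lin_on_scale[OF cls_lin L_N[OF z rep_N]])
qed

lemma linear_genV:
  assumes \<zeta>: "\<zeta> \<in> \<hh>" shows "linear (genV \<zeta>)"
proof (rule linearI)
  fix x y r
  have l: "linear (actV (expG (t *\<^sub>R \<zeta>)))" for t by (rule linear_actV[OF exp_in_H[OF \<zeta>]])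
  show "genV \<zeta> (x + y) = genV \<zeta> x + genV \<zeta> y"
    using has_vector_derivative_add[OF actV_exp_derivative[OF \<zeta>] actV_exp_derivative[OF \<zeta>], of x y]
      actV_exp_derivative[OF \<zeta>, of "x + y"]
    unfolding linear_add[OF l] by (rule vector_derivative_unique_at[rotated])
  show "genV \<zeta> (r *\<^sub>R x) = r *\<^sub>R genV \<zeta> x"
    using has_vector_derivative_scaleR[OF DERIV_const actV_exp_derivative[OF \<zeta>, of x], of r]
      actV_exp_derivative[OF \<zeta>, of "r *\<^sub>R x"]
    unfolding linear_scale[OF l] by (auto dest: vector_derivative_unique_at)
qed

text \<open>The infinitesimal form of \<open>\<omega>V_actV\<close>: the derivative of a constant
  function of \<open>t\<close>.\<close>

lemma \<omega>V_genV:
  assumes \<zeta>: "\<zeta> \<in> \<hh>" shows "\<omega>V (genV \<zeta> x) y = - \<omega>V x (genV \<zeta> y)"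
proof -
  have "((\<lambda>t. \<omega>V (actV (expG (t *\<^sub>R \<zeta>)) x) (actV (expG (t *\<^sub>R \<zeta>)) y)) has_vector_derivative
      \<omega>V (actV (expG (0 *\<^sub>R \<zeta>)) x) (genV \<zeta> y) + \<omega>V (genV \<zeta> x) (actV (expG (0 *\<^sub>R \<zeta>)) y)) (at 0)"
    by (rule bounded_bilinear.has_vector_derivative[OF bounded_bilinear_\<omega>V])
       (rule actV_exp_derivative[OF \<zeta>])+
  then have "((\<lambda>t. \<omega>V x y) has_vector_derivative \<omega>V x (genV \<zeta> y) + \<omega>V (genV \<zeta> x) y) (at 0)"
    unfolding \<omega>V_actV[OF exp_in_H[OF \<zeta>]] by (simp add: exp_zero actV_one)
  from vector_derivative_unique_at[OF this has_vector_derivative_const] show ?thesis by simp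
qed

end

section \<open>Splittings\<close>

lemma direct_sum_of_commute:
  assumes "direct_sum_of A B C" shows "direct_sum_of B A C"
proof -
  have "{b + a |b a. b \<in> B \<and> a \<in> A} = {a + b |a b. a \<in> A \<and> b \<in> B}"
    by (rule Collect_cong) (metis add.commute)
  then show ?thesis using assms unfolding direct_sum_of_def by (simp add: Int_commute)
qed

lemma direct_sum_ofD:
  assumes "direct_sum_of A B C"
  shows "subspace A" "subspace B" "A \<inter> B = {0}" "{a + b |a b. a \<in> A \<and> b \<in> B} = C"
    and "a \<in> A \<Longrightarrow> b \<in> B \<Longrightarrow> a + b \<in> C" and "x \<in> C \<Longrightarrow> \<exists>a\<in>A. \<exists>b\<in>B. x = a + b"
proof -
  show *: "subspace A" "subspace B" "A \<inter> B = {0}" "{a + b |a b. a \<in> A \<and> b \<in> B} = C"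
    using assms unfolding direct_sum_of_def by simp_all
  show "a \<in> A \<Longrightarrow> b \<in> B \<Longrightarrow> a + b \<in> C" and "x \<in> C \<Longrightarrow> \<exists>a\<in>A. \<exists>b\<in>B. x = a + b"
    unfolding *(4)[symmetric] by blast+
qed

lemma direct_sum_of_subspace:
  assumes "direct_sum_of A B C" shows "subspace C"
  unfolding direct_sum_ofD(4)[OF assms, symmetric]
  by (rule subspace_sums[OF direct_sum_ofD(1,2)[OF assms]])

lemma direct_sum_of_subset1:
  assumes "direct_sum_of A B C" shows "A \<subseteq> C"
  using direct_sum_ofD(5)[OF assms _ subspace_0[OF direct_sum_ofD(2)[OF assms]]] by auto

lemmas direct_sum_of_subset = direct_sum_of_subset1 direct_sum_of_subset1[OF direct_sum_of_commute]

text \<open>Regroups (A + B) + D as A + (B + D). With \<kk> in the role of C it produces the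
  complements of \<hh> and of \<mm> in the whole algebra.\<close>

lemma direct_sum_of_assoc:
  assumes AB: "direct_sum_of A B C" and CD: "direct_sum_of C D U" and BD: "direct_sum_of B D E"
  shows "direct_sum_of A E U"
  unfolding direct_sum_of_def
proof (intro conjI equalityI subsetI)
  have sC: "subspace C" using AB by (rule direct_sum_of_subspace)
  show A: "subspace A" by (rule direct_sum_ofD(1)[OF AB])
  show E: "subspace E" by (rule direct_sum_of_subspace[OF BD])
  show "x \<in> {0}" if "x \<in> A \<inter> E" for x
  proof -
    have x: "x \<in> A" "x \<in> E" using that by auto
    obtain b e where be: "x = b + e" "b \<in> B" "e \<in> D" using direct_sum_ofD(6)[OF BD x(2)] by blast
    have "x - b \<in> C"
      using subspace_diff[OF sC, of x b] x(1) be(2) direct_sum_of_subset[OF AB] by blast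
    then have "x - b \<in> C \<inter> D" using be by simp
    then have "x = b" unfolding direct_sum_ofD(3)[OF CD] by simp
    then have "x \<in> A \<inter> B" using x(1) be(2) by blast
    then show ?thesis unfolding direct_sum_ofD(3)[OF AB] .
  qed
  show "x \<in> A \<inter> E" if "x \<in> {0}" for x using that subspace_0[OF A] subspace_0[OF E] by simp
  show "x \<in> U" if "x \<in> {a + e |a e. a \<in> A \<and> e \<in> E}" for x
  proof -
    obtain a e where ae: "x = a + e" "a \<in> A" "e \<in> E" using \<open>x \<in> {a + e |a e. a \<in> A \<and> e \<in> E}\<close> by blast
    obtain b c where bc: "e = b + c" "b \<in> B" "c \<in> D" using direct_sum_ofD(6)[OF BD ae(3)] by blast
    have "(a + b) + c \<in> U" by (rule direct_sum_ofD(5)[OF CD direct_sum_ofD(5)[OF AB ae(2) bc(2)] bc(3)])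
    then show "x \<in> U" unfolding ae bc by (simp add: add.assoc)
  qed
  show "x \<in> {a + e |a e. a \<in> A \<and> e \<in> E}" if "x \<in> U" for x
  proof -
    obtain k c where kc: "x = k + c" "k \<in> C" "c \<in> D" using direct_sum_ofD(6)[OF CD \<open>x \<in> U\<close>] by blast
    obtain a b where ab: "k = a + b" "a \<in> A" "b \<in> B" using direct_sum_ofD(6)[OF AB kc(2)] by blast
    have "x = a + (b + c)" unfolding kc ab by (rule add.assoc)
    then show ?thesis using ab(2) direct_sum_ofD(5)[OF BD ab(3) kc(3)] by blast
  qed
qed

lemma proj_along_eqI:
  assumes "direct_sum_of A B U" "a \<in> A" "x - a \<in> B"
  shows "proj_along A B x = a"
  unfolding proj_along_def
proof (rule the_equality)
  fix b assume b: "b \<in> A \<and> x - b \<in> B"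
  have "b - a \<in> A" by (rule subspace_diff[OF direct_sum_ofD(1)[OF assms(1)]]) (use assms(2) b in simp_all)
  moreover have "(x - a) - (x - b) \<in> B"
    by (rule subspace_diff[OF direct_sum_ofD(2)[OF assms(1)]]) (use assms(3) b in simp_all)
  ultimately have "b - a \<in> A \<inter> B" by simp
  then show "b = a" unfolding direct_sum_ofD(3)[OF assms(1)] by simp
qed (use assms in simp)

lemma proj_along_direct_sum:
  assumes "direct_sum_of A B UNIV"
  shows "proj_along A B x \<in> A" "x - proj_along A B x \<in> B"
proof -
  obtain a b where x: "x = a + b" "a \<in> A" "b \<in> B"
    using direct_sum_ofD(6)[OF assms UNIV_I[of x]] by blast
  then have "proj_along A B x = a" using proj_along_eqI[OF assms] by auto
  then show "proj_along A B x \<in> A" "x - proj_along A B x \<in> B" using x by auto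
qed

lemma linear_proj_along:
  assumes "direct_sum_of A B UNIV" shows "linear (proj_along A B)"
proof -
  note s = direct_sum_ofD(1,2)[OF assms]
  note p = proj_along_direct_sum[OF assms]
  show ?thesis
  proof (rule linearI; rule proj_along_eqI[OF assms])
    fix x y r
    show "proj_along A B x + proj_along A B y \<in> A" by (intro subspace_add s p)
    have "(x - proj_along A B x) + (y - proj_along A B y) \<in> B" by (intro subspace_add s p)
    then show "x + y - (proj_along A B x + proj_along A B y) \<in> B" by (simp add: algebra_simps)
    show "r *\<^sub>R proj_along A B x \<in> A" by (intro subspace_scale s p)
    have "r *\<^sub>R (x - proj_along A B x) \<in> B" by (intro subspace_scale s p)
    then show "r *\<^sub>R x - r *\<^sub>R proj_along A B x \<in> B" by (simp add: algebra_simps)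
  qed
qed

locale splitting = normal_space G LG expG M \<Phi> m \<omega> cls
  for G (structure) and LG :: "('a, 'g::real_normed_vector) manifold" and expG :: "'g \<Rightarrow> 'a"
    and M :: "('p, 'e::real_normed_vector) manifold" and \<Phi> :: "'a \<Rightarrow> 'p \<Rightarrow> 'p" and m :: 'p
    and \<omega> :: "('p, 'e) form2" and cls :: "'e \<Rightarrow> 'v::real_normed_vector" +
  fixes \<kk> \<mm> \<qq> \<hh>\<qq> \<mm>\<qq> :: "'g set"
  assumes \<kk>: "\<kk> = {\<eta>. gen \<eta> \<in> N}"
    and hmk: "direct_sum_of \<hh> \<mm> \<kk>" and Ad_\<mm>: "\<forall>k\<in>H. Ad G LG k ` \<mm> \<subseteq> \<mm>"
    and kq: "direct_sum_of \<kk> \<qq> UNIV" and Ad_\<qq>: "\<forall>k\<in>H. Ad G LG k ` \<qq> \<subseteq> \<qq>"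
    and hq: "direct_sum_of \<hh> \<qq> \<hh>\<qq>" and mq: "direct_sum_of \<mm> \<qq> \<mm>\<qq>"
begin

text \<open>The sums \<mm> + \<qq> and \<hh> + \<qq> are the spaces on which the duals of \<hh> and
  \<mm>, embedded by zero extension, have to vanish.\<close>

lemma h_mq: "direct_sum_of \<hh> \<mm>\<qq> UNIV"
  by (rule direct_sum_of_assoc[OF hmk kq mq])

lemma m_hq: "direct_sum_of \<mm> \<hh>\<qq> UNIV"
  by (rule direct_sum_of_assoc[OF direct_sum_of_commute[OF hmk] kq hq])

lemma subspaces: "subspace \<hh>" "subspace \<mm>" "subspace \<qq>" "subspace \<kk>"
  using direct_sum_ofD(1,2)[OF hmk] direct_sum_ofD(2)[OF mq] direct_sum_ofD(1)[OF kq] by simp_all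

section \<open>Functionals, coadjoint actions and dual projections\<close>

lemma linear_bounded: "linear (f :: 'g \<Rightarrow> 'b::real_normed_vector) \<Longrightarrow> bounded_linear f"
  by (rule fin_dim_linear_bounded[OF fin_dim_algebra])

lemma Blinfun_linear: "linear f \<Longrightarrow> blinfun_apply (Blinfun f) (\<eta> :: 'g) = f \<eta>"
  by (simp add: bounded_linear_Blinfun_apply linear_bounded)

lemma linear_blinfun_comp: "linear f \<Longrightarrow> linear (\<lambda>\<eta>. blinfun_apply \<nu> (f \<eta>))"
  using linear_compose[of f "blinfun_apply \<nu>"] bounded_linear.linear[OF blinfun.bounded_linear_right]
  by (auto simp: comp_def)

lemma coad_apply: "blinfun_apply (coad G LG \<xi> \<nu>) \<eta> = blinfun_apply \<nu> (lie_bracket G LG \<xi> \<eta>)"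
  unfolding coad_def by (rule Blinfun_linear[OF linear_blinfun_comp[OF linear_lie_bracket(1)]])

lemma coAd_apply:
  "k \<in> carrier G \<Longrightarrow> blinfun_apply (coAd G LG k \<nu>) \<eta> = blinfun_apply \<nu> (Ad G LG k \<eta>)"
  unfolding coAd_def by (rule Blinfun_linear[OF linear_blinfun_comp[OF linear_Ad]])

lemma dual_proj_apply:
  "direct_sum_of A B UNIV \<Longrightarrow> blinfun_apply (dual_proj A B \<nu>) \<eta> = blinfun_apply \<nu> (proj_along A B \<eta>)"
  for A B :: "'g set"
  unfolding dual_proj_def by (rule Blinfun_linear[OF linear_blinfun_comp[OF linear_proj_along]])

lemma dual_proj_in_dual_summand:
  fixes A B :: "'g set"
  assumes "direct_sum_of A B UNIV" shows "dual_proj A B \<nu> \<in> dual_summand B"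
  unfolding dual_summand_def
proof (intro CollectI ballI)
  fix \<xi> assume "\<xi> \<in> B"
  moreover have "0 \<in> A" by (rule subspace_0[OF direct_sum_ofD(1)[OF assms]])
  ultimately have "proj_along A B \<xi> = 0" by (intro proj_along_eqI[OF assms]) simp_all
  then show "blinfun_apply (dual_proj A B \<nu>) \<xi> = 0" by (simp add: dual_proj_apply[OF assms] blinfun.zero_right)
qed

lemma coAd_mult:
  "k \<in> carrier G \<Longrightarrow> j \<in> carrier G \<Longrightarrow> coAd G LG (inv (j \<otimes> k)) \<nu> = coAd G LG (inv j) (coAd G LG (inv k) \<nu>)"
  by (rule blinfun_eqI) (simp add: coAd_apply inv_mult_group Ad_mult)

text \<open>The bracket is the derivative of \<open>Ad (exp (t \<eta>)) \<zeta>\<close>, a curve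
  that never leaves the closed subspace \<open>S\<close>.\<close>

lemma bracket_invariant:
  assumes S: "subspace S" "\<forall>k\<in>H. Ad G LG k ` S \<subseteq> S" and "\<eta> \<in> \<hh>" "\<zeta> \<in> S"
  shows "lie_bracket G LG \<eta> \<zeta> \<in> S"
proof (rule has_vector_derivative_lin_on(1)[OF _ linear_lin_on[OF linear_id] Ad_exp_derivative])
  show "fin_dim S" using fin_dim_subset[OF fin_dim_algebra S(1)] by blast
  show "\<forall>\<^sub>F t in nhds 0. Ad G LG (expG (t *\<^sub>R \<eta>)) \<zeta> \<in> S"
    using S(2) exp_in_H[OF assms(3)] assms(4) by (intro always_eventually) blast
qed

section \<open>The momentum map of the normal space, extended by zero\<close>

definition "J x = Blinfun (\<lambda>\<zeta>. 1/2 * \<omega>V (genV (proj_along \<hh> \<mm>\<qq> \<zeta>) x) x)"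

lemma linear_\<omega>V_genV: "linear (\<lambda>\<zeta>. \<omega>V (genV (proj_along \<hh> \<mm>\<qq> \<zeta>) x) y)"
proof -
  note p = linear_proj_along[OF h_mq] and i = proj_along_direct_sum(1)[OF h_mq]
    and g = genV_lin_on[OF subspaces(1)]
  show ?thesis
    by (rule linearI)
       (simp_all add: linear_add[OF p] linear_scale[OF p] lin_on_add[OF g i i] lin_on_scale[OF g i]
          linear_add[OF \<omega>V_linear1] linear_scale[OF \<omega>V_linear1])
qed

lemma J_apply: "blinfun_apply (J x) \<zeta> = 1/2 * \<omega>V (genV (proj_along \<hh> \<mm>\<qq> \<zeta>) x) x"
proof -
  have "linear (\<lambda>\<zeta>. 1/2 * \<omega>V (genV (proj_along \<hh> \<mm>\<qq> \<zeta>) x) x)"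
    using linear_compose_scale_right[OF linear_\<omega>V_genV, of "1/2"] by simp
  from Blinfun_linear[OF this] show ?thesis unfolding J_def .
qed

lemma genV_zero: "genV 0 x = 0"
  by (rule lin_on_zero[OF genV_lin_on[OF subspaces(1)] subspace_0[OF subspaces(1)]])

lemma proj_h_mq: "\<zeta> \<in> \<mm>\<qq> \<Longrightarrow> proj_along \<hh> \<mm>\<qq> \<zeta> = 0"
  by (rule proj_along_eqI[OF h_mq]) (auto simp: subspace_0[OF subspaces(1)])

lemma J_vanishes: "\<zeta> \<in> \<mm>\<qq> \<Longrightarrow> blinfun_apply (J x) \<zeta> = 0"
  by (simp add: J_apply proj_h_mq genV_zero linear_0[OF \<omega>V_linear1])

text \<open>\<open>J\<close> is quadratic: the two terms of the product rule coincide because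
  \<open>genV\<close> is skew for \<open>\<omega>V\<close>, and this cancels the factor 1/2. A dual
  basis reduces the functional-valued derivative to real coordinates.\<close>

lemma J_has_derivative:
  obtains DJ where "(J has_derivative DJ) (at x)"
    "\<And>u \<eta>. blinfun_apply (DJ u) \<eta> = \<omega>V (genV (proj_along \<hh> \<mm>\<qq> \<eta>) x) u"
proof -
  obtain B :: "'g set" and r :: "'g \<Rightarrow> 'g \<Rightarrow>\<^sub>L real" where B: "finite B"
    "\<And>x. x = (\<Sum>b\<in>B. blinfun_apply (r b) x *\<^sub>R b)"
    "\<And>\<nu> :: 'g \<Rightarrow>\<^sub>L real. \<nu> = (\<Sum>b\<in>B. blinfun_apply \<nu> b *\<^sub>R r b)"
    by (rule fin_dim_dual_basis[OF fin_dim_algebra]) (rule that)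
  define P where "P = proj_along \<hh> \<mm>\<qq>"
  have P: "P \<zeta> \<in> \<hh>" for \<zeta> unfolding P_def by (rule proj_along_direct_sum(1)[OF h_mq])
  have comp: "((\<lambda>x. blinfun_apply (J x) \<eta>) has_derivative (\<lambda>u. \<omega>V (genV (P \<eta>) x) u)) (at x)" for \<eta>
  proof -
    have bl: "bounded_linear (genV (P \<eta>))"
      by (rule fin_dim_linear_bounded[OF fin_dim_V linear_genV[OF P]])
    have "((\<lambda>x. \<omega>V (genV (P \<eta>) x) x) has_derivative
        (\<lambda>u. \<omega>V (genV (P \<eta>) x) u + \<omega>V (genV (P \<eta>) u) x)) (at x)"
      by (rule bounded_bilinear.FDERIV[OF bounded_bilinear_\<omega>V
            bounded_linear.has_derivative[OF bl has_derivative_ident] has_derivative_ident])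
    moreover have "\<omega>V (genV (P \<eta>) u) x = \<omega>V (genV (P \<eta>) x) u" for u
      using \<omega>V_genV[OF P, of \<eta> u x] \<omega>V_skew[of u "genV (P \<eta>) x"] by simp
    ultimately have "((\<lambda>x. \<omega>V (genV (P \<eta>) x) x) has_derivative (\<lambda>u. 2 * \<omega>V (genV (P \<eta>) x) u)) (at x)"
      by simp
    from has_derivative_mult_right[OF this, of "1/2"] show ?thesis
      unfolding J_apply P_def[symmetric] by simp
  qed
  define DJ where "DJ u = (\<Sum>b\<in>B. \<omega>V (genV (P b) x) u *\<^sub>R r b)" for u
  have "((\<lambda>x. \<Sum>b\<in>B. blinfun_apply (J x) b *\<^sub>R r b) has_derivative DJ) (at x)"
    unfolding DJ_def by (intro has_derivative_sum has_derivative_scaleR_left comp)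
  then have DJ: "(J has_derivative DJ) (at x)" using B(3) by simp
  have "((\<lambda>x. blinfun_apply (J x) \<eta>) has_derivative (\<lambda>u. blinfun_apply (DJ u) \<eta>)) (at x)" for \<eta>
    by (rule bounded_linear.has_derivative[OF blinfun.bounded_linear_left DJ])
  then have eq: "(\<lambda>u. blinfun_apply (DJ u) \<eta>) = (\<lambda>u. \<omega>V (genV (P \<eta>) x) u)" for \<eta>
    using comp by (rule has_derivative_unique)
  have "blinfun_apply (DJ u) \<eta> = \<omega>V (genV (proj_along \<hh> \<mm>\<qq> \<eta>) x) u" for u \<eta>
    using fun_cong[OF eq[of \<eta>], of u] unfolding P_def .
  with DJ show ?thesis by (rule that)
qed

text \<open>The minus sign arises because \<open>coAd\<close> at the inverse of the exponential
  pulls back along \<open>Ad (exp (- t \<eta>))\<close>.\<close>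

lemma coAd_exp_derivative:
  "((\<lambda>t. coAd G LG (inv (expG (t *\<^sub>R \<eta>))) \<rho>) has_vector_derivative - coad G LG \<eta> \<rho>) (at 0)"
proof -
  obtain B :: "'g set" and r :: "'g \<Rightarrow> 'g \<Rightarrow>\<^sub>L real" where B: "finite B"
    "\<And>x. x = (\<Sum>b\<in>B. blinfun_apply (r b) x *\<^sub>R b)"
    "\<And>\<nu> :: 'g \<Rightarrow>\<^sub>L real. \<nu> = (\<Sum>b\<in>B. blinfun_apply \<nu> b *\<^sub>R r b)"
    by (rule fin_dim_dual_basis[OF fin_dim_algebra]) (rule that)
  define c where "c t = coAd G LG (inv (expG (t *\<^sub>R \<eta>))) \<rho>" for t
  have "((\<lambda>t. blinfun_apply (c t) b) has_vector_derivative blinfun_apply (- coad G LG \<eta> \<rho>) b) (at 0)" for b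
  proof -
    have c: "blinfun_apply (c t) b = blinfun_apply \<rho> (Ad G LG (expG (t *\<^sub>R (- \<eta>))) b)" for t
    proof -
      have "inv (expG (t *\<^sub>R \<eta>)) = expG (t *\<^sub>R (- \<eta>))" unfolding exp_minus by simp
      then show ?thesis unfolding c_def by (simp only: coAd_apply exp_carrier)
    qed
    have "((\<lambda>t. blinfun_apply (c t) b) has_vector_derivative blinfun_apply \<rho> (lie_bracket G LG (- \<eta>) b)) (at 0)"
      unfolding c
      by (rule bounded_linear.has_vector_derivative[OF blinfun.bounded_linear_right Ad_exp_derivative])
    then show ?thesis
      by (simp add: coad_apply linear_neg[OF linear_lie_bracket(2)] blinfun.minus_left blinfun.minus_right)
  qed
  then have "((\<lambda>t. blinfun_apply (c t) b *\<^sub>R r b) has_vector_derivative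
      blinfun_apply (- coad G LG \<eta> \<rho>) b *\<^sub>R r b) (at 0)" for b
    by (rule bounded_linear.has_vector_derivative[OF bounded_linear_scaleR_left])
  then have "((\<lambda>t. \<Sum>b\<in>B. blinfun_apply (c t) b *\<^sub>R r b) has_vector_derivative
      (\<Sum>b\<in>B. blinfun_apply (- coad G LG \<eta> \<rho>) b *\<^sub>R r b)) (at 0)"
    by (intro has_vector_derivative_sum)
  then show ?thesis unfolding B(3)[symmetric] c_def .
qed

lemma coad_in_dual_summand:
  assumes \<eta>: "\<eta> \<in> \<hh>" and \<rho>: "\<forall>k\<in>H. coAd G LG (inv k) \<rho> \<in> dual_summand S"
  shows "coad G LG \<eta> \<rho> \<in> dual_summand S"
  unfolding dual_summand_def
proof (intro CollectI ballI)
  fix \<xi> assume \<xi>: "\<xi> \<in> S"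
  have "((\<lambda>t. blinfun_apply (coAd G LG (inv (expG (t *\<^sub>R \<eta>))) \<rho>) \<xi>) has_vector_derivative
      blinfun_apply (- coad G LG \<eta> \<rho>) \<xi>) (at 0)"
    by (rule bounded_linear.has_vector_derivative[OF blinfun.bounded_linear_left coAd_exp_derivative])
  moreover have "blinfun_apply (coAd G LG (inv (expG (t *\<^sub>R \<eta>))) \<rho>) \<xi> = 0" for t
    using \<rho> exp_in_H[OF \<eta>] \<xi> unfolding dual_summand_def by blast
  ultimately have "((\<lambda>t. 0) has_vector_derivative blinfun_apply (- coad G LG \<eta> \<rho>) \<xi>) (at (0::real))" by simp
  from vector_derivative_unique_at[OF this has_vector_derivative_const]
  show "blinfun_apply (coad G LG \<eta> \<rho>) \<xi> = 0" by (simp add: blinfun.minus_left)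
qed

text \<open>The function is constant along the curve through the point given by
  \<open>exp (t \<eta>)\<close>; this curve stays in \<open>E\<close>, so a derivative within
  \<open>E\<close> may be evaluated on its velocity.\<close>

lemma invariant_function_derivative:
  assumes D: "((\<lambda>(\<rho>, x). f \<rho> x) has_derivative D) (at (\<rho>, x) within E \<times> UNIV)"
    and inv: "\<forall>k\<in>H. f (coAd G LG (inv k) \<rho>) (actV k x) = (f \<rho> x :: real)"
    and E: "\<forall>k\<in>H. coAd G LG (inv k) \<rho> \<in> E" and \<eta>: "\<eta> \<in> \<hh>"
  shows "D (- coad G LG \<eta> \<rho>, genV \<eta> x) = 0"
proof -
  define u where "u t = (coAd G LG (inv (expG (t *\<^sub>R \<eta>))) \<rho>, actV (expG (t *\<^sub>R \<eta>)) x)" for t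
  have u: "(u has_vector_derivative (- coad G LG \<eta> \<rho>, genV \<eta> x)) (at 0)"
    unfolding u_def by (intro has_vector_derivative_Pair coAd_exp_derivative actV_exp_derivative \<eta>)
  have "coAd G LG (inv \<one>) \<rho> = \<rho>"
    by (rule blinfun_eqI) (simp add: coAd_apply Ad_one)
  then have u0: "u 0 = (\<rho>, x)" unfolding u_def by (simp add: exp_zero actV_one)
  have uE: "\<forall>\<^sub>F t in nhds 0. u t \<in> E \<times> UNIV"
    unfolding u_def using E exp_in_H[OF \<eta>] by (intro always_eventually) blast
  have "((\<lambda>t. (\<lambda>(\<rho>, x). f \<rho> x) (u t)) has_vector_derivative D (- coad G LG \<eta> \<rho>, genV \<eta> x)) (at 0)"
    by (rule has_derivative_curve[OF _ uE u]) (use D u0 in simp)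
  moreover have "(\<lambda>(\<rho>, x). f \<rho> x) (u t) = f \<rho> x" for t
    unfolding u_def using inv exp_in_H[OF \<eta>] by simp
  ultimately have "((\<lambda>t. f \<rho> x) has_vector_derivative D (- coad G LG \<eta> \<rho>, genV \<eta> x)) (at 0)" by simp
  from vector_derivative_unique_at[OF this has_vector_derivative_const] show ?thesis .
qed

text \<open>The identification of \<mm> with its bidual, which justifies the definite description
  behind the partial derivative in \<mm>. A vector representing \<open>D\<close> on the whole dual
  is projected to \<mm> along \<hh> + \<qq>, which does not change its pairing with functionals
  vanishing there.\<close>

lemma dual_representer:
  assumes D: "linear (D :: ('g \<Rightarrow>\<^sub>L real) \<Rightarrow> real)"
  shows "\<exists>!\<xi>. \<xi> \<in> \<mm> \<and> (\<forall>\<sigma>\<in>dual_summand \<hh>\<qq>. blinfun_apply \<sigma> \<xi> = D \<sigma>)"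
proof -
  obtain B :: "'g set" and r :: "'g \<Rightarrow> 'g \<Rightarrow>\<^sub>L real" where B: "finite B"
    "\<And>x. x = (\<Sum>b\<in>B. blinfun_apply (r b) x *\<^sub>R b)"
    "\<And>\<nu> :: 'g \<Rightarrow>\<^sub>L real. \<nu> = (\<Sum>b\<in>B. blinfun_apply \<nu> b *\<^sub>R r b)"
    by (rule fin_dim_dual_basis[OF fin_dim_algebra]) (rule that)
  define p where "p = proj_along \<mm> \<hh>\<qq>"
  define \<xi>0 where "\<xi>0 = (\<Sum>b\<in>B. D (r b) *\<^sub>R b)"
  have \<xi>0: "blinfun_apply \<sigma> \<xi>0 = D \<sigma>" for \<sigma>
  proof -
    have "blinfun_apply \<sigma> \<xi>0 = (\<Sum>b\<in>B. blinfun_apply \<sigma> b *\<^sub>R D (r b))"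
      unfolding \<xi>0_def by (simp add: blinfun.sum_right blinfun.scaleR_right mult.commute)
    also have "\<dots> = D (\<Sum>b\<in>B. blinfun_apply \<sigma> b *\<^sub>R r b)"
      by (simp add: linear_sum[OF D] linear_scale[OF D])
    finally show ?thesis using B(3) by metis
  qed
  have p: "p \<xi>0 \<in> \<mm>" "\<xi>0 - p \<xi>0 \<in> \<hh>\<qq>"
    unfolding p_def by (rule proj_along_direct_sum[OF m_hq])+
  have ex: "blinfun_apply \<sigma> (p \<xi>0) = D \<sigma>" if "\<sigma> \<in> dual_summand \<hh>\<qq>" for \<sigma>
    using that p(2) \<xi>0[of \<sigma>] unfolding dual_summand_def by (force simp: blinfun.diff_right)
  moreover have "\<xi> = p \<xi>0"
    if \<xi>: "\<xi> \<in> \<mm>" "\<forall>\<sigma>\<in>dual_summand \<hh>\<qq>. blinfun_apply \<sigma> \<xi> = D \<sigma>" for \<xi>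
  proof -
    define d where "d = \<xi> - p \<xi>0"
    have dm: "d \<in> \<mm>" unfolding d_def by (rule subspace_diff[OF subspaces(2) \<xi>(1) p(1)])
    have pd: "p d = d"
      unfolding p_def
      by (rule proj_along_eqI[OF m_hq dm]) (use direct_sum_of_subspace[OF hq] subspace_0 in auto)
    \<comment> \<open>The two candidates are compared only on functionals vanishing on \<hh> +
      \<qq>; as \<open>d\<close> lies in \<mm>, projecting a coordinate functional to that space
      does not change its value at \<open>d\<close>.\<close>
    have "blinfun_apply (r b) d = 0" for b
    proof -
      have "dual_proj \<mm> \<hh>\<qq> (r b) \<in> dual_summand \<hh>\<qq>" by (rule dual_proj_in_dual_summand[OF m_hq])
      then have "blinfun_apply (dual_proj \<mm> \<hh>\<qq> (r b)) d = 0"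
        unfolding d_def blinfun.diff_right using \<xi>(2) ex by simp
      then show ?thesis unfolding dual_proj_apply[OF m_hq] p_def[symmetric] pd .
    qed
    then have "d = 0" using B(2)[of d] by simp
    then show ?thesis unfolding d_def by simp
  qed
  ultimately show ?thesis using p(1) by blast
qed

text \<open>The \<open>\<gg>\<close>-component of \<open>l\<^sup>* (\<Omega> \<oplus> \<omega>\<^sub>V) (X, \<cdot>) = d (h \<circ> \<pi>)\<close>; \<open>inv\<close> is the infinitesimal
  \<open>H\<close>-invariance of \<open>h \<circ> \<pi>\<close>.\<close>
lemma momentum_identity:
  assumes \<rho>: "\<rho> \<in> dual_summand \<hh>\<qq>" and d: "d \<in> \<mm>" and s: "s \<in> \<qq>"
    and F: "dual_proj \<qq> \<kk> (coad G LG (d + s) (\<rho> + J x))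
      + Blinfun (\<lambda>\<eta>. \<omega> m (gen s) (gen (proj_along \<qq> \<kk> \<eta>))) = 0"
    and inv: "\<And>\<eta>. \<eta> \<in> \<hh> \<Longrightarrow> blinfun_apply \<rho> (lie_bracket G LG \<eta> d) = \<omega>V u (genV \<eta> x)"
  defines "Pm \<equiv> dual_proj \<mm> \<hh>\<qq>"
  shows "blinfun_apply (Pm (coad G LG d \<rho>) + Pm (coad G LG d (J x)) + Pm (coad G LG s (\<rho> + J x))) \<eta>
      + \<omega>V (genV (proj_along \<hh> \<mm>\<qq> \<eta>) x) u
    = blinfun_apply (\<rho> + J x) (lie_bracket G LG (s + d) \<eta>) + \<omega> m (gen (s + d)) (gen \<eta>)"
proof -
  define \<nu> where "\<nu> = \<rho> + J x"
  let ?br = "lie_bracket G LG"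
  obtain k c where kc: "\<eta> = k + c" "k \<in> \<kk>" "c \<in> \<qq>"
    using direct_sum_ofD(6)[OF kq UNIV_I[of \<eta>]] by blast
  obtain a b where ab: "k = a + b" "a \<in> \<hh>" "b \<in> \<mm>"
    using direct_sum_ofD(6)[OF hmk kc(2)] by blast
  have q_hq: "\<qq> \<subseteq> \<hh>\<qq>" and h_hq: "\<hh> \<subseteq> \<hh>\<qq>" using direct_sum_of_subset[OF hq] by auto
  have q_mq: "\<qq> \<subseteq> \<mm>\<qq>" and m_mq: "\<mm> \<subseteq> \<mm>\<qq>" using direct_sum_of_subset[OF mq] by auto
  have h_k: "\<hh> \<subseteq> \<kk>" and m_k: "\<mm> \<subseteq> \<kk>" using direct_sum_of_subset[OF hmk] by auto
  have \<nu>q: "blinfun_apply \<nu> z = 0" if "z \<in> \<qq>" for z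
  proof -
    have "blinfun_apply \<rho> z = 0" using \<rho> that q_hq unfolding dual_summand_def by blast
    moreover have "blinfun_apply (J x) z = 0" by (rule J_vanishes) (use that q_mq in blast)
    ultimately show ?thesis unfolding \<nu>_def by (simp add: blinfun.add_left)
  qed
  have pm: "proj_along \<mm> \<hh>\<qq> \<eta> = b"
  proof (rule proj_along_eqI[OF m_hq ab(3)])
    have "a + c \<in> \<hh>\<qq>" by (intro subspace_add[OF direct_sum_of_subspace[OF hq]]) (use ab kc h_hq q_hq in auto)
    then show "\<eta> - b \<in> \<hh>\<qq>" unfolding kc ab by (simp add: algebra_simps)
  qed
  have ph: "proj_along \<hh> \<mm>\<qq> \<eta> = a"
  proof (rule proj_along_eqI[OF h_mq ab(2)])
    have "b + c \<in> \<mm>\<qq>" by (intro subspace_add[OF direct_sum_of_subspace[OF mq]]) (use ab kc m_mq q_mq in auto)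
    then show "\<eta> - a \<in> \<mm>\<qq>" unfolding kc ab by (simp add: algebra_simps)
  qed
  have pq: "proj_along \<qq> \<kk> c = c"
    by (rule proj_along_eqI[OF direct_sum_of_commute[OF kq] kc(3)]) (simp add: subspace_0[OF subspaces(4)])
  have lin: "linear (\<lambda>\<eta>. \<omega> m (gen s) (gen (proj_along \<qq> \<kk> \<eta>)))"
  proof -
    note p = linear_proj_along[OF direct_sum_of_commute[OF kq]] and w = \<omega>_lin2[OF gen_in_model]
    show ?thesis
      by (rule linearI)
         (simp_all add: linear_add[OF p] linear_scale[OF p] linear_add[OF linear_gen] linear_scale[OF linear_gen]
           lin_on_add[OF w gen_in_model gen_in_model] lin_on_scale[OF w gen_in_model])
  qed
  \<comment> \<open>The implicit equation evaluated at the \<qq>-component of \<eta>, where the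
    projection onto \<qq> does nothing.\<close>
  have Fc: "blinfun_apply \<nu> (?br (s + d) c) + \<omega> m (gen s) (gen c) = 0"
  proof -
    have "blinfun_apply (dual_proj \<qq> \<kk> (coad G LG (d + s) (\<rho> + J x))
      + Blinfun (\<lambda>\<eta>. \<omega> m (gen s) (gen (proj_along \<qq> \<kk> \<eta>)))) c = 0"
      unfolding F by (rule blinfun.zero_left)
    then show ?thesis
      unfolding \<nu>_def
      by (simp add: blinfun.add_left dual_proj_apply[OF direct_sum_of_commute[OF kq]] pq coad_apply
          Blinfun_linear[OF lin] add.commute[of s d])
  qed
  have \<omega>k: "\<omega> m (gen y) (gen z) = 0" if "y \<in> \<kk>" for y z
    using that \<kk> N_iff by blast
  have gm: "\<omega> m (gen (y + z)) (gen w) = \<omega> m (gen y) (gen w) + \<omega> m (gen z) (gen w)"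
    "\<omega> m (gen w) (gen (y + z)) = \<omega> m (gen w) (gen y) + \<omega> m (gen w) (gen z)" for y z w
    using lin_on_add[OF \<omega>_lin1[OF gen_in_model] gen_in_model gen_in_model]
      lin_on_add[OF \<omega>_lin2[OF gen_in_model] gen_in_model gen_in_model]
    by (simp_all add: linear_add[OF linear_gen])
  \<comment> \<open>Generators of elements of \<kk> are orthogonal to the whole orbit direction, so
    only the two \<qq>-components interact.\<close>
  have "\<omega> m (gen (s + d)) (gen \<eta>) = \<omega> m (gen s) (gen k) + \<omega> m (gen s) (gen c)"
    unfolding gm kc(1) using \<omega>k[of d] d m_k by auto
  also have "\<omega> m (gen s) (gen k) = 0"
    using \<omega>_skew[OF gen_in_model gen_in_model, of s k] \<omega>k[OF kc(2)] by simp
  finally have \<omega>val: "\<omega> m (gen (s + d)) (gen \<eta>) = \<omega> m (gen s) (gen c)" by simp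
  \<comment> \<open>The bracket of \<hh> with \<qq> stays in \<qq>, on which both \<rho> and
    \<open>J x\<close> vanish.\<close>
  have sa: "blinfun_apply \<nu> (?br s a) = 0"
    using \<nu>q[OF bracket_invariant[OF subspaces(3) Ad_\<qq> ab(2) s]]
    by (simp add: lie_bracket_skew[of s a] blinfun.minus_right)
  \<comment> \<open>The bracket of \<open>a\<close> with \<open>d\<close> stays in \<mm>, so
    \<open>J x\<close> drops out and \<rho> is evaluated by \<open>inv\<close>. The sign from
    reversing the bracket is undone by the skewness of \<open>\<omega>V\<close>.\<close>
  have da: "blinfun_apply \<nu> (?br d a) = \<omega>V (genV a x) u"
  proof -
    have "?br a d \<in> \<mm>" by (rule bracket_invariant[OF subspaces(2) Ad_\<mm> ab(2) d])
    then have "blinfun_apply (J x) (?br a d) = 0" using J_vanishes m_mq by blast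
    then have "blinfun_apply \<nu> (?br a d) = \<omega>V u (genV a x)"
      unfolding \<nu>_def using inv[OF ab(2)] by (simp add: blinfun.add_left)
    then show ?thesis
      using \<omega>V_skew[of u "genV a x"] by (simp add: lie_bracket_skew[of d a] blinfun.minus_right)
  qed
  have "blinfun_apply \<nu> (?br (s + d) \<eta>)
      = blinfun_apply \<nu> (?br (s + d) a) + blinfun_apply \<nu> (?br (s + d) b) + blinfun_apply \<nu> (?br (s + d) c)"
    unfolding kc(1) ab(1) by (simp add: linear_add[OF linear_lie_bracket(1)] blinfun.add_right)
  also have "blinfun_apply \<nu> (?br (s + d) a) = \<omega>V (genV a x) u"
    using sa da by (simp add: linear_add[OF linear_lie_bracket(2)] blinfun.add_right)
  also have "blinfun_apply \<nu> (?br (s + d) b)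
      = blinfun_apply (Pm (coad G LG d \<rho>) + Pm (coad G LG d (J x)) + Pm (coad G LG s (\<rho> + J x))) \<eta>"
    unfolding Pm_def blinfun.add_left dual_proj_apply[OF m_hq] pm coad_apply \<nu>_def
    by (simp add: linear_add[OF linear_lie_bracket(2)] blinfun.add_right)
  finally show ?thesis using Fc unfolding \<omega>val ph \<nu>_def[symmetric] by simp
qed

end

section \<open>The tubular model\<close>

context lie_grp
begin

text \<open>The domain of the projection to the tubular model; \<open>E\<close>, \<open>A\<close>
  and \<open>W\<close> stand for \<open>\<mm>s\<close>, \<open>\<mm>r\<close> and
  \<open>Vr\<close>.\<close>

definition "slice_mfd E A W = prod_mfd LG (prod_mfd (open_mfd E A) (open_mfd UNIV W))"

context
  fixes E A :: "('g \<Rightarrow>\<^sub>L real) set" and W :: "'v::real_normed_vector set"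
    and g :: 'a and \<rho> :: "'g \<Rightarrow>\<^sub>L real" and x :: 'v
  assumes E: "subspace E" and A: "openin (top_of_set E) A" and W: "open W"
    and g: "g \<in> carrier G" and \<rho>: "\<rho> \<in> A" and x: "x \<in> W"
begin

text \<open>The preferred chart at the point (g, \<rho>, x). The linear factors carry identity
  charts, so only the group coordinate is transformed.\<close>

definition "cz = prod_chart (chart_at LG g) (prod_chart (A, id) (W, id))"
definition "yz = chart_map (chart_at LG g) g"
definition "czI = (chart_map (chart_at LG g) ` chart_dom (chart_at LG g)) \<times> A \<times> W"

lemma charted_slice: "charted (slice_mfd E A W)"
  unfolding slice_mfd_def
  by (intro charted_prod_mfd charted_LG charted_open_mfd E A) (simp_all add: W)

lemma slice_sel: "model (slice_mfd E A W) = UNIV \<times> E \<times> UNIV"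
    "carrier (slice_mfd E A W) = carrier G \<times> A \<times> W"
    "chart_at (slice_mfd E A W) (g, \<rho>, x) = cz" "chart_map cz (g, \<rho>, x) = (yz, \<rho>, x)"
    "chart_map cz ` chart_dom cz = czI"
  unfolding slice_mfd_def cz_def yz_def czI_def prod_mfd_sel open_mfd_sel prod_chart_sel
  by (simp_all add: model_LG carrier_LG prod_chart_def map_prod_surj_on)

lemma yz_czI: "(yz, \<rho>, x) \<in> czI"
  unfolding yz_def czI_def using chart_at_LG(2)[OF g] \<rho> x by simp

lemma cz_inv:
  assumes "(y, \<sigma>, w) \<in> czI"
  shows "chart_inv cz (y, \<sigma>, w) = (chart_inv (chart_at LG g) y, \<sigma>, w)"
proof -
  have y: "y \<in> chart_map (chart_at LG g) ` chart_dom (chart_at LG g)" "\<sigma> \<in> A" "w \<in> W"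
    using assms unfolding czI_def by auto
  have c2: "charted (open_mfd E A)" "charted (open_mfd UNIV W)"
    by (intro charted_open_mfd E A, intro charted_open_mfd) (simp_all add: W)
  have "chart_inv (prod_chart (A, id) (W, id)) (\<sigma>, w) = (\<sigma>, w)"
    using chart_inv_prod_chart[OF c2, of "(A, id)" "(W, id)" \<sigma> w] y(2,3)
    by (simp add: open_mfd_sel chart_inv_id)
  moreover have "chart_inv cz (y, \<sigma>, w)
      = (chart_inv (chart_at LG g) y, chart_inv (prod_chart (A, id) (W, id)) (\<sigma>, w))"
    unfolding cz_def
  proof (rule chart_inv_prod_chart[OF charted_LG charted_prod_mfd[OF c2] chart_at_LG(1)[OF g] _ y(1)])
    show "prod_chart (A, id) (W, id) \<in> atlas (prod_mfd (open_mfd E A) (open_mfd UNIV W))"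
      by (rule prod_mfd_sel(4)) (simp_all add: open_mfd_sel)
    show "(\<sigma>, w) \<in> chart_map (prod_chart (A, id) (W, id)) ` chart_dom (prod_chart (A, id) (W, id))"
      unfolding prod_chart_def using y(2,3) by force
  qed
  ultimately show ?thesis by simp
qed

lemma at_czI: "at (yz, \<rho>, x) within czI = at (yz, \<rho>, x) within UNIV \<times> E \<times> UNIV"
proof (rule at_within_openin[OF _ yz_czI])
  have "cz \<in> atlas (slice_mfd E A W)"
    using chartedD(2)[OF charted_slice, of "(g, \<rho>, x)"] g \<rho> x unfolding slice_sel by simp
  from chartedD(6)[OF charted_slice this] show "openin (top_of_set (UNIV \<times> E \<times> UNIV)) czI"
    unfolding slice_sel .
qed

lemma slice_model_mem: "(yz, \<rho>, x) \<in> UNIV \<times> E \<times> UNIV"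
  using \<rho> A openin_imp_subset by blast

text \<open>A function that ignores the group variable factors through the projection to the linear
  factors. Its partial derivative comes from inserting the constant \<open>yz\<close>, and
  uniqueness of derivatives shows that the group direction contributes nothing.\<close>

lemma slice_derivative:
  fixes f :: "('g \<Rightarrow>\<^sub>L real) \<Rightarrow> 'v \<Rightarrow> real"
  assumes U: "chart_deriv (slice_mfd E A W) cz real_mfd (UNIV, id) (\<lambda>(g, \<rho>, x). f \<rho> x) (g, \<rho>, x) U"
  obtains D where "((\<lambda>(\<rho>, x). f \<rho> x) has_derivative D) (at (\<rho>, x) within E \<times> UNIV)"
    "\<And>a \<alpha> u. \<alpha> \<in> E \<Longrightarrow> U (a, \<alpha>, u) = D (\<alpha>, u)"
proof -
  let ?f = "\<lambda>(\<rho>, x). f \<rho> x"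
  have "((chart_map (UNIV, id) \<circ> (\<lambda>(g, \<rho>, x). f \<rho> x) \<circ> chart_inv cz) has_derivative U)
      (at (yz, \<rho>, x) within czI)"
    using chart_derivD(8)[OF U] unfolding slice_sel at_czI .
  then have "((\<lambda>y. ?f (snd y)) has_derivative U) (at (yz, \<rho>, x) within czI)"
    by (rule has_derivative_transform_within[where d = 1]) (use yz_czI cz_inv in auto)
  then have U': "((\<lambda>y. ?f (snd y)) has_derivative U) (at (yz, \<rho>, x) within UNIV \<times> E \<times> UNIV)"
    unfolding at_czI .
  have \<rho>E: "\<rho> \<in> E" using slice_model_mem by simp
  have "((\<lambda>q. (yz, q)) has_derivative (\<lambda>v. (0, v))) (at (\<rho>, x) within E \<times> UNIV)"
    by (auto intro!: derivative_eq_intros)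
  then have "((\<lambda>q. ?f (snd (yz, q))) has_derivative (\<lambda>v. U (0, v))) (at (\<rho>, x) within E \<times> UNIV)"
    by (rule has_derivative_compose_within[where E' = "UNIV \<times> E \<times> UNIV"])
       (use \<rho>E U' in \<open>auto simp: eventually_at_filter\<close>)
  then have D: "(?f has_derivative (\<lambda>v. U (0, v))) (at (\<rho>, x) within E \<times> UNIV)" by simp
  have "((\<lambda>y. ?f (snd y)) has_derivative (\<lambda>v. U (0, snd v))) (at (yz, \<rho>, x) within UNIV \<times> E \<times> UNIV)"
    by (rule has_derivative_compose_within[where E' = "E \<times> UNIV" and f = snd and A = snd])
       (use \<rho>E D in \<open>auto simp: eventually_at_filter intro!: derivative_eq_intros always_eventually\<close>)
  then have UE: "U (a, \<alpha>, u) = U (0, \<alpha>, u)" if "\<alpha> \<in> E" for a \<alpha> u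
    using has_derivative_unique_within_subspace[OF U' _ _ slice_model_mem, of _ "(a, \<alpha>, u)"] that E
    by (simp add: subspace_Times)
  show ?thesis by (rule that[OF D]) (rule UE)
qed

text \<open>The map leaves the group entry alone, so the same group chart appears on both sides; in
  coordinates it only shifts the dual entry by \<open>J\<close>.\<close>

lemma slice_momentum_tmap:
  assumes J: "(J has_derivative DJ) (at x)" and \<alpha>: "\<alpha> \<in> E"
  shows "tmap (slice_mfd E A W) (prod_mfd (prod_mfd LG (open_mfd F B)) (open_mfd UNIV W))
      (\<lambda>(g, \<rho>, x). ((g, \<rho> + J x), x)) (g, \<rho>, x) (a, \<alpha>, u) = ((a, \<alpha> + DJ u), u)"
proof -
  let ?l = "\<lambda>(g, \<rho>, x). ((g, \<rho> + J x), x)"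
  let ?d = "prod_chart (prod_chart (chart_at LG g) (B, id)) (W, id)"
  have "((\<lambda>(y, \<rho>, x). ((y, \<rho> + J x), x)) has_derivative (\<lambda>(a, \<alpha>, u). ((a, \<alpha> + DJ u), u)))
      (at (yz, \<rho>, x) within czI)"
  proof -
    have "((\<lambda>z. J (snd (snd z))) has_derivative (\<lambda>z. DJ (snd (snd z)))) (at (yz, \<rho>, x) within czI)"
      by (rule has_derivative_compose[where g = J]) (auto intro!: derivative_eq_intros J)
    then show ?thesis unfolding case_prod_unfold by (auto intro!: derivative_eq_intros)
  qed
  then have "((chart_map ?d \<circ> ?l \<circ> chart_inv cz) has_derivative (\<lambda>(a, \<alpha>, u). ((a, \<alpha> + DJ u), u)))
      (at (yz, \<rho>, x) within czI)"
  proof (rule has_derivative_transform_within[where d = 1])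
    fix y assume y: "y \<in> czI"
    obtain p \<sigma> w where p: "y = (chart_map (chart_at LG g) p, \<sigma>, w)" "p \<in> chart_dom (chart_at LG g)"
      using y unfolding czI_def by auto
    then show "(case y of (y, \<rho>, x) \<Rightarrow> ((y, \<rho> + J x), x)) = (chart_map ?d \<circ> ?l \<circ> chart_inv cz) y"
      using cz_inv y charted_chart_inv[OF charted_LG chart_at_LG(1)[OF g] p(2)]
      by (simp add: prod_chart_sel)
  qed (simp_all add: yz_czI)
  then have "((chart_map ?d \<circ> ?l \<circ> chart_inv cz) has_derivative (\<lambda>(a, \<alpha>, u). ((a, \<alpha> + DJ u), u)))
      (at (yz, \<rho>, x) within UNIV \<times> E \<times> UNIV)" unfolding at_czI .
  from frechet_derivative_eq_within_subspace[OF this _ slice_model_mem, of "(a, \<alpha>, u)"]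
  have "frechet_derivative (chart_map ?d \<circ> ?l \<circ> chart_inv cz) (at (yz, \<rho>, x) within UNIV \<times> E \<times> UNIV)
      (a, \<alpha>, u) = ((a, \<alpha> + DJ u), u)"
    using \<alpha> E by (simp add: subspace_Times)
  then show ?thesis
    unfolding tmap_def Let_def slice_sel at_czI
    by (simp add: prod_mfd_sel open_mfd_sel)
qed

end

end

section \<open>Orbits and the Hamiltonian vector field on the quotient\<close>

context splitting
begin

text \<open>Points of the model are H-orbits as sets, and right multiplication by \<open>k\<close>
  permutes \<open>H\<close>; so the projection takes the same value along an orbit.\<close>

lemma actH_orbit:
  fixes actH :: "'a \<Rightarrow> 'a \<times> ('g \<Rightarrow>\<^sub>L real) \<times> 'v \<Rightarrow> 'a \<times> ('g \<Rightarrow>\<^sub>L real) \<times> 'v"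
  assumes actH: "actH = (\<lambda>k (g, \<rho>, x). (g \<otimes> inv k, coAd G LG (inv k) \<rho>, actV k x))"
    and k: "k \<in> H" and g: "g \<in> carrier G"
  shows "(\<lambda>j. actH j (actH k (g, \<rho>, x))) ` H = (\<lambda>j. actH j (g, \<rho>, x)) ` H"
proof -
  have comp: "actH j (actH k (g, \<rho>, x)) = actH (j \<otimes> k) (g, \<rho>, x)" if j: "j \<in> H" for j
    unfolding actH using H_carrier[OF j] H_carrier[OF k] g
    by (simp add: coAd_mult actV_mult[OF j k]) (simp add: inv_mult_group m_assoc)
  have "j = (j \<otimes> inv k) \<otimes> k" if "j \<in> H" for j
    using H_carrier[OF k] H_carrier[OF that] by (simp add: m_assoc)
  then have "(\<lambda>j. j \<otimes> k) ` H = H"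
    using H_mult[OF _ k] H_mult[OF _ H_inv[OF k]] by (auto simp: image_iff)
  then have "(\<lambda>j. actH j (g, \<rho>, x)) ` H = (\<lambda>j. actH j (g, \<rho>, x)) ` (\<lambda>j. j \<otimes> k) ` H"
    by (simp only:)
  also have "\<dots> = (\<lambda>j. actH (j \<otimes> k) (g, \<rho>, x)) ` H" by (rule image_image)
  also have "\<dots> = (\<lambda>j. actH j (actH k (g, \<rho>, x))) ` H"
    by (rule image_cong) (simp_all add: comp)
  finally show ?thesis by simp
qed

text \<open>The implicit map enters only through a vector \<open>s\<close> of \<qq> solving its
  equation at \<open>(d, \<rho> + J x)\<close>. The vectors \<open>d\<close> and
  \<open>X\<^sub>V\<close> are given as definite descriptions, which the proof has to resolve before
  it can compute with them.\<close>

lemma hamiltonian_field_model: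
  fixes \<mm>r \<kk>s \<kk>r :: "('g \<Rightarrow>\<^sub>L real) set" and Vr :: "'v set"
    and Y :: "(('a \<times> ('g \<Rightarrow>\<^sub>L real) \<times> 'v) set, 'y::real_normed_vector) manifold"
    and h :: "('a \<times> ('g \<Rightarrow>\<^sub>L real) \<times> 'v) set \<Rightarrow> real"
  defines "\<mm>s \<equiv> dual_summand \<hh>\<qq>" and "P\<^sub>m \<equiv> dual_proj \<mm> \<hh>\<qq>"
  assumes \<mm>r: "openin (top_of_set \<mm>s) \<mm>r" "\<forall>k\<in>H. coAd G LG (inv k) ` \<mm>r \<subseteq> \<mm>r"
    and Vr: "open Vr" "\<forall>k\<in>H. actV k ` Vr \<subseteq> Vr"
    and Z: "Z = slice_mfd \<mm>s \<mm>r Vr"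
    and \<Omega>: "\<Omega> = (\<lambda>(g, \<nu>) (a, \<rho>) (b, \<sigma>).
          let \<xi> = left_tr G LG g (inv g) a; \<eta> = left_tr G LG g (inv g) b in
          blinfun_apply \<sigma> \<xi> - blinfun_apply \<rho> \<eta> + blinfun_apply \<nu> (lie_bracket G LG \<xi> \<eta>)
            + \<omega> m (gen \<xi>) (gen \<eta>))"
    and actH: "actH = (\<lambda>k (g, \<rho>, x). (g \<otimes> inv k, coAd G LG (inv k) \<rho>, actV k x))"
    and \<pi>: "\<pi> = (\<lambda>z. (\<lambda>k. actH k z) ` H)"
    and Y: "smooth_manifold Y" "carrier Y = \<pi> ` carrier Z" "submersion Z Y \<pi>"
    and \<omega>Y: "symplectic_form Y \<omega>Y"
      "\<forall>z\<in>carrier Z. \<forall>X\<in>model Z. \<forall>X'\<in>model Z.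
         pullback Z Y \<pi> \<omega>Y z X X' = pullback Z (prod_mfd (prod_mfd LG (open_mfd \<kk>s \<kk>r)) (open_mfd UNIV Vr))
           (\<lambda>(g, \<rho>, x). ((g, \<rho> + J x), x)) (form_sum \<Omega> (\<lambda>_. \<omega>V)) z X X'"
    and h: "smooth_map Y real_mfd h"
      "\<forall>g\<in>carrier G. \<forall>y\<in>carrier Y. h ((\<lambda>(g', \<rho>, x). (g \<otimes> g', \<rho>, x)) ` y) = h y"
    and hr: "hr = (\<lambda>\<rho> x. h (\<pi> (\<one>, \<rho>, x)))"
    and g: "g \<in> carrier G" and \<rho>: "\<rho> \<in> \<mm>r" and x: "x \<in> Vr"
    and d: "d = (THE \<xi>. \<xi> \<in> \<mm> \<and>
          (\<forall>\<sigma>\<in>\<mm>s. blinfun_apply \<sigma> \<xi> = frechet_derivative (\<lambda>\<rho>. hr \<rho> x) (at \<rho> within \<mm>r) \<sigma>))"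
    and X\<^sub>V: "X\<^sub>V = (THE y. \<forall>w. \<omega>V y w = frechet_derivative (\<lambda>x. hr \<rho> x) (at x) w)"
    and s: "s \<in> \<qq>" "dual_proj \<qq> \<kk> (coad G LG (d + s) (\<rho> + J x))
      + Blinfun (\<lambda>\<eta>. \<omega> m (gen s) (gen (proj_along \<qq> \<kk> \<eta>))) = 0"
  shows "hamiltonian_field Y \<omega>Y h (\<pi> (g, \<rho>, x)) = tmap Z Y \<pi> (g, \<rho>, x)
      (left_tr G LG \<one> g (s + d),
       P\<^sub>m (coad G LG d \<rho>) + P\<^sub>m (coad G LG d (J x)) + P\<^sub>m (coad G LG s (\<rho> + J x)), X\<^sub>V)"
proof -
  have ms: "subspace \<mm>s"
    unfolding \<mm>s_def dual_summand_def subspace_def by (auto simp: blinfun.add_left blinfun.scaleR_left)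
  have \<rho>s: "\<rho> \<in> \<mm>s" using \<mm>r(1) \<rho> openin_imp_subset by blast
  note slice = ms \<mm>r(1) Vr(1) g \<rho> x
  let ?z = "(g, \<rho>, x)"
  have Zsel: "model Z = UNIV \<times> \<mm>s \<times> UNIV" "carrier Z = carrier G \<times> \<mm>r \<times> Vr"
    unfolding Z using slice_sel(1,2)[OF slice] by simp_all
  have chZ: "charted Z" unfolding Z by (rule charted_slice[OF slice])
  have chY: "charted Y" by (rule smooth_manifold_charted[OF Y(1)])
  have z: "?z \<in> carrier Z" unfolding Zsel using g \<rho> x by simp
  have \<pi>z: "\<pi> ?z \<in> carrier Y" unfolding Y(2) using z by blast
  \<comment> \<open>Left translation by \<open>g'\<close> carries the orbit of (1, \<sigma>, w) to
    that of (g', \<sigma>, w), so G-invariance removes the group entry.\<close>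
  have h\<pi>: "h (\<pi> (g', \<sigma>, w)) = hr \<sigma> w" if "g' \<in> carrier G" "\<sigma> \<in> \<mm>r" "w \<in> Vr" for g' \<sigma> w
  proof -
    have "(\<lambda>(a, \<rho>, x). (g' \<otimes> a, \<rho>, x)) ` \<pi> (\<one>, \<sigma>, w) = \<pi> (g', \<sigma>, w)"
      unfolding \<pi> actH image_image using that(1) H_carrier by (auto simp: image_iff)
    moreover have "\<pi> (\<one>, \<sigma>, w) \<in> carrier Y" unfolding Y(2) Zsel using that by blast
    ultimately show ?thesis using h(2) that(1) unfolding hr by metis
  qed
  \<comment> \<open>The differential of \<open>h\<close> after the tangent map of the projection.
    Being defined on the domain of the projection, it can be compared with the derivative of
    \<open>hr\<close>.\<close>
  define U where "U X = tmap Y real_mfd h (\<pi> ?z) (tmap Z Y \<pi> ?z X)" for X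
  have sm\<pi>: "smooth_map Z Y \<pi>" and onto: "tmap Z Y \<pi> ?z ` model Z = model Y"
    using Y(3) z unfolding submersion_def by blast+
  have U: "chart_deriv Z (chart_at Z ?z) real_mfd (UNIV, id) (\<lambda>(g, \<rho>, x). hr \<rho> x) ?z U"
  proof -
    have "chart_deriv Y (chart_at Y (\<pi> ?z)) real_mfd (UNIV, id) h (\<pi> ?z) (tmap Y real_mfd h (\<pi> ?z))"
      using smooth_map_chart_deriv_tmap[OF h(1) chY charted_real_mfd \<pi>z] by (simp add: real_mfd_sel)
    from chart_deriv_comp[OF smooth_map_chart_deriv_tmap[OF sm\<pi> chZ chY z] this]
    have "chart_deriv Z (chart_at Z ?z) real_mfd (UNIV, id) (\<lambda>z. h (\<pi> z)) ?z U" unfolding U_def .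
    then show ?thesis
      by (rule chart_deriv_cong) (auto simp: Zsel h\<pi>)
  qed
  obtain D where D: "((\<lambda>(\<rho>, x). hr \<rho> x) has_derivative D) (at (\<rho>, x) within \<mm>s \<times> UNIV)"
      and UD: "\<And>a \<alpha> u. \<alpha> \<in> \<mm>s \<Longrightarrow> U (a, \<alpha>, u) = D (\<alpha>, u)"
    using slice_derivative[OF slice, of hr U] U slice_sel(3)[OF slice] unfolding Z by metis
  have linD: "linear D" by (rule bounded_linear.linear[OF has_derivative_bounded_linear[OF D]])
  have Dsplit: "D (\<alpha>, u) = D (\<alpha>, 0) + D (0, u)" for \<alpha> u
    using linear_add[OF linD, of "(\<alpha>, 0)" "(0, u)"] by simp
  \<comment> \<open>The restriction to \<open>\<mm>s\<close> matters: derivatives within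
    \<open>\<mm>r\<close> are determined only there, and \<open>d\<close> is tested only
    there.\<close>
  have D1: "frechet_derivative (\<lambda>\<rho>. hr \<rho> x) (at \<rho> within \<mm>r) \<sigma> = D (\<sigma>, 0)" if "\<sigma> \<in> \<mm>s" for \<sigma>
  proof -
    have "((\<lambda>\<rho>. (\<rho>, x)) has_derivative (\<lambda>v. (v, 0))) (at \<rho> within \<mm>s)" by (auto intro!: derivative_eq_intros)
    then have "((\<lambda>\<rho>. (\<lambda>(\<rho>, x). hr \<rho> x) (\<rho>, x)) has_derivative (\<lambda>v. D (v, 0))) (at \<rho> within \<mm>s)"
      by (rule has_derivative_compose_within[where E' = "\<mm>s \<times> UNIV"])
         (use \<rho>s D in \<open>auto simp: eventually_at_filter\<close>)
    then have "((\<lambda>\<rho>. hr \<rho> x) has_derivative (\<lambda>v. D (v, 0))) (at \<rho> within \<mm>s)" by simp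
    from frechet_derivative_eq_within_subspace[OF this ms \<rho>s that]
    show ?thesis unfolding at_within_openin[OF \<mm>r(1) \<rho>] .
  qed
  have D2: "frechet_derivative (\<lambda>x. hr \<rho> x) (at x) = (\<lambda>u. D (0, u))"
  proof -
    have "((\<lambda>x. (\<rho>, x)) has_derivative (\<lambda>v. (0, v))) (at x)" by (auto intro!: derivative_eq_intros)
    then have "((\<lambda>x. (\<lambda>(\<rho>, x). hr \<rho> x) (\<rho>, x)) has_derivative (\<lambda>v. D (0, v))) (at x)"
      by (rule has_derivative_compose_within[where E' = "\<mm>s \<times> UNIV"])
         (use \<rho>s D in \<open>auto simp: eventually_at_filter\<close>)
    then show ?thesis by (simp add: frechet_derivative_at[symmetric])
  qed
  have linD1: "linear (\<lambda>\<sigma>. D (\<sigma>, 0))" and linD2: "linear (\<lambda>u. D (0, u))"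
    using linear_add[OF linD, of "(_, 0)" "(_, 0)"] linear_scale[OF linD, of _ "(_, 0)"]
      linear_add[OF linD, of "(0, _)" "(0, _)"] linear_scale[OF linD, of _ "(0, _)"]
    by (auto intro!: linearI)
  have "d = (THE \<xi>. \<xi> \<in> \<mm> \<and> (\<forall>\<sigma>\<in>\<mm>s. blinfun_apply \<sigma> \<xi> = D (\<sigma>, 0)))"
    unfolding d using D1 by (intro arg_cong[where f = The] ext) auto
  then have d: "d \<in> \<mm>" "\<And>\<sigma>. \<sigma> \<in> \<mm>s \<Longrightarrow> blinfun_apply \<sigma> d = D (\<sigma>, 0)"
    using theI'[OF dual_representer[OF linD1]] unfolding \<mm>s_def by blast+
  have X\<^sub>V: "\<omega>V X\<^sub>V w = D (0, w)" for w
    unfolding X\<^sub>V D2 using theI'[OF \<omega>V_representer[OF linD2]] by blast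
  \<comment> \<open>Acting by \<open>k\<close> replaces the group entry by \<open>inv k\<close>,
    which \<open>h\<pi>\<close> forgets, and by \<open>actH_orbit\<close> the point of the quotient
    is unchanged.\<close>
  have "\<forall>k\<in>H. hr (coAd G LG (inv k) \<rho>) (actV k x) = hr \<rho> x"
  proof
    fix k assume k: "k \<in> H"
    have "coAd G LG (inv k) \<rho> \<in> \<mm>r" "actV k x \<in> Vr" using \<mm>r(2) Vr(2) k \<rho> x by blast+
    then have "h (\<pi> (\<one> \<otimes> inv k, coAd G LG (inv k) \<rho>, actV k x)) = hr (coAd G LG (inv k) \<rho>) (actV k x)"
      using h\<pi> k H_carrier by simp
    moreover have "\<pi> (\<one> \<otimes> inv k, coAd G LG (inv k) \<rho>, actV k x) = \<pi> (\<one>, \<rho>, x)"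
      using actH_orbit[OF actH k one_closed, of \<rho> x] unfolding \<pi> actH by simp
    ultimately show "hr (coAd G LG (inv k) \<rho>) (actV k x) = hr \<rho> x"
      using h\<pi>[OF one_closed \<rho> x] by (simp only:)
  qed
  moreover have coAds: "\<forall>k\<in>H. coAd G LG (inv k) \<rho> \<in> \<mm>s"
    using \<mm>r \<rho> openin_imp_subset by blast
  ultimately have invariance: "D (- coad G LG \<eta> \<rho>, genV \<eta> x) = 0" if "\<eta> \<in> \<hh>" for \<eta>
    using invariant_function_derivative[OF D] that by blast
  \<comment> \<open>The invariance splits into a dual and a normal part: \<open>d\<close> represents
    the first, which gives minus the pairing of \<rho> with the bracket, and
    \<open>X\<^sub>V\<close> the second.\<close>
  have inv: "blinfun_apply \<rho> (lie_bracket G LG \<eta> d) = \<omega>V X\<^sub>V (genV \<eta> x)" if \<eta>: "\<eta> \<in> \<hh>" for \<eta>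
  proof -
    have c: "coad G LG \<eta> \<rho> \<in> \<mm>s"
      unfolding \<mm>s_def by (rule coad_in_dual_summand[OF \<eta>]) (use coAds in \<open>simp add: \<mm>s_def\<close>)
    have "D (- coad G LG \<eta> \<rho>, 0) = - blinfun_apply \<rho> (lie_bracket G LG \<eta> d)"
      using d(2)[OF subspace_neg[OF ms c]] by (simp add: blinfun.minus_left coad_apply)
    then show ?thesis
      using invariance[OF \<eta>] Dsplit[of "- coad G LG \<eta> \<rho>" "genV \<eta> x"] X\<^sub>V[of "genV \<eta> x"] by linarith
  qed
  obtain DJ where DJ: "(J has_derivative DJ) (at x)"
      "\<And>u \<eta>. blinfun_apply (DJ u) \<eta> = \<omega>V (genV (proj_along \<hh> \<mm>\<qq> \<eta>) x) u"
    by (rule J_has_derivative) (rule that)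
  define X\<^sub>m where "X\<^sub>m = P\<^sub>m (coad G LG d \<rho>) + P\<^sub>m (coad G LG d (J x)) + P\<^sub>m (coad G LG s (\<rho> + J x))"
  define X where "X = (left_tr G LG \<one> g (s + d), X\<^sub>m, X\<^sub>V)"
  have X\<^sub>ms: "X\<^sub>m \<in> \<mm>s"
    unfolding X\<^sub>m_def P\<^sub>m_def
    by (intro subspace_add[OF ms]) (simp_all add: \<mm>s_def dual_proj_in_dual_summand[OF m_hq])
  then have XZ: "X \<in> model Z" unfolding X_def Zsel by simp
  have key: "pullback Z Y \<pi> \<omega>Y ?z X X' = U X'" if X': "X' \<in> model Z" for X'
  proof -
    obtain a \<alpha> u where X'eq: "X' = (a, \<alpha>, u)" and \<alpha>: "\<alpha> \<in> \<mm>s" using X' unfolding Zsel by auto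
    define \<eta> where "\<eta> = left_tr G LG g (inv g) a"
    have sd: "s + d \<in> \<mm>\<qq>"
      using direct_sum_ofD(5)[OF mq d(1) s(1)] by (simp add: add.commute)
    \<comment> \<open>A functional in \<open>\<mm>s\<close> kills \<qq>, so \<alpha> sees only
      \<open>d\<close>; the derivative of \<open>J\<close> kills \<mm> + \<qq>, so it does not see
      \<open>s + d\<close> at all.\<close>
    have q0: "blinfun_apply \<alpha> s = 0"
      using \<alpha> s(1) direct_sum_of_subset(2)[OF hq] unfolding \<mm>s_def dual_summand_def by blast
    have "pullback Z Y \<pi> \<omega>Y ?z X X' = form_sum \<Omega> (\<lambda>_. \<omega>V) ((g, \<rho> + J x), x)
        ((left_tr G LG \<one> g (s + d), X\<^sub>m + DJ X\<^sub>V), X\<^sub>V) ((a, \<alpha> + DJ u), u)"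
      using \<omega>Y(2)[rule_format, OF z XZ X'] unfolding pullback_def X_def X'eq Z
      by (simp add: slice_momentum_tmap[OF slice DJ(1) X\<^sub>ms] slice_momentum_tmap[OF slice DJ(1) \<alpha>])
    also have "\<dots> = blinfun_apply (\<alpha> + DJ u) (s + d) - blinfun_apply (X\<^sub>m + DJ X\<^sub>V) \<eta>
        + blinfun_apply (\<rho> + J x) (lie_bracket G LG (s + d) \<eta>) + \<omega> m (gen (s + d)) (gen \<eta>) + \<omega>V X\<^sub>V u"
      unfolding form_sum_def \<Omega> \<eta>_def by (simp add: Let_def left_tr_inverse[OF g])
    \<comment> \<open>All terms containing the group velocity \<eta> cancel here, which leaves the
      two partial derivatives of \<open>hr\<close>.\<close>
    also have "blinfun_apply (X\<^sub>m + DJ X\<^sub>V) \<eta>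
        = blinfun_apply (\<rho> + J x) (lie_bracket G LG (s + d) \<eta>) + \<omega> m (gen (s + d)) (gen \<eta>)"
      using momentum_identity[OF \<rho>s[unfolded \<mm>s_def] d(1) s inv, of \<eta>]
      unfolding X\<^sub>m_def P\<^sub>m_def blinfun.add_left[of _ "DJ X\<^sub>V"] DJ(2) by simp
    also have "blinfun_apply (\<alpha> + DJ u) (s + d) = D (\<alpha>, 0)"
      using d(2)[OF \<alpha>] q0 DJ(2)[of u "s + d"] proj_h_mq[OF sd]
      by (simp add: blinfun.add_left blinfun.add_right[of \<alpha>] genV_zero linear_0[OF \<omega>V_linear1])
    finally show ?thesis unfolding X'eq UD[OF \<alpha>] Dsplit[of \<alpha> u] X\<^sub>V by simp
  qed
  show ?thesis
    unfolding hamiltonian_field_def X\<^sub>m_def[symmetric] X_def[symmetric]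
  proof (rule the_equality)
    have ham: "\<omega>Y (\<pi> ?z) (tmap Z Y \<pi> ?z X) w = tmap Y real_mfd h (\<pi> ?z) w" if "w \<in> model Y" for w
    proof -
      \<comment> \<open>Every tangent vector of the quotient lifts because the projection is a
        submersion, so \<open>key\<close> tests against all of them.\<close>
      obtain X' where X': "X' \<in> model Z" "w = tmap Z Y \<pi> ?z X'" using \<open>w \<in> model Y\<close> onto by blast
      show ?thesis using key[OF X'(1)] unfolding pullback_def U_def X'(2) .
    qed
    have in_Y: "tmap Z Y \<pi> ?z X \<in> model Y" using onto XZ by blast
    show "tmap Z Y \<pi> ?z X \<in> model Y
      \<and> (\<forall>w\<in>model Y. \<omega>Y (\<pi> ?z) (tmap Z Y \<pi> ?z X) w = tmap Y real_mfd h (\<pi> ?z) w)"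
      using ham in_Y by blast
    fix X2 assume X2: "X2 \<in> model Y \<and> (\<forall>w\<in>model Y. \<omega>Y (\<pi> ?z) X2 w = tmap Y real_mfd h (\<pi> ?z) w)"
    have lin: "\<omega>Y (\<pi> ?z) (a *\<^sub>R u + b *\<^sub>R v) w = a * \<omega>Y (\<pi> ?z) u w + b * \<omega>Y (\<pi> ?z) v w"
      if "u \<in> model Y" "v \<in> model Y" "w \<in> model Y" for u v w a b
      using \<omega>Y(1)[unfolded symplectic_form_def two_form_def, THEN conjunct1, THEN conjunct1] \<pi>z that by blast
    have diff: "X2 - tmap Z Y \<pi> ?z X \<in> model Y"
      using X2 in_Y subspace_diff[OF chartedD(1)[OF chY]] by blast
    \<comment> \<open>Two solutions differ by a vector in the kernel of the symplectic form, which
      is zero.\<close>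
    have "\<omega>Y (\<pi> ?z) (X2 - tmap Z Y \<pi> ?z X) w = 0" if w: "w \<in> model Y" for w
      using lin[of X2 "tmap Z Y \<pi> ?z X" w 1 "-1"] X2 in_Y w ham[OF w] by simp
    then have "X2 - tmap Z Y \<pi> ?z X = 0"
      using \<omega>Y(1) \<pi>z diff unfolding symplectic_form_def by blast
    then show "X2 = tmap Z Y \<pi> ?z X" by simp
  qed
qed

end

theorem mainTheorem3:
  fixes G :: "'a monoid" and LG :: "('a, 'g::real_normed_vector) manifold"
    and expG :: "'g \<Rightarrow> 'a"
    and M :: "('p, 'e::real_normed_vector) manifold" and \<omega> :: "('p, 'e) form2"
    and \<Phi> :: "'a \<Rightarrow> 'p \<Rightarrow> 'p" and m :: 'p and H :: "'a set"
    and gen :: "'g \<Rightarrow> 'e" and orb N :: "'e set"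
    and cls :: "'e \<Rightarrow> 'v::real_normed_vector" and \<omega>V :: "'v \<Rightarrow> 'v \<Rightarrow> real"
    and actV :: "'a \<Rightarrow> 'v \<Rightarrow> 'v" and genV :: "'g \<Rightarrow> 'v \<Rightarrow> 'v" and J :: "'v \<Rightarrow> 'g \<Rightarrow>\<^sub>L real"
    and \<hh> \<kk> \<mm> \<qq> \<hh>\<qq> \<mm>\<qq> :: "'g set" and \<hh>s \<mm>s \<kk>s :: "('g \<Rightarrow>\<^sub>L real) set"
    and P\<^sub>m P\<^sub>q :: "('g \<Rightarrow>\<^sub>L real) \<Rightarrow> ('g \<Rightarrow>\<^sub>L real)"
    and \<hh>r \<mm>r \<kk>r :: "('g \<Rightarrow>\<^sub>L real) set" and Vr :: "'v set"
    and K :: "('a \<times> ('g \<Rightarrow>\<^sub>L real), 'g \<times> ('g \<Rightarrow>\<^sub>L real)) manifold"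
    and \<Omega> :: "('a \<times> ('g \<Rightarrow>\<^sub>L real), 'g \<times> ('g \<Rightarrow>\<^sub>L real)) form2"
    and VM :: "('v, 'v) manifold"
    and Z :: "('a \<times> ('g \<Rightarrow>\<^sub>L real) \<times> 'v, 'g \<times> ('g \<Rightarrow>\<^sub>L real) \<times> 'v) manifold"
    and actH :: "'a \<Rightarrow> 'a \<times> ('g \<Rightarrow>\<^sub>L real) \<times> 'v \<Rightarrow> 'a \<times> ('g \<Rightarrow>\<^sub>L real) \<times> 'v"
    and \<pi> :: "'a \<times> ('g \<Rightarrow>\<^sub>L real) \<times> 'v \<Rightarrow> ('a \<times> ('g \<Rightarrow>\<^sub>L real) \<times> 'v) set"
    and Y :: "(('a \<times> ('g \<Rightarrow>\<^sub>L real) \<times> 'v) set, 'y::real_normed_vector) manifold"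
    and actY :: "'a \<Rightarrow> ('a \<times> ('g \<Rightarrow>\<^sub>L real) \<times> 'v) set \<Rightarrow> ('a \<times> ('g \<Rightarrow>\<^sub>L real) \<times> 'v) set"
    and l :: "'a \<times> ('g \<Rightarrow>\<^sub>L real) \<times> 'v \<Rightarrow> ('a \<times> ('g \<Rightarrow>\<^sub>L real)) \<times> 'v"
    and \<omega>Y :: "(('a \<times> ('g \<Rightarrow>\<^sub>L real) \<times> 'v) set, 'y) form2"
    and F :: "'g \<Rightarrow> ('g \<Rightarrow>\<^sub>L real) \<Rightarrow> 'g \<Rightarrow> ('g \<Rightarrow>\<^sub>L real)"
    and \<tau> :: "'g \<Rightarrow> ('g \<Rightarrow>\<^sub>L real) \<Rightarrow> 'g" and dom\<tau> :: "('g \<times> ('g \<Rightarrow>\<^sub>L real)) set"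
    and h :: "('a \<times> ('g \<Rightarrow>\<^sub>L real) \<times> 'v) set \<Rightarrow> real"
    and hr :: "('g \<Rightarrow>\<^sub>L real) \<Rightarrow> 'v \<Rightarrow> real"
    and D\<^sub>m :: "('g \<Rightarrow>\<^sub>L real) \<Rightarrow> 'v \<Rightarrow> 'g" and D\<^sub>V :: "('g \<Rightarrow>\<^sub>L real) \<Rightarrow> 'v \<Rightarrow> 'v \<Rightarrow> real"
    and B\<^sub>V :: "('v \<Rightarrow> real) \<Rightarrow> 'v" and \<psi> :: "('g \<Rightarrow>\<^sub>L real) \<Rightarrow> 'v \<Rightarrow> 'g"
  \<comment> \<open>the proper canonical action\<close>
  assumes G: "lie_group G LG" and expG: "exponential_map G LG expG"
    and M: "smooth_manifold M" and \<omega>: "symplectic_form M \<omega>"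
    and action: "smooth_action G LG M \<Phi>" and proper: "proper_action LG M \<Phi>"
    and canonical: "canonical_action G M \<omega> \<Phi>"
    and m: "m \<in> carrier M" and H: "H = stabilizer G \<Phi> m"
    and gen: "gen = (\<lambda>\<xi>. inf_generator M \<Phi> expG \<xi> m)" and orb: "orb = range gen"
  \<comment> \<open>the symplectic normal space\<close>
    and N: "N = orth_compl (model M) (\<omega> m) orb"
    and cls: "quotient_space N (N \<inter> orb) cls"
    and \<omega>V: "\<omega>V = (\<lambda>x y. \<omega> m (inv_into N cls x) (inv_into N cls y))"
    and actV: "actV = (\<lambda>k x. cls (tmap M M (\<Phi> k) m (inv_into N cls x)))"
    and genV: "genV = (\<lambda>\<zeta> x. vector_derivative (\<lambda>t. actV (expG (t *\<^sub>R \<zeta>)) x) (at 0))"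
  \<comment> \<open>the splittings\<close>
    and \<hh>: "\<hh> = subgroup_algebra expG H" and \<kk>: "\<kk> = {\<eta>. gen \<eta> \<in> N}"
    and \<mm>: "direct_sum_of \<hh> \<mm> \<kk>" "\<forall>k\<in>H. Ad G LG k ` \<mm> \<subseteq> \<mm>"
    and \<qq>: "direct_sum_of \<kk> \<qq> UNIV" "\<forall>k\<in>H. Ad G LG k ` \<qq> \<subseteq> \<qq>"
    and sums: "direct_sum_of \<hh> \<qq> \<hh>\<qq>" "direct_sum_of \<mm> \<qq> \<mm>\<qq>"
    and duals: "\<hh>s = dual_summand \<mm>\<qq>" "\<mm>s = dual_summand \<hh>\<qq>" "\<kk>s = dual_summand \<qq>"
    and projs: "P\<^sub>m = dual_proj \<mm> \<hh>\<qq>" "P\<^sub>q = dual_proj \<qq> \<kk>"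
    and J: "J = (\<lambda>x. Blinfun (\<lambda>\<zeta>. 1/2 * \<omega>V (genV (proj_along \<hh> \<mm>\<qq> \<zeta>) x) x))"
  \<comment> \<open>the symplectic form on the product of the group and the truncated dual\<close>
    and \<hh>r: "openin (top_of_set \<hh>s) \<hh>r" "0 \<in> \<hh>r" "\<forall>k\<in>H. coAd G LG (inv\<^bsub>G\<^esub> k) ` \<hh>r \<subseteq> \<hh>r"
    and \<mm>r: "openin (top_of_set \<mm>s) \<mm>r" "0 \<in> \<mm>r" "\<forall>k\<in>H. coAd G LG (inv\<^bsub>G\<^esub> k) ` \<mm>r \<subseteq> \<mm>r"
    and \<kk>r: "\<kk>r = {\<alpha> + \<rho> |\<alpha> \<rho>. \<alpha> \<in> \<hh>r \<and> \<rho> \<in> \<mm>r}"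
    and K: "K = prod_mfd LG (open_mfd \<kk>s \<kk>r)"
    and \<Omega>: "\<Omega> = (\<lambda>(g, \<nu>) (a, \<rho>) (b, \<sigma>).
          let \<xi> = left_tr G LG g (inv\<^bsub>G\<^esub> g) a; \<eta> = left_tr G LG g (inv\<^bsub>G\<^esub> g) b in
          blinfun_apply \<sigma> \<xi> - blinfun_apply \<rho> \<eta> + blinfun_apply \<nu> (lie_bracket G LG \<xi> \<eta>)
            + \<omega> m (gen \<xi>) (gen \<eta>))"
    and \<Omega>_symplectic: "symplectic_form K \<Omega>"
  \<comment> \<open>the model\<close>
    and Vr: "open Vr" "0 \<in> Vr" "\<forall>k\<in>H. actV k ` Vr \<subseteq> Vr" "J ` Vr \<subseteq> \<hh>r"
    and VM: "VM = open_mfd UNIV Vr"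
    and Z: "Z = prod_mfd LG (prod_mfd (open_mfd \<mm>s \<mm>r) VM)"
    and actH: "actH = (\<lambda>k (g, \<rho>, x). (g \<otimes>\<^bsub>G\<^esub> inv\<^bsub>G\<^esub> k, coAd G LG (inv\<^bsub>G\<^esub> k) \<rho>, actV k x))"
    and \<pi>: "\<pi> = (\<lambda>z. (\<lambda>k. actH k z) ` H)"
    and Y: "smooth_manifold Y" "carrier Y = \<pi> ` carrier Z" "submersion Z Y \<pi>"
    and actY: "actY = (\<lambda>g' y. (\<lambda>(g, \<rho>, x). (g' \<otimes>\<^bsub>G\<^esub> g, \<rho>, x)) ` y)"
    and l: "l = (\<lambda>(g, \<rho>, x). ((g, \<rho> + J x), x))"
    and \<omega>Y: "symplectic_form Y \<omega>Y"
      "\<forall>z\<in>carrier Z. \<forall>X\<in>model Z. \<forall>X'\<in>model Z.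
         pullback Z Y \<pi> \<omega>Y z X X' = pullback Z (prod_mfd K VM) l (form_sum \<Omega> (\<lambda>_. \<omega>V)) z X X'"
  \<comment> \<open>the implicitly defined map\<close>
    and F: "F = (\<lambda>\<xi> \<mu> t. P\<^sub>q (coad G LG (\<xi> + t) \<mu>)
          + Blinfun (\<lambda>\<eta>. \<omega> m (gen t) (gen (proj_along \<qq> \<kk> \<eta>))))"
    and \<tau>: "openin (top_of_set (\<kk> \<times> \<kk>s)) dom\<tau>" "(0, 0) \<in> dom\<tau>"
      "smooth_on (\<kk> \<times> \<kk>s) dom\<tau> (\<lambda>(\<xi>, \<mu>). \<tau> \<xi> \<mu>)" "\<tau> 0 0 = 0"
      "\<forall>(\<xi>, \<mu>)\<in>dom\<tau>. \<tau> \<xi> \<mu> \<in> \<qq> \<and> F \<xi> \<mu> (\<tau> \<xi> \<mu>) = 0"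
  \<comment> \<open>the Hamiltonian\<close>
    and h: "smooth_map Y real_mfd h" "\<forall>g\<in>carrier G. \<forall>y\<in>carrier Y. h (actY g y) = h y"
    and hr: "hr = (\<lambda>\<rho> x. h (\<pi> (\<one>\<^bsub>G\<^esub>, \<rho>, x)))"
    and D\<^sub>m: "D\<^sub>m = (\<lambda>\<rho> x. THE \<xi>. \<xi> \<in> \<mm> \<and>
          (\<forall>\<sigma>\<in>\<mm>s. blinfun_apply \<sigma> \<xi> = frechet_derivative (\<lambda>\<rho>. hr \<rho> x) (at \<rho> within \<mm>r) \<sigma>))"
    and D\<^sub>V: "D\<^sub>V = (\<lambda>\<rho> x. frechet_derivative (\<lambda>x. hr \<rho> x) (at x))"
    and B\<^sub>V: "B\<^sub>V = (\<lambda>\<alpha>. THE x. \<forall>w. \<omega>V x w = \<alpha> w)"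
    and \<psi>: "\<psi> = (\<lambda>\<rho> x. \<tau> (D\<^sub>m \<rho> x) (\<rho> + J x))"
  shows "\<forall>g\<in>carrier G. \<forall>\<rho>\<in>\<mm>r. \<forall>x\<in>Vr. (D\<^sub>m \<rho> x, \<rho> + J x) \<in> dom\<tau> \<longrightarrow>
    hamiltonian_field Y \<omega>Y h (\<pi> (g, \<rho>, x)) = tmap Z Y \<pi> (g, \<rho>, x)
      (left_tr G LG \<one>\<^bsub>G\<^esub> g (\<psi> \<rho> x + D\<^sub>m \<rho> x),
       P\<^sub>m (coad G LG (D\<^sub>m \<rho> x) \<rho>) + P\<^sub>m (coad G LG (D\<^sub>m \<rho> x) (J x))
         + P\<^sub>m (coad G LG (\<psi> \<rho> x) (\<rho> + J x)),
       B\<^sub>V (D\<^sub>V \<rho> x))"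
proof -
  interpret A: lie_action G LG expG M \<Phi> m
    by unfold_locales (fact G expG M action m)+
  \<comment> \<open>The symbols of the statement are variables fixed by equations. They are
    identified with locale constants in stages, since each interpretation needs its assumptions
    phrased with the constants of the previous one.\<close>
  have gen_eq: "gen = A.gen" using gen by (simp add: fun_eq_iff A.gen_def)
  have H_eq: "H = A.H" using H by (simp add: A.H_def)
  interpret B: normal_space G LG expG M \<Phi> m \<omega> cls
    by unfold_locales (fact \<omega> canonical cls[unfolded N orb gen_eq])+
  have N_eq: "N = B.N" unfolding N orb gen_eq B.N_def ..
  have \<omega>V_eq: "\<omega>V = B.\<omega>V" using \<omega>V by (simp add: fun_eq_iff B.\<omega>V_def B.rep_def N_eq)
  have actV_eq: "actV = B.actV"
    using actV by (simp add: fun_eq_iff B.actV_def B.rep_def N_eq A.T_def)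
  have genV_eq: "genV = B.genV" using genV by (simp add: fun_eq_iff B.genV_def actV_eq)
  have \<hh>_eq: "\<hh> = A.\<hh>" using \<hh> by (simp add: A.\<hh>_def H_eq)
  interpret C: splitting G LG expG M \<Phi> m \<omega> cls \<kk> \<mm> \<qq> \<hh>\<qq> \<mm>\<qq>
    by unfold_locales
      (fact \<kk>[unfolded gen_eq N_eq] \<mm>[unfolded \<hh>_eq H_eq] \<qq>[unfolded H_eq] sums[unfolded \<hh>_eq])+
  have J_eq: "J = C.J" using J by (simp add: fun_eq_iff C.J_def \<omega>V_eq genV_eq \<hh>_eq)
  note eqs = gen_eq H_eq \<omega>V_eq actV_eq J_eq
  show ?thesis
  proof (intro ballI impI)
    fix g \<rho> x
    assume g: "g \<in> carrier G" and \<rho>: "\<rho> \<in> \<mm>r" and x: "x \<in> Vr" and dom: "(D\<^sub>m \<rho> x, \<rho> + J x) \<in> dom\<tau>"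
    \<comment> \<open>On \<open>dom\<tau>\<close> the implicit map takes values in \<qq> and solves
      \<open>F = 0\<close>, which is exactly what \<open>hamiltonian_field_model\<close> asks of its
      vector \<open>s\<close>.\<close>
    have s: "\<psi> \<rho> x \<in> \<qq>" "F (D\<^sub>m \<rho> x) (\<rho> + J x) (\<psi> \<rho> x) = 0"
      using bspec[OF \<tau>(5) dom] unfolding \<psi> by simp_all
    show "hamiltonian_field Y \<omega>Y h (\<pi> (g, \<rho>, x)) = tmap Z Y \<pi> (g, \<rho>, x)
      (left_tr G LG \<one>\<^bsub>G\<^esub> g (\<psi> \<rho> x + D\<^sub>m \<rho> x),
       P\<^sub>m (coad G LG (D\<^sub>m \<rho> x) \<rho>) + P\<^sub>m (coad G LG (D\<^sub>m \<rho> x) (J x))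
         + P\<^sub>m (coad G LG (\<psi> \<rho> x) (\<rho> + J x)),
       B\<^sub>V (D\<^sub>V \<rho> x))"
      unfolding projs(1) J_eq
    proof (rule C.hamiltonian_field_model)
      show "openin (top_of_set (dual_summand \<hh>\<qq>)) \<mm>r" by (fact \<mm>r(1)[unfolded duals(2)])
      show "\<forall>k\<in>A.H. coAd G LG (inv\<^bsub>G\<^esub> k) ` \<mm>r \<subseteq> \<mm>r" by (fact \<mm>r(3)[unfolded H_eq])
      show "\<forall>k\<in>A.H. B.actV k ` Vr \<subseteq> Vr" by (fact Vr(3)[unfolded H_eq actV_eq])
      show "Z = A.slice_mfd (dual_summand \<hh>\<qq>) \<mm>r Vr"
        unfolding Z VM duals(2) A.slice_mfd_def ..
      show "\<forall>z\<in>carrier Z. \<forall>X\<in>model Z. \<forall>X'\<in>model Z. pullback Z Y \<pi> \<omega>Y z X X' =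
          pullback Z (prod_mfd (prod_mfd LG (open_mfd \<kk>s \<kk>r)) (open_mfd UNIV Vr))
            (\<lambda>(g, \<rho>, x). ((g, \<rho> + C.J x), x)) (form_sum \<Omega> (\<lambda>_. B.\<omega>V)) z X X'"
        by (fact \<omega>Y(2)[unfolded l K VM J_eq \<omega>V_eq])
      show "\<forall>g\<in>carrier G. \<forall>y\<in>carrier Y. h ((\<lambda>(g', \<rho>, x). (g \<otimes>\<^bsub>G\<^esub> g', \<rho>, x)) ` y) = h y"
        by (fact h(2)[unfolded actY])
      show "D\<^sub>m \<rho> x = (THE \<xi>. \<xi> \<in> \<mm> \<and> (\<forall>\<sigma>\<in>dual_summand \<hh>\<qq>.
          blinfun_apply \<sigma> \<xi> = frechet_derivative (\<lambda>\<rho>. hr \<rho> x) (at \<rho> within \<mm>r) \<sigma>))"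
        unfolding D\<^sub>m duals(2) ..
      show "B\<^sub>V (D\<^sub>V \<rho> x) = (THE y. \<forall>w. B.\<omega>V y w = frechet_derivative (\<lambda>x. hr \<rho> x) (at x) w)"
        unfolding B\<^sub>V D\<^sub>V \<omega>V_eq ..
      show "dual_proj \<qq> \<kk> (coad G LG (D\<^sub>m \<rho> x + \<psi> \<rho> x) (\<rho> + C.J x))
          + Blinfun (\<lambda>\<eta>. \<omega> m (A.gen (\<psi> \<rho> x)) (A.gen (proj_along \<qq> \<kk> \<eta>))) = 0"
        using s(2) unfolding F projs(2) gen_eq J_eq .
    qed (fact Vr(1) \<Omega>[unfolded gen_eq] actH[unfolded actV_eq] \<pi>[unfolded H_eq] Y \<omega>Y(1) h(1) hr g \<rho> x s(1))+
  qed
qed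

end
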